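(* Let $0<p<1$ be a constant and let $F$ be a graph (without isolated vertices) with property $(\star)$. Then with probability tending to $1$ as $n\to\infty$, $$\mathrm{sat}\left(G(n,p),F\right)\le\left(1+o(1)\right)n\log_{\frac{1}{1-p}}n.$$
   Context: $G(n,p)$ is the binomial random graph on $[n]$ with edge probability $p$. For graphs $G,F$, a subgraph $H\subseteq G$ is $F$-saturated in $G$ if $H$ contains no copy of $F$, but adding any edge of $E(G)\setminus E(H)$ creates a copy of $F$; $\mathrm{sat}(G,F)$ is the minimum number of edges of an $F$-saturated subgraph of $G$. For graphs $A,B$, $B$ is called $A$-degenerate if every two-vertex-connected subgraph of $B$ is a subgraph of $A$ (i.e. isomorphic to a subgraph of $A$). A graph $F=(V,E)$ has property $(\star)$ if there is an edge $\{u,v\}\in E$ such that for every independent set $I\subseteq V$ of $F$, the induced graph $F[V\setminus I]$ is not $F[V\setminus\{u,v\}]$-degenerate, i.e. $F[V\setminus I]$ has a two-vertex-connected subgraph which is not a subgraph of $F[V\setminus\{u,v\}]$. *)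

theory Defs
  imports "HOL-Probability.Probability" "HOL-Probability.Product_PMF"
begin

type_synonym 'a ugraph = "'a set \<times> 'a set set"

abbreviation uverts :: "'a ugraph \<Rightarrow> 'a set" where "uverts G \<equiv> fst G"
abbreviation uedges :: "'a ugraph \<Rightarrow> 'a set set" where "uedges G \<equiv> snd G"

definition all_edges :: "'a set \<Rightarrow> 'a set set" where
  "all_edges V = {e. e \<subseteq> V \<and> card e = 2}"

definition ugraph :: "'a ugraph \<Rightarrow> bool" where
  "ugraph G \<longleftrightarrow> finite (uverts G) \<and> uedges G \<subseteq> all_edges (uverts G)"

definition no_isolated_vertices :: "'a ugraph \<Rightarrow> bool" where
  "no_isolated_vertices G \<longleftrightarrow> (\<forall>v\<in>uverts G. \<exists>e\<in>uedges G. v \<in> e)"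

definition subgraph :: "'a ugraph \<Rightarrow> 'a ugraph \<Rightarrow> bool" where
  "subgraph H G \<longleftrightarrow> ugraph H \<and> uverts H \<subseteq> uverts G \<and> uedges H \<subseteq> uedges G"

definition induced :: "'a ugraph \<Rightarrow> 'a set \<Rightarrow> 'a ugraph" where
  "induced G S = (S, {e \<in> uedges G. e \<subseteq> S})"

definition isomorphic :: "'a ugraph \<Rightarrow> 'b ugraph \<Rightarrow> bool" where
  "isomorphic G H \<longleftrightarrow>
     (\<exists>f. bij_betw f (uverts G) (uverts H) \<and> (\<lambda>e. f ` e) ` uedges G = uedges H)"

definition contains_copy :: "'b ugraph \<Rightarrow> 'a ugraph \<Rightarrow> bool" where
  "contains_copy G F \<longleftrightarrow> (\<exists>H. subgraph H G \<and> isomorphic F H)"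

definition independent_set :: "'a ugraph \<Rightarrow> 'a set \<Rightarrow> bool" where
  "independent_set G I \<longleftrightarrow> I \<subseteq> uverts G \<and> (\<forall>e\<in>uedges G. \<not> e \<subseteq> I)"

definition connected_graph :: "'a ugraph \<Rightarrow> bool" where
  "connected_graph G \<longleftrightarrow> uverts G \<noteq> {} \<and>
     (\<forall>x\<in>uverts G. \<forall>y\<in>uverts G. (x, y) \<in> {(a, b). {a, b} \<in> uedges G}\<^sup>*)"

text \<open>The usual convention for k-vertex-connectivity: more than k vertices, and deleting fewer
  than k of them leaves a connected graph. Hence a single edge is not two-vertex-connected.\<close>

definition two_connected :: "'a ugraph \<Rightarrow> bool" where
  "two_connected G \<longleftrightarrow> card (uverts G) > 2 \<and> connected_graph G \<and>
     (\<forall>v\<in>uverts G. connected_graph (induced G (uverts G - {v})))"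

definition degenerate :: "'b ugraph \<Rightarrow> 'a ugraph \<Rightarrow> bool" where
  "degenerate A B \<longleftrightarrow> (\<forall>H. subgraph H B \<and> two_connected H \<longrightarrow> contains_copy A H)"

definition property_star :: "'a ugraph \<Rightarrow> bool" where
  "property_star F \<longleftrightarrow> (\<exists>u v. {u, v} \<in> uedges F \<and>
     (\<forall>I. independent_set F I \<longrightarrow>
        \<not> degenerate (induced F (uverts F - {u, v})) (induced F (uverts F - I))))"

definition add_edge :: "'a ugraph \<Rightarrow> 'a set \<Rightarrow> 'a ugraph" where
  "add_edge H e = (uverts H \<union> e, insert e (uedges H))"

text \<open>\<open>saturated F G H\<close>: H is an F-saturated subgraph of G. It need not be spanning; if F has
  no isolated vertices, this does not affect the saturation number.\<close>

definition saturated :: "'a ugraph \<Rightarrow> 'b ugraph \<Rightarrow> 'b ugraph \<Rightarrow> bool" where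
  "saturated F G H \<longleftrightarrow> subgraph H G \<and> \<not> contains_copy H F \<and>
     (\<forall>e \<in> uedges G - uedges H. contains_copy (add_edge H e) F)"

definition sat :: "'b ugraph \<Rightarrow> 'a ugraph \<Rightarrow> nat" where
  "sat G F = (LEAST m. \<exists>H. saturated F G H \<and> card (uedges H) = m)"

lemma saturated_exists:
  assumes G: "ugraph G" and F: "uedges F \<noteq> {}"
  shows "\<exists>H. saturated F G H"
proof -
  let ?S = "{E. E \<subseteq> uedges G \<and> \<not> contains_copy (uverts G, E) F}"
  have "finite (uedges G)"
    using G unfolding ugraph_def all_edges_def
    by (auto intro: finite_subset[where B = "Pow (uverts G)"])
  then have fin: "finite ?S"
    by (auto intro: finite_subset[where B = "Pow (uedges G)"])
  have "{} \<in> ?S"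
    using F by (auto simp: contains_copy_def subgraph_def isomorphic_def)
  then obtain E where E: "E \<in> ?S" and max: "\<And>E'. E' \<in> ?S \<Longrightarrow> E \<subseteq> E' \<Longrightarrow> E' = E"
    using finite_has_maximal2[OF fin] by (metis (no_types, lifting))
  have "saturated F G (uverts G, E)"
    unfolding saturated_def
  proof (intro conjI ballI)
    show "subgraph (uverts G, E) G"
      using E G by (auto simp: subgraph_def ugraph_def)
    show "\<not> contains_copy (uverts G, E) F" using E by simp
    fix e assume e: "e \<in> uedges G - uedges (uverts G, E)"
    then have "add_edge (uverts G, E) e = (uverts G, insert e E)"
      using G by (auto simp: add_edge_def ugraph_def all_edges_def)
    moreover have "insert e E \<notin> ?S" using e max[of "insert e E"] by auto
    ultimately show "contains_copy (add_edge (uverts G, E) e) F" using e E by auto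
  qed
  then show ?thesis by blast
qed

definition gnp :: "nat \<Rightarrow> real \<Rightarrow> nat ugraph pmf" where
  "gnp n p = map_pmf (\<lambda>\<omega>. ({1..n}, {e \<in> all_edges {1..n}. \<omega> e}))
     (Pi_pmf (all_edges {1..n}) False (\<lambda>_. bernoulli_pmf p))"

end

theory Submission
  imports Defs "HOL-Real_Asymp.Real_Asymp"
begin

text \<open>Let \<open>{u, v}\<close> be the edge given by the star property, let \<open>F0\<close> be \<open>F\<close> without \<open>u\<close> and \<open>v\<close>, and let
  \<open>l\<close> be the logarithm of \<open>n\<close> to base \<open>1 / (1 - p)\<close>. Among all partitions \<open>V = I \<union> R \<union> T\<close> with \<open>I\<close>
  independent and \<open>R\<close>, \<open>T\<close> inducing \<open>F0\<close>-degenerate graphs, choose one, \<open>(Is, Rs, Ts)\<close>, that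
  lexicographically minimises the largest components of the part of \<open>T\<close> adjacent to \<open>R\<close> and of the part of
  \<open>R\<close> adjacent to \<open>T\<close>. A sparse random hypergraph provides a fixed finite graph \<open>\<Gamma>\<close> on \<open>N\<close> vertices
  whose small two-connected subgraphs all embed into \<open>F0\<close>, while every subset of \<open>\<delta> N\<close> vertices contains
  \<open>F0\<close> and an induced copy of \<open>Rs\<close>.

  In the random graph place disjoint copies of \<open>\<Gamma>\<close> on sets \<open>A1\<close> (about \<open>(1 + \<epsilon>) l / p\<close> vertices) and \<open>A2\<close>
  (\<open>C l\<close> vertices), and boundedly many copies of \<open>Ts\<close> (the bodies), each wired to \<open>A2\<close> as \<open>Ts\<close> is to \<open>Rs\<close>.
  All remaining vertices are joined to \<open>A1\<close>; those of small degree into \<open>A1\<close> form \<open>X\<close> and are also joined to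
  \<open>A2\<close>, the others form \<open>B\<close> and are joined to the bodies. This graph contains no copy of \<open>F\<close>, since a copy
  would yield a partition beating the minimal one. It has \<open>(1 + o(1)) n l\<close> edges. Take any maximal
  extension of it without a copy of \<open>F\<close>. Two outer vertices with many common neighbours in \<open>A1\<close> (or two
  vertices of \<open>X\<close> with many in \<open>A2\<close>) cannot be adjacent in the extension, since their edge would complete
  \<open>F0\<close> to \<open>F\<close>; and only boundedly many vertices of \<open>B\<close> per copy of \<open>\<Gamma>\<close> have many neighbours in \<open>A2\<close>,
  since otherwise they would play the role of \<open>Is\<close>. Chernoff bounds show that only \<open>o(n l)\<close> further edges
  are possible.\<close>


subsection \<open>Embeddings and degeneracy\<close>

text \<open>The budget of about \<open>n * l\<close> edges dictates the shape of the host. If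
  \<open>x\<close> has more than \<open>(1 + \<epsilon> / 2) * l\<close> neighbours in
  \<open>A1\<close>, a given second vertex shares few of them with probability only slightly below
  \<open>1 / n\<close>. So about \<open>n\<close> pairs escape control, which is affordable, and
  \<open>A1\<close> cannot be made smaller by a constant factor. Vertices of lower degree are rare,
  but the pairs among them may still be too many. They get a second, generously large set
  \<open>A2\<close>, and joining every vertex to \<open>A2\<close> would break the budget. Edges
  between \<open>B\<close> and \<open>A2\<close> therefore have to be kept scarce in another way: a
  body wired to \<open>A2\<close> is a copy of the forbidden graph that lacks only its independent
  part. The price is that the host might now contain the forbidden graph by itself, and the minimal
  choice of the decomposition rules this out. Two-connectivity is the right notion because a graph
  may be glued from copies of \<open>F0\<close> in a locally tree-like way: large vertex sets then
  contain \<open>F0\<close>, while small two-connected pieces never leave one of the glued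
  copies.\<close>

definition emb :: "('a \<Rightarrow> 'b) \<Rightarrow> 'a ugraph \<Rightarrow> 'b ugraph \<Rightarrow> bool" where
  "emb f G H \<longleftrightarrow> inj_on f (uverts G) \<and> f ` uverts G \<subseteq> uverts H \<and> (\<forall>e\<in>uedges G. f ` e \<in> uedges H)"

definition map_graph :: "('a \<Rightarrow> 'b) \<Rightarrow> 'a ugraph \<Rightarrow> 'b ugraph" where
  "map_graph f G = (f ` uverts G, (`) f ` uedges G)"

lemma ugraph_edgeD:
  assumes "ugraph G" "{x, y} \<in> uedges G"
  shows "x \<in> uverts G" "y \<in> uverts G" "x \<noteq> y"
proof -
  have "{x, y} \<subseteq> uverts G \<and> card {x, y} = 2"
    using assms by (auto simp: ugraph_def all_edges_def)
  then show "x \<in> uverts G" "y \<in> uverts G" "x \<noteq> y" by auto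
qed

lemma ugraph_edgeE:
  assumes "ugraph G" "e \<in> uedges G"
  obtains x y where "e = {x, y}" "x \<in> uverts G" "y \<in> uverts G" "x \<noteq> y"
proof -
  have "e \<subseteq> uverts G" "card e = 2"
    using assms by (auto simp: ugraph_def all_edges_def)
  then show ?thesis using that by (auto simp: card_2_iff)
qed

lemma finite_uedges: "ugraph G \<Longrightarrow> finite (uedges G)"
  unfolding ugraph_def all_edges_def
  by (auto intro: finite_subset[where B = "Pow (uverts G)"])

lemma ugraph_induced: "ugraph G \<Longrightarrow> S \<subseteq> uverts G \<Longrightarrow> ugraph (induced G S)"
  by (auto simp: ugraph_def induced_def all_edges_def finite_subset)

lemma uverts_induced [simp]: "uverts (induced G S) = S"
  by (simp add: induced_def)

lemma uedges_induced [simp]: "uedges (induced G S) = {e \<in> uedges G. e \<subseteq> S}"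
  by (simp add: induced_def)

lemma ugraph_map_graph:
  assumes "ugraph G" "inj_on f (uverts G)"
  shows "ugraph (map_graph f G)"
proof -
  have "f ` e \<in> all_edges (f ` uverts G)" if "e \<in> uedges G" for e
  proof -
    have e: "e \<subseteq> uverts G" "card e = 2"
      using that assms by (auto simp: ugraph_def all_edges_def)
    then have "card (f ` e) = card e"
      using assms(2) by (meson card_image inj_on_subset)
    then show ?thesis using e by (auto simp: all_edges_def)
  qed
  then show ?thesis using assms by (auto simp: ugraph_def map_graph_def)
qed

lemma contains_copy_iff_emb:
  assumes "ugraph F"
  shows "contains_copy G F \<longleftrightarrow> (\<exists>f. emb f F G)"
proof
  assume "contains_copy G F"
  then obtain K f where K: "subgraph K G" "bij_betw f (uverts F) (uverts K)"
    "(\<lambda>e. f ` e) ` uedges F = uedges K"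
    by (auto simp: contains_copy_def isomorphic_def)
  then have "emb f F G"
    unfolding emb_def subgraph_def by (auto simp: bij_betw_def)
  then show "\<exists>f. emb f F G" by blast
next
  assume "\<exists>f. emb f F G"
  then obtain f where f: "emb f F G" ..
  have "subgraph (map_graph f F) G"
    using f ugraph_map_graph[OF assms, of f]
    by (auto simp: subgraph_def emb_def map_graph_def)
  moreover have "isomorphic F (map_graph f F)"
    unfolding isomorphic_def
    by (rule exI[of _ f]) (use f in \<open>auto simp: emb_def map_graph_def bij_betw_def\<close>)
  ultimately show "contains_copy G F" unfolding contains_copy_def by blast
qed

lemma degenerate_iff_emb:
  "degenerate A B \<longleftrightarrow> (\<forall>J. subgraph J B \<and> two_connected J \<longrightarrow> (\<exists>f. emb f J A))"
  unfolding degenerate_def using contains_copy_iff_emb by (metis subgraph_def)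

lemma emb_comp:
  assumes "emb f G H" "emb g H K"
  shows "emb (g \<circ> f) G K"
  unfolding emb_def
proof (intro conjI ballI)
  show "inj_on (g \<circ> f) (uverts G)"
    using assms unfolding emb_def by (meson comp_inj_on inj_on_subset)
  show "(g \<circ> f) ` uverts G \<subseteq> uverts K"
    using assms unfolding emb_def image_comp[symmetric] by blast
  show "(g \<circ> f) ` e \<in> uedges K" if "e \<in> uedges G" for e
    using assms that unfolding emb_def image_comp[symmetric] by blast
qed

lemma emb_subgraph: "emb f G H \<Longrightarrow> subgraph J G \<Longrightarrow> emb f J H"
  unfolding emb_def subgraph_def by (auto intro: inj_on_subset)

lemma emb_map_graph: "inj_on f (uverts G) \<Longrightarrow> emb f G (map_graph f G)"
  by (auto simp: emb_def map_graph_def)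

lemma subgraph_map_graph:
  assumes "emb f G H" "subgraph J G"
  shows "subgraph (map_graph f J) H"
proof -
  have e: "emb f J H" using emb_subgraph assms .
  have "ugraph (map_graph f J)"
    by (rule ugraph_map_graph) (use e assms(2) in \<open>simp_all add: emb_def subgraph_def\<close>)
  then show ?thesis using e by (auto simp: subgraph_def emb_def map_graph_def)
qed

lemma connected_graph_map:
  assumes "connected_graph G"
  shows "connected_graph (map_graph f G)"
proof -
  have *: "(f x, f y) \<in> {(a, b). {a, b} \<in> uedges (map_graph f G)}\<^sup>*"
    if "(x, y) \<in> {(a, b). {a, b} \<in> uedges G}\<^sup>*" for x y
    using that
  proof (induction rule: rtrancl_induct)
    case (step y z)
    then have "f ` {y, z} \<in> uedges (map_graph f G)"
      unfolding map_graph_def by (metis CollectD case_prodD imageI snd_conv)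
    then have "(f y, f z) \<in> {(a, b). {a, b} \<in> uedges (map_graph f G)}" by simp
    then show ?case using step by (meson rtrancl.rtrancl_into_rtrancl)
  qed auto
  then show ?thesis
    using assms unfolding connected_graph_def by (auto simp: map_graph_def)
qed

lemma induced_map_graph:
  assumes "ugraph G" "inj_on f (uverts G)" "x \<in> uverts G"
  shows "induced (map_graph f G) (uverts (map_graph f G) - {f x})
    = map_graph f (induced G (uverts G - {x}))"
proof -
  have eq: "f ` uverts G - {f x} = f ` (uverts G - {x})"
    using assms by (simp add: inj_on_image_set_diff)
  have "f ` e \<subseteq> f ` (uverts G - {x}) \<longleftrightarrow> e \<subseteq> uverts G - {x}" if "e \<in> uedges G" for e
  proof -
    have "e \<subseteq> uverts G" using that assms by (auto simp: ugraph_def all_edges_def)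
    then show ?thesis
      by (meson Diff_subset assms(2) inj_on_image_subset_iff)
  qed
  then show ?thesis
    using eq unfolding induced_def map_graph_def by auto
qed

lemma two_connected_map:
  assumes "ugraph G" "inj_on f (uverts G)" "two_connected G"
  shows "two_connected (map_graph f G)"
proof -
  have "connected_graph (induced (map_graph f G) (uverts (map_graph f G) - {y}))"
    if "y \<in> uverts (map_graph f G)" for y
  proof -
    have "y \<in> f ` uverts G" using that by (simp add: map_graph_def)
    then obtain x where x: "x \<in> uverts G" "y = f x" by blast
    then show ?thesis
      using induced_map_graph[OF assms(1,2) x(1)]
        connected_graph_map[of "induced G (uverts G - {x})" f] assms(3)
      by (metis two_connected_def)
  qed
  moreover have "card (uverts (map_graph f G)) = card (uverts G)"
    using assms(2) by (simp add: map_graph_def card_image)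
  ultimately show ?thesis
    using assms(3) connected_graph_map[of G f] unfolding two_connected_def by simp
qed

text \<open>Two-connectedness passes to injective images, even if these have additional edges around
  them, so degeneracy is inherited along arbitrary embeddings and not only by literal
  subgraphs.\<close>

lemma degenerate_emb:
  assumes "degenerate A B'" "emb g B B'"
  shows "degenerate A B"
  unfolding degenerate_iff_emb
proof (intro allI impI, elim conjE)
  fix J assume J: "subgraph J B" "two_connected J"
  have inj: "inj_on g (uverts J)"
    using assms(2) J by (auto simp: emb_def subgraph_def intro: inj_on_subset)
  have "two_connected (map_graph g J)"
    by (rule two_connected_map) (use J inj in \<open>simp_all add: subgraph_def\<close>)
  then obtain f where "emb f (map_graph g J) A"
    using subgraph_map_graph[OF assms(2) J(1)] assms(1) unfolding degenerate_iff_emb by blast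
  then show "\<exists>f. emb f J A"
    using emb_comp[OF emb_map_graph[OF inj]] by blast
qed

text \<open>The working form of connectivity: a vertex set that is closed under edges and is met
  once contains every vertex.\<close>

lemma connected_graph_closed:
  assumes "connected_graph G" "x \<in> uverts G" "x \<in> S" "y \<in> uverts G"
    and "\<And>a b. {a, b} \<in> uedges G \<Longrightarrow> a \<in> S \<Longrightarrow> b \<in> S"
  shows "y \<in> S"
proof -
  have "(x, y) \<in> {(a, b). {a, b} \<in> uedges G}\<^sup>*"
    using assms unfolding connected_graph_def by auto
  then show ?thesis
    by (induction rule: rtrancl_induct) (use assms in auto)
qed

text \<open>Meant for labels such as the index of the copy or the body that contains a vertex: a
  label preserved by edges confines a connected piece to one copy.\<close>

lemma connected_graph_constant:
  assumes "connected_graph G" "\<And>a b. {a, b} \<in> uedges G \<Longrightarrow> h a = h b"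
    and "x \<in> uverts G" "y \<in> uverts G"
  shows "h x = h y"
  using connected_graph_closed[of G x "{z. h z = h x}" y] assms by auto

lemma connected_graph_mono:
  assumes "connected_graph G" "uverts G = uverts H" "uedges G \<subseteq> uedges H"
  shows "connected_graph H"
proof -
  have "{(a, b). {a, b} \<in> uedges G}\<^sup>* \<subseteq> {(a, b). {a, b} \<in> uedges H}\<^sup>*"
    using assms by (intro rtrancl_mono) auto
  moreover have "uverts H \<noteq> {}" "\<forall>x\<in>uverts H. \<forall>y\<in>uverts H. (x, y) \<in> {(a, b). {a, b} \<in> uedges G}\<^sup>*"
    using assms unfolding connected_graph_def by simp_all
  ultimately show ?thesis unfolding connected_graph_def by blast
qed

lemma connected_induced_insert:
  assumes "connected_graph (induced G K)" "x \<in> K" "{x, c} \<in> uedges G"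
  shows "connected_graph (induced G (insert c K))"
proof -
  let ?r = "{(a, b). {a, b} \<in> uedges (induced G (insert c K))}"
  have mono: "{(a, b). {a, b} \<in> uedges (induced G K)}\<^sup>* \<subseteq> ?r\<^sup>*"
    by (intro rtrancl_mono) auto
  have K: "(a, b) \<in> ?r\<^sup>*" if "a \<in> K" "b \<in> K" for a b
    using assms(1) that mono unfolding connected_graph_def by auto
  have xc: "(x, c) \<in> ?r" "(c, x) \<in> ?r" using assms by (auto simp: insert_commute)
  have c1: "(a, c) \<in> ?r\<^sup>*" if "a \<in> K" for a
    using K[OF that assms(2)] xc by (meson rtrancl.rtrancl_into_rtrancl)
  have c2: "(c, a) \<in> ?r\<^sup>*" if "a \<in> K" for a
    using K[OF assms(2) that] xc by (meson converse_rtrancl_into_rtrancl)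
  show ?thesis
    unfolding connected_graph_def using K c1 c2 by auto
qed

subsection \<open>Minimal decompositions of a graph with the star property\<close>

locale star_graph =
  fixes F :: "'a ugraph" and u v :: 'a
  assumes ugraph_F: "ugraph F"
    and uv: "{u, v} \<in> uedges F"
    and star: "\<And>I. independent_set F I \<Longrightarrow>
      \<not> degenerate (induced F (uverts F - {u, v})) (induced F (uverts F - I))"
begin

abbreviation "V \<equiv> uverts F"
abbreviation "E \<equiv> uedges F"
abbreviation "F0 \<equiv> induced F (V - {u, v})"

definition deg :: "'a set \<Rightarrow> bool" where
  "deg S \<longleftrightarrow> degenerate F0 (induced F S)"

definition nb :: "'a set \<Rightarrow> 'a set" where
  "nb S = {x. \<exists>y\<in>S. {x, y} \<in> E}"

text \<open>A bound on the component sizes of the graph induced by \<open>S\<close>. Quantifying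
  over all connected subsets avoids a definition of components.\<close>

definition cb :: "'a set \<Rightarrow> nat \<Rightarrow> bool" where
  "cb S h \<longleftrightarrow> (\<forall>K\<subseteq>S. connected_graph (induced F K) \<longrightarrow> card K \<le> h)"

definition conf :: "'a set \<Rightarrow> 'a set \<Rightarrow> 'a set \<Rightarrow> bool" where
  "conf I R T \<longleftrightarrow> I \<union> R \<union> T = V \<and> I \<inter> R = {} \<and> I \<inter> T = {} \<and> R \<inter> T = {} \<and>
     independent_set F I \<and> deg R \<and> deg T"

lemma finite_V: "finite V" using ugraph_F by (auto simp: ugraph_def)

lemma E_V: "{x, y} \<in> E \<Longrightarrow> x \<in> V \<and> y \<in> V \<and> x \<noteq> y"
  using ugraph_edgeD[OF ugraph_F] by blast

lemma E_sym: "{x, y} \<in> E \<Longrightarrow> {y, x} \<in> E" by (simp add: insert_commute)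

lemma indepI:
  assumes "I \<subseteq> V" "\<And>x y. x \<in> I \<Longrightarrow> y \<in> I \<Longrightarrow> {x, y} \<notin> E"
  shows "independent_set F I"
  unfolding independent_set_def
proof (intro conjI ballI notI)
  fix e assume "e \<in> E" "e \<subseteq> I"
  then show False using assms(2) by (metis insert_subset ugraph_edgeE[OF ugraph_F])
qed (use assms in auto)

lemma indepD: "independent_set F I \<Longrightarrow> x \<in> I \<Longrightarrow> y \<in> I \<Longrightarrow> {x, y} \<notin> E"
  unfolding independent_set_def by auto

lemma deg_avoid: "S \<subseteq> V \<Longrightarrow> u \<notin> S \<Longrightarrow> v \<notin> S \<Longrightarrow> deg S"
  unfolding deg_def degenerate_iff_emb
  by (intro allI impI exI[of _ id]) (auto simp: emb_def subgraph_def)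

text \<open>A two-connected subgraph is connected, so it lies on one side of a partition without
  crossing edges.\<close>

lemma deg_Un:
  assumes "deg S" "deg T" "S \<inter> T = {}" "\<And>x y. x \<in> S \<Longrightarrow> y \<in> T \<Longrightarrow> {x, y} \<notin> E"
  shows "deg (S \<union> T)"
  unfolding deg_def degenerate_iff_emb
proof (intro allI impI, elim conjE)
  fix J assume J: "subgraph J (induced F (S \<union> T))" "two_connected J"
  then have con: "connected_graph J" by (simp add: two_connected_def)
  then obtain x where x: "x \<in> uverts J" by (auto simp: connected_graph_def)
  have edge: "{a, b} \<in> E \<and> a \<in> S \<union> T \<and> b \<in> S \<union> T" if "{a, b} \<in> uedges J" for a b
    using that J by (auto simp: subgraph_def)
  have one: "\<exists>Z\<in>{S, T}. uverts J \<subseteq> Z"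
  proof (cases "x \<in> S")
    case True
    have "uverts J \<subseteq> S"
      using connected_graph_closed[OF con x True] edge assms by blast
    then show ?thesis by auto
  next
    case False
    then have xT: "x \<in> T" using x J by (auto simp: subgraph_def)
    have "uverts J \<subseteq> T"
      using connected_graph_closed[OF con x xT] edge assms E_sym by blast
    then show ?thesis by auto
  qed
  then obtain Z where Z: "Z \<in> {S, T}" "uverts J \<subseteq> Z" by auto
  have "subgraph J (induced F Z)"
    using J Z unfolding subgraph_def ugraph_def all_edges_def by auto
  then show "\<exists>f. emb f J F0"
    using J(2) Z(1) assms(1,2) unfolding deg_def degenerate_iff_emb by blast
qed

lemma not_deg_compl: "independent_set F I \<Longrightarrow> \<not> deg (V - I)"
  using star unfolding deg_def by auto

text \<open>Every vertex outside a maximal independent subset has a neighbour in it, so each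
  connected set avoiding the subset can be enlarged by one vertex.\<close>

lemma cb_remove_independent:
  assumes "S \<subseteq> V" "C0 \<subseteq> S" "independent_set F C0" "cb S h"
  obtains C where "C0 \<subseteq> C" "C \<subseteq> S" "independent_set F C" "cb (S - C) (h - 1)"
proof -
  let ?M = "{C. C0 \<subseteq> C \<and> C \<subseteq> S \<and> independent_set F C}"
  have "finite ?M" using finite_subset[OF assms(1) finite_V] by auto
  moreover have "C0 \<in> ?M" using assms by auto
  ultimately obtain C where C: "C \<in> ?M" and max: "\<And>C'. C' \<in> ?M \<Longrightarrow> C \<subseteq> C' \<Longrightarrow> C' = C"
    using finite_has_maximal2[of ?M C0] by (metis (no_types, lifting))
  have "cb (S - C) (h - 1)"
    unfolding cb_def
  proof (intro allI impI)
    fix K assume K: "K \<subseteq> S - C" "connected_graph (induced F K)"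
    then obtain x where x: "x \<in> K" by (auto simp: connected_graph_def)
    have "insert x C \<notin> ?M" using max[of "insert x C"] x K by auto
    then have "\<not> independent_set F (insert x C)" using C x K by auto
    then obtain y z where yz: "y \<in> insert x C" "z \<in> insert x C" "{y, z} \<in> E"
      using indepI[of "insert x C"] C x K assms(1) by blast
    have "{y, z} \<notin> E" if "y \<in> C" "z \<in> C" using indepD that C by blast
    then obtain c where c: "c \<in> C" "{x, c} \<in> E"
      using yz E_V[OF yz(3)] E_sym by blast
    have "insert c K \<subseteq> S" using c C K by blast
    then have "card (insert c K) \<le> h"
      using assms(4) connected_induced_insert[OF K(2) x c(2)] unfolding cb_def by blast
    moreover have "finite K" using K assms(1) finite_V by (meson Diff_subset finite_subset)
    moreover have "c \<notin> K" using c K by blast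
    ultimately show "card K \<le> h - 1" by simp
  qed
  then show ?thesis using that C by auto
qed

lemma cb_0: "S \<subseteq> V \<Longrightarrow> cb S 0 \<Longrightarrow> S = {}"
proof (rule ccontr)
  assume S: "S \<subseteq> V" "cb S 0" "S \<noteq> {}"
  then obtain x where x: "x \<in> S" by auto
  have "connected_graph (induced F {x})" by (auto simp: connected_graph_def)
  then have "card {x} \<le> 0" using S(2) x unfolding cb_def by (metis empty_subsetI insert_subset)
  then show False by simp
qed

lemma cb_mono: "cb S h \<Longrightarrow> S' \<subseteq> S \<Longrightarrow> cb S' h"
  unfolding cb_def by auto

lemma cb_card: "S \<subseteq> V \<Longrightarrow> cb S (card V)"
  unfolding cb_def using finite_V by (meson card_mono order_trans)

text \<open>Without an edge between \<open>R\<close> and \<open>T\<close> their union would be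
  degenerate by \<open>deg_Un\<close>, although it is the complement of an independent set. Both
  crossing parts being nonempty makes the two minimal parameters positive.\<close>

lemma conf_crossing:
  assumes "conf I R T"
  shows "nb R \<inter> T \<noteq> {}" "nb T \<inter> R \<noteq> {}"
proof -
  have *: "V - I = R \<union> T" using assms unfolding conf_def by auto
  have no: "\<not> deg (R \<union> T)"
    using not_deg_compl[of I] assms * unfolding conf_def by auto
  show "nb R \<inter> T \<noteq> {}" "nb T \<inter> R \<noteq> {}"
    using no deg_Un[of R T] assms E_sym unfolding conf_def nb_def by blast+
qed

text \<open>The subtractions are on natural numbers; they express a genuine decrease because
  \<open>a\<close> and \<open>b\<close> are positive by \<open>conf_crossing\<close>. The second
  negated clause is the second coordinate of the lexicographic order: \<open>b\<close> may only be
  compared while \<open>a\<close> is kept.\<close>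

definition minimal_conf :: "'a set \<Rightarrow> 'a set \<Rightarrow> 'a set \<Rightarrow> nat \<Rightarrow> nat \<Rightarrow> bool" where
  "minimal_conf I R T a b \<longleftrightarrow> conf I R T \<and> cb (nb R \<inter> T) a \<and> cb (nb T \<inter> R) b \<and>
    (\<forall>I' R' T'. conf I' R' T' \<longrightarrow> \<not> cb (nb R' \<inter> T') (a - 1) \<and>
      \<not> (cb (nb R' \<inter> T') a \<and> cb (nb T' \<inter> R') (b - 1)))"

lemma nb_V: "nb S \<subseteq> V" unfolding nb_def using E_V by auto

lemma minimal_conf_exists: "\<exists>I R T a b. minimal_conf I R T a b"
proof -
  have uV: "u \<in> V" "v \<in> V" "u \<noteq> v" using E_V[OF uv] by auto
  \<comment> \<open>A two-connected graph has more than two vertices, so single vertices are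
    degenerate. This gives a first decomposition \<open>{v}\<close>, \<open>{u}\<close>,
    \<open>V - {u, v}\<close> from which to minimise.\<close>
  have degu: "deg {u}"
    unfolding deg_def degenerate_iff_emb
  proof (intro allI impI)
    fix J assume J: "subgraph J (induced F {u}) \<and> two_connected J"
    then have "card (uverts J) \<le> card {u}" by (intro card_mono) (auto simp: subgraph_def)
    then show "\<exists>f. emb f J F0" using J by (auto simp: two_connected_def)
  qed
  have "independent_set F {v}" by (rule indepI) (use uV E_V in blast)+
  then have c0: "conf {v} {u} (V - {u, v})"
    unfolding conf_def using uV degu deg_avoid[of "V - {u, v}"] by auto
  define Pa where "Pa a \<longleftrightarrow> (\<exists>I R T. conf I R T \<and> cb (nb R \<inter> T) a)" for a
  define a where "a = (LEAST a. Pa a)"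
  have "Pa (card V)" unfolding Pa_def using c0 cb_card nb_V by blast
  then have Pa: "Pa a" unfolding a_def by (rule LeastI)
  have less_a: "\<not> Pa a'" if "a' < a" for a' using that unfolding a_def by (rule not_less_Least)
  define Pb where "Pb b \<longleftrightarrow> (\<exists>I R T. conf I R T \<and> cb (nb R \<inter> T) a \<and> cb (nb T \<inter> R) b)" for b
  define b where "b = (LEAST b. Pb b)"
  have "Pb (card V)" using Pa unfolding Pa_def Pb_def using cb_card nb_V by blast
  then have Pb: "Pb b" unfolding b_def by (rule LeastI)
  have less_b: "\<not> Pb b'" if "b' < b" for b' using that unfolding b_def by (rule not_less_Least)
  obtain I R T where c: "conf I R T" "cb (nb R \<inter> T) a" "cb (nb T \<inter> R) b"
    using Pb unfolding Pb_def by auto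
  have "a \<noteq> 0" using conf_crossing(1)[OF c(1)] cb_0[of "nb R \<inter> T"] c(2) nb_V[of R] by auto
  moreover have "b \<noteq> 0" using conf_crossing(2)[OF c(1)] cb_0[of "nb T \<inter> R"] c(3) nb_V[of T] by auto
  ultimately have "minimal_conf I R T a b"
    unfolding minimal_conf_def using c less_a[of "a - 1"] less_b[of "b - 1"]
    unfolding Pa_def Pb_def by auto
  then show ?thesis by blast
qed

text \<open>Injectivity is demanded on connected sets only, because \<open>g\<close> will identify
  vertices of different components, for example equal positions in two different bodies.\<close>

lemma cb_transfer:
  assumes "cb S' h" "S \<subseteq> V" "g ` S \<subseteq> S'"
    and "\<And>K. K \<subseteq> S \<Longrightarrow> connected_graph (induced F K) \<Longrightarrow> inj_on g K"
    and "\<And>x y. x \<in> S \<Longrightarrow> y \<in> S \<Longrightarrow> {x, y} \<in> E \<Longrightarrow> {g x, g y} \<in> E"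
  shows "cb S h"
  unfolding cb_def
proof (intro allI impI)
  fix K assume K: "K \<subseteq> S" "connected_graph (induced F K)"
  have "connected_graph (map_graph g (induced F K))" using connected_graph_map K by blast
  then have "connected_graph (induced F (g ` K))"
  proof (rule connected_graph_mono)
    show "uverts (map_graph g (induced F K)) = uverts (induced F (g ` K))"
      by (simp add: map_graph_def)
    show "uedges (map_graph g (induced F K)) \<subseteq> uedges (induced F (g ` K))"
    proof
      fix e assume "e \<in> uedges (map_graph g (induced F K))"
      then obtain e' where e': "e' \<in> E" "e' \<subseteq> K" "e = g ` e'" by (auto simp: map_graph_def)
      obtain x y where "e' = {x, y}" using ugraph_edgeE[OF ugraph_F e'(1)] by metis
      then show "e \<in> uedges (induced F (g ` K))" using e' K assms(5) by auto
    qed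
  qed
  moreover have "g ` K \<subseteq> S'" using K assms(3) by auto
  ultimately have "card (g ` K) \<le> h" using assms(1) unfolding cb_def by auto
  then show "card K \<le> h" using card_image[OF assms(4)[OF K]] by simp
qed

text \<open>The sets describe how a copy of the graph meets the vertex classes of the host graph built
  below. Vertices of \<open>T\<close> in the body \<open>\<iota>\<close> carry a position in \<open>Ts\<close>, and the vertices of \<open>R\<close>
  attached to the body \<open>i\<close> carry the position \<open>pR i\<close> in \<open>Rs\<close>. Moving a maximal independent set
  of attachment vertices into the independent part yields a decomposition that beats the
  minimal one; which side has to be moved depends on where \<open>u\<close> and \<open>v\<close> lie.\<close>

lemma no_layered_decomposition:
  fixes \<iota> :: "'a \<Rightarrow> 'i" and \<kappa> :: "'a \<Rightarrow> 'k"
  assumes min: "minimal_conf Is Rs Ts a b"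
    and V: "V = X \<union> B \<union> A \<union> R \<union> T"
    and disj: "X \<inter> B = {}" "X \<inter> A = {}" "X \<inter> R = {}" "X \<inter> T = {}" "B \<inter> A = {}" "B \<inter> R = {}"
      "B \<inter> T = {}" "A \<inter> R = {}" "A \<inter> T = {}" "R \<inter> T = {}"
    and eX: "\<And>x y. {x, y} \<in> E \<Longrightarrow> x \<in> X \<Longrightarrow> y \<in> A \<union> R"
    and eB: "\<And>x y. {x, y} \<in> E \<Longrightarrow> x \<in> B \<Longrightarrow> y \<in> A \<union> T"
    and eA: "\<And>x y. {x, y} \<in> E \<Longrightarrow> x \<in> A \<Longrightarrow> y \<in> X \<union> B \<union> A"
    and degA: "deg A" and degR: "deg R"
    and T\<iota>: "\<And>x y. {x, y} \<in> E \<Longrightarrow> x \<in> T \<Longrightarrow> y \<in> T \<Longrightarrow> \<iota> x = \<iota> y"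
    and Tinj: "\<And>x y. x \<in> T \<Longrightarrow> y \<in> T \<Longrightarrow> \<iota> x = \<iota> y \<Longrightarrow> pT x = pT y \<Longrightarrow> x = y"
    and Tpos: "\<And>x. x \<in> T \<Longrightarrow> pT x \<in> Ts"
    and Tedge: "\<And>x y. {x, y} \<in> E \<Longrightarrow> x \<in> T \<Longrightarrow> y \<in> T \<Longrightarrow> {pT x, pT y} \<in> E"
    and RT: "\<And>r t. {r, t} \<in> E \<Longrightarrow> r \<in> R \<Longrightarrow> t \<in> T \<Longrightarrow> pR (\<iota> t) r \<in> Rs \<and> {pR (\<iota> t) r, pT t} \<in> E"
    and R\<kappa>: "\<And>x y. {x, y} \<in> E \<Longrightarrow> x \<in> R \<Longrightarrow> y \<in> R \<Longrightarrow> \<kappa> x = \<kappa> y"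
    and Rinj: "\<And>r r' t t'. {r, t} \<in> E \<Longrightarrow> {r', t'} \<in> E \<Longrightarrow> r \<in> R \<Longrightarrow> r' \<in> R \<Longrightarrow> t \<in> T \<Longrightarrow> t' \<in> T \<Longrightarrow>
      \<iota> t = \<iota> t' \<Longrightarrow> \<kappa> r = \<kappa> r' \<Longrightarrow> pR (\<iota> t) r = pR (\<iota> t) r' \<Longrightarrow> r = r'"
    and Redge: "\<And>r r' t t'. {r, t} \<in> E \<Longrightarrow> {r', t'} \<in> E \<Longrightarrow> r \<in> R \<Longrightarrow> r' \<in> R \<Longrightarrow> t \<in> T \<Longrightarrow> t' \<in> T \<Longrightarrow>
      \<iota> t = \<iota> t' \<Longrightarrow> {r, r'} \<in> E \<Longrightarrow> {pR (\<iota> t) r, pR (\<iota> t) r'} \<in> E"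
  shows False
proof -
  have best: "\<not> cb (nb R' \<inter> T') (a - 1)" "\<not> (cb (nb R' \<inter> T') a \<and> cb (nb T' \<inter> R') (b - 1))"
    if "conf I' R' T'" for I' R' T'
    using min that unfolding minimal_conf_def by blast+
  have cba: "cb (nb Rs \<inter> Ts) a" and cbb: "cb (nb Ts \<inter> Rs) b" and degTs: "deg Ts"
    using min unfolding minimal_conf_def conf_def by auto
  have uV: "u \<in> V" "v \<in> V" "u \<noteq> v" using E_V[OF uv] by auto
  have vu: "{v, u} \<in> E" using uv E_sym by auto
  \<comment> \<open>A connected subset of \<open>T\<close> stays within one body, where positions
    determine vertices; so the bound for \<open>nb Rs \<inter> Ts\<close> carries over although
    \<open>T\<close> may spread over many bodies.\<close>
  have cbT: "cb (nb R \<inter> T) a"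
  proof (rule cb_transfer[OF cba, of _ pT])
    show "nb R \<inter> T \<subseteq> V" using nb_V by auto
    show "pT ` (nb R \<inter> T) \<subseteq> nb Rs \<inter> Ts"
      using Tpos RT E_sym unfolding nb_def by blast
    show "inj_on pT K" if K: "K \<subseteq> nb R \<inter> T" "connected_graph (induced F K)" for K
    proof (rule inj_onI)
      fix x y assume xy: "x \<in> K" "y \<in> K" "pT x = pT y"
      have "\<iota> x = \<iota> y"
        using connected_graph_constant[OF K(2), of \<iota> x y] T\<iota> K(1) xy by auto
      then show "x = y" using Tinj xy K by auto
    qed
    show "{pT x, pT y} \<in> E" if "x \<in> nb R \<inter> T" "y \<in> nb R \<inter> T" "{x, y} \<in> E" for x y
      using Tedge that by auto
  qed
  have dX: "z \<notin> B \<and> z \<notin> A \<and> z \<notin> R \<and> z \<notin> T" if "z \<in> X" for z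
    using that disj(1-4) by blast
  have dB: "z \<notin> X \<and> z \<notin> A \<and> z \<notin> R \<and> z \<notin> T" if "z \<in> B" for z
    using that disj(1,5-7) by blast
  have dA: "z \<notin> X \<and> z \<notin> B \<and> z \<notin> R \<and> z \<notin> T" if "z \<in> A" for z
    using that disj(2,5,8,9) by blast
  have dR: "z \<notin> X \<and> z \<notin> B \<and> z \<notin> A \<and> z \<notin> T" if "z \<in> R" for z
    using that disj(3,6,8,10) by blast
  have dT: "z \<notin> X \<and> z \<notin> B \<and> z \<notin> A \<and> z \<notin> R" if "z \<in> T" for z
    using that disj(4,7,9,10) by blast
  have inV: "z \<in> X \<or> z \<in> B \<or> z \<in> A \<or> z \<in> R \<or> z \<in> T" if "z \<in> V" for z
    using that V by blast
  have subV: "X \<subseteq> V" "B \<subseteq> V" "A \<subseteq> V" "R \<subseteq> V" "T \<subseteq> V" using V by auto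
  have edge: "(x \<in> X \<longrightarrow> y \<in> A \<or> y \<in> R) \<and> (x \<in> B \<longrightarrow> y \<in> A \<or> y \<in> T) \<and>
      (x \<in> A \<longrightarrow> y \<in> X \<or> y \<in> B \<or> y \<in> A) \<and> (x \<in> R \<longrightarrow> y \<in> X \<or> y \<in> R \<or> y \<in> T) \<and>
      (x \<in> T \<longrightarrow> y \<in> B \<or> y \<in> R \<or> y \<in> T)" if e: "{x, y} \<in> E" for x y
  proof -
    have e': "{y, x} \<in> E" and yV: "y \<in> V" using e E_sym E_V by blast+
    show ?thesis
      using eX[OF e] eX[OF e'] eB[OF e] eB[OF e'] eA[OF e] eA[OF e'] inV[OF yV]
        dX[of x] dB[of x] dA[of x] dR[of x] dT[of x] by blast
  qed
  have indXB: "independent_set F (X \<union> B)"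
  proof (rule indepI)
    show "X \<union> B \<subseteq> V" using subV by auto
    show "{x, y} \<notin> E" if "x \<in> X \<union> B" "y \<in> X \<union> B" for x y
      using that edge[of x y] dX[of y] dB[of y] by blast
  qed
  \<comment> \<open>Edges at \<open>A\<close> lead to \<open>X\<close>, \<open>B\<close> or
    \<open>A\<close>. If an end of the edge \<open>{u, v}\<close> were in \<open>A\<close>, then
    \<open>R \<union> T\<close> would avoid both ends and be degenerate; as it has no edge to
    \<open>A\<close>, the whole complement of the independent set \<open>X \<union> B\<close> would
    be degenerate.\<close>
  have "u \<notin> A \<and> v \<notin> A"
  proof (rule ccontr)
    assume "\<not> (u \<notin> A \<and> v \<notin> A)"
    moreover have "z \<notin> R \<union> T \<and> w \<notin> R \<union> T" if "z \<in> A" "{z, w} \<in> E" for z w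
      using edge[OF that(2)] that(1) dA[of z] dA[of w] dX[of w] dB[of w] by blast
    ultimately have "u \<notin> R \<union> T" "v \<notin> R \<union> T" using uv vu by blast+
    then have "deg (R \<union> T)" using deg_avoid[of "R \<union> T"] subV(4,5) by blast
    then have "deg (A \<union> (R \<union> T))"
    proof (rule deg_Un[OF degA])
      show "A \<inter> (R \<union> T) = {}" using dA by blast
      show "{x, y} \<notin> E" if "x \<in> A" "y \<in> R \<union> T" for x y
        using that edge[of x y] dR[of y] dT[of y] by blast
    qed
    moreover have "V - (X \<union> B) = A \<union> (R \<union> T)"
    proof (intro equalityI subsetI)
      show "z \<in> A \<union> (R \<union> T)" if "z \<in> V - (X \<union> B)" for z using that inV[of z] by blast
      show "z \<in> V - (X \<union> B)" if "z \<in> A \<union> (R \<union> T)" for z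
        using that subV dA[of z] dR[of z] dT[of z] by blast
    qed
    ultimately show False using not_deg_compl[OF indXB] by metis
  qed
  then have uvA: "u \<notin> A" "v \<notin> A" by auto
  \<comment> \<open>The set \<open>C\<close> enters the independent part and the vertices of
    \<open>B\<close> adjacent to it have to leave. They can go to \<open>T'\<close>, which is
    degenerate for the trivial reason that it avoids \<open>u\<close> and \<open>v\<close>. Neither
    \<open>A\<close> nor \<open>B\<close> has edges to \<open>R\<close>, so the crossing part of
    \<open>T'\<close> is contained in that of \<open>T\<close> without \<open>C\<close>, and the
    first parameter drops.\<close>
  have moveT: False
    if C0: "C0 \<subseteq> nb R \<inter> T" "independent_set F C0" and av: "u \<in> X \<union> R \<union> C0" "v \<in> X \<union> R \<union> C0"
    for C0
  proof -
    obtain C where C: "C0 \<subseteq> C" "C \<subseteq> nb R \<inter> T" "independent_set F C" "cb (nb R \<inter> T - C) (a - 1)"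
      using cb_remove_independent[OF _ C0 cbT] nb_V[of R] by (metis le_infI1)
    define I' where "I' = X \<union> C \<union> (B - nb C)"
    define T' where "T' = (T - C) \<union> (B \<inter> nb C) \<union> A"
    have notT': "z \<notin> T'" if "z \<in> X \<union> R \<union> C0" for z
      using that C(1,2) dX[of z] dR[of z] dT[of z] unfolding T'_def by blast
    have avT: "u \<notin> T'" "v \<notin> T'" using av notT' by blast+
    have "independent_set F I'"
    proof (rule indepI)
      show "I' \<subseteq> V" unfolding I'_def using subV C(2) by blast
      fix x y assume xy: "x \<in> I'" "y \<in> I'"
      show "{x, y} \<notin> E"
      proof
        assume e: "{x, y} \<in> E"
        have e': "{y, x} \<in> E" using e E_sym by auto
        have CT: "z \<in> T" if "z \<in> C" for z using that C(2) by blast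
        have nbC: "x \<in> C \<Longrightarrow> y \<in> nb C" "y \<in> C \<Longrightarrow> x \<in> nb C"
          using e e' unfolding nb_def by blast+
        have I': "z \<notin> A \<and> z \<notin> R \<and> (z \<in> T \<longrightarrow> z \<in> C) \<and> (z \<in> B \<longrightarrow> z \<notin> nb C)" if "z \<in> I'" for z
          using that CT[of z] dX[of z] dB[of z] dT[of z] unfolding I'_def by blast
        have "x \<notin> X" using edge[OF e] I'[OF xy(2)] by blast
        moreover have "y \<notin> X" using edge[OF e'] I'[OF xy(1)] by blast
        moreover have "x \<notin> B" using edge[OF e] I'[OF xy(2)] I'[OF xy(1)] nbC(2) by blast
        moreover have "y \<notin> B" using edge[OF e'] I'[OF xy(1)] I'[OF xy(2)] nbC(1) by blast
        ultimately have "x \<in> C" "y \<in> C" using xy unfolding I'_def by blast+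
        then show False using e indepD[OF C(3)] by blast
      qed
    qed
    moreover have "deg T'"
      using deg_avoid[OF _ avT] subV unfolding T'_def by blast
    moreover have "I' \<union> R \<union> T' = V" unfolding I'_def T'_def V using C(2) by blast
    moreover have "I' \<inter> R = {}" "I' \<inter> T' = {}" "R \<inter> T' = {}"
      unfolding I'_def T'_def using C(2) dX dB dA dR dT by blast+
    ultimately have "conf I' R T'" unfolding conf_def using degR by blast
    moreover have "nb R \<inter> T' \<subseteq> nb R \<inter> T - C"
    proof
      fix x assume x: "x \<in> nb R \<inter> T'"
      then obtain r where r: "r \<in> R" "{x, r} \<in> E" unfolding nb_def by auto
      show "x \<in> nb R \<inter> T - C"
        using x edge[OF r(2)] dR[OF r(1)] r(1) unfolding T'_def by blast
    qed
    ultimately show False using best(1) C(4) cb_mono by blast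
  qed
  \<comment> \<open>With \<open>A\<close> excluded, a neighbour of a vertex in \<open>X\<close> is
    in \<open>R\<close> and a neighbour of a vertex in \<open>B\<close> is in \<open>T\<close>, so
    these cases cover every position of the edge.\<close>
  consider (R) "u \<in> X \<union> R" "v \<in> X \<union> R" | (TR) "u \<in> T" "v \<in> R" | (RT) "v \<in> T" "u \<in> R"
    | (T) "u \<in> T \<union> B" "v \<in> T \<union> B"
  proof -
    have "u \<in> X \<or> u \<in> R \<or> u \<in> T \<or> u \<in> B" "v \<in> X \<or> v \<in> R \<or> v \<in> T \<or> v \<in> B"
      using inV[OF uV(1)] inV[OF uV(2)] uvA by blast+
    moreover have "u \<in> X \<Longrightarrow> v \<in> R" "v \<in> X \<Longrightarrow> u \<in> R" "u \<in> B \<Longrightarrow> v \<in> T" "v \<in> B \<Longrightarrow> u \<in> T"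
      using edge[OF uv] edge[OF vu] uvA by blast+
    ultimately show ?thesis using that by (metis UnCI)
  qed
  then show False
  proof cases
    case R
    then show ?thesis using moveT[of "{}"] indepI[of "{}"] by blast
  next
    \<comment> \<open>The end in \<open>T\<close> has its neighbour in \<open>R\<close>, so it lies
      in the crossing part and may be prescribed as an element of \<open>C\<close>.\<close>
    case TR
    then show ?thesis
      using moveT[of "{u}"] indepI[of "{u}"] uv uV E_V unfolding nb_def by blast
  next
    case RT
    then show ?thesis
      using moveT[of "{v}"] indepI[of "{v}"] vu uV E_V unfolding nb_def by blast
  next
    case T
    have "u \<in> T \<or> v \<in> T" using T edge[OF uv] uvA by blast
    \<comment> \<open>The body that contains whichever of \<open>u\<close> and \<open>v\<close> lies
      in \<open>T\<close>; if both do, they share it because they are adjacent.\<close>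
    then obtain i where i: "u \<in> T \<Longrightarrow> \<iota> u = i" "v \<in> T \<Longrightarrow> \<iota> v = i"
      using T\<iota>[OF uv] by metis
    \<comment> \<open>The new third part consists of one body only: positions in \<open>Rs\<close>
      depend on the body, so the bound \<open>cbb\<close> can be pulled back for a single body at a
      time. The other bodies can be moved to \<open>R'\<close> since that set avoids
      \<open>u\<close> and \<open>v\<close>. No edges run between bodies, so the first parameter
      does not grow, while removing \<open>C\<close> lowers the second.\<close>
    define Ti where "Ti = {t \<in> T. \<iota> t = i}"
    have Ti: "u \<in> Ti \<union> B" "v \<in> Ti \<union> B" unfolding Ti_def using T i by auto
    have cbR: "cb (nb Ti \<inter> R) b"
    proof (rule cb_transfer[OF cbb, of _ "pR i"])
      show "nb Ti \<inter> R \<subseteq> V" using nb_V by auto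
      show "pR i ` (nb Ti \<inter> R) \<subseteq> nb Ts \<inter> Rs"
        using Tpos RT unfolding nb_def Ti_def by fastforce
      show "inj_on (pR i) K" if K: "K \<subseteq> nb Ti \<inter> R" "connected_graph (induced F K)" for K
      proof (rule inj_onI)
        fix x y assume xy: "x \<in> K" "y \<in> K" "pR i x = pR i y"
        have "\<kappa> x = \<kappa> y"
          using connected_graph_constant[OF K(2), of \<kappa> x y] R\<kappa> K(1) xy by auto
        moreover obtain t t' where "{x, t} \<in> E" "{y, t'} \<in> E" "t \<in> Ti" "t' \<in> Ti" "x \<in> R" "y \<in> R"
          using xy K(1) unfolding nb_def by blast
        ultimately show "x = y" using Rinj[of x t y t'] xy unfolding Ti_def by auto
      qed
      show "{pR i x, pR i y} \<in> E" if xy: "x \<in> nb Ti \<inter> R" "y \<in> nb Ti \<inter> R" "{x, y} \<in> E" for x y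
      proof -
        obtain t t' where "{x, t} \<in> E" "{y, t'} \<in> E" "t \<in> Ti" "t' \<in> Ti"
          using xy unfolding nb_def by blast
        then show ?thesis using Redge[of x t y t'] xy unfolding Ti_def by auto
      qed
    qed
    obtain C where C: "C \<subseteq> nb Ti \<inter> R" "independent_set F C" "cb (nb Ti \<inter> R - C) (b - 1)"
      using cb_remove_independent[OF _ _ _ cbR, of "{}"] nb_V[of Ti] indepI[of "{}"]
      by (metis empty_iff empty_subsetI le_infI1)
    define I' where "I' = B \<union> C \<union> (X - nb C)"
    define R' where "R' = (R - C) \<union> (T - Ti) \<union> (X \<inter> nb C) \<union> A"
    have "independent_set F I'"
    proof (rule indepI)
      show "I' \<subseteq> V" unfolding I'_def using subV C(1) by blast
      fix x y assume xy: "x \<in> I'" "y \<in> I'"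
      show "{x, y} \<notin> E"
      proof
        assume e: "{x, y} \<in> E"
        have e': "{y, x} \<in> E" using e E_sym by auto
        have CR: "z \<in> R" if "z \<in> C" for z using that C(1) by blast
        have nbC: "x \<in> C \<Longrightarrow> y \<in> nb C" "y \<in> C \<Longrightarrow> x \<in> nb C"
          using e e' unfolding nb_def by blast+
        have I': "z \<notin> A \<and> z \<notin> T \<and> (z \<in> R \<longrightarrow> z \<in> C) \<and> (z \<in> X \<longrightarrow> z \<notin> nb C)" if "z \<in> I'" for z
          using that CR[of z] dX[of z] dB[of z] dR[of z] unfolding I'_def by blast
        have "x \<notin> B" using edge[OF e] I'[OF xy(2)] by blast
        moreover have "y \<notin> B" using edge[OF e'] I'[OF xy(1)] by blast
        moreover have "x \<notin> X" using edge[OF e] I'[OF xy(2)] I'[OF xy(1)] nbC(2) by blast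
        moreover have "y \<notin> X" using edge[OF e'] I'[OF xy(1)] I'[OF xy(2)] nbC(1) by blast
        ultimately have "x \<in> C" "y \<in> C" using xy unfolding I'_def by blast+
        then show False using e indepD[OF C(2)] by blast
      qed
    qed
    moreover have "deg R'"
    proof (rule deg_avoid)
      show "R' \<subseteq> V" unfolding R'_def using subV by blast
      have "z \<notin> R'" if "z \<in> Ti \<union> B" for z
        using that dB[of z] dT[of z] unfolding R'_def Ti_def by blast
      then show "u \<notin> R'" "v \<notin> R'" using Ti by blast+
    qed
    moreover have "deg Ti"
    proof -
      have "emb pT (induced F Ti) (induced F Ts)"
        unfolding emb_def
      proof (intro conjI ballI)
        show "inj_on pT (uverts (induced F Ti))"
          by (rule inj_onI) (use Tinj Ti_def in auto)
        show "pT ` uverts (induced F Ti) \<subseteq> uverts (induced F Ts)" using Tpos Ti_def by auto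
        fix e assume e: "e \<in> uedges (induced F Ti)"
        then have "e \<in> E" by simp
        then obtain x y where "e = {x, y}" using ugraph_edgeE[OF ugraph_F] by metis
        then show "pT ` e \<in> uedges (induced F Ts)" using e Tedge Tpos unfolding Ti_def by auto
      qed
      then show ?thesis using degenerate_emb degTs unfolding deg_def by blast
    qed
    moreover have "I' \<union> R' \<union> Ti = V"
      unfolding I'_def R'_def V Ti_def using C(1) by blast
    moreover have "I' \<inter> R' = {}" "I' \<inter> Ti = {}" "R' \<inter> Ti = {}"
      unfolding I'_def R'_def Ti_def using C(1) dX dB dA dR dT by blast+
    ultimately have cf: "conf I' R' Ti" unfolding conf_def by blast
    have "nb R' \<inter> Ti \<subseteq> nb R \<inter> T"
    proof
      fix x assume x: "x \<in> nb R' \<inter> Ti"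
      then obtain r where r: "r \<in> R'" "{x, r} \<in> E" unfolding nb_def by auto
      have xT: "x \<in> T" "\<iota> x = i" using x unfolding Ti_def by auto
      have "r \<notin> T - Ti" using T\<iota>[OF r(2)] xT unfolding Ti_def by auto
      then have "r \<in> R"
        using edge[OF r(2)] xT(1) r(1) dX[of r] dA[of r] dB[of r] unfolding R'_def by blast
      then show "x \<in> nb R \<inter> T" using r xT unfolding nb_def by blast
    qed
    moreover have "nb Ti \<inter> R' \<subseteq> nb Ti \<inter> R - C"
    proof
      fix x assume x: "x \<in> nb Ti \<inter> R'"
      then obtain t where t: "t \<in> Ti" "{x, t} \<in> E" unfolding nb_def by auto
      have "x \<notin> T - Ti" using T\<iota>[OF t(2)] t(1) unfolding Ti_def by auto
      moreover have tT: "t \<in> T" using t(1) unfolding Ti_def by auto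
      moreover have "x \<notin> X" "x \<notin> A" using edge[OF t(2)] dT[OF tT] by blast+
      ultimately show "x \<in> nb Ti \<inter> R - C" using x unfolding R'_def by blast
    qed
    ultimately show False using best(2)[OF cf] cbT C(3) cb_mono by blast
  qed
qed

end

subsection \<open>Sparse hypergraphs without large independent sets\<close>

lemma finite_pmf_prob_Markov:
  fixes f :: "'a \<Rightarrow> real"
  assumes "finite (set_pmf p)" "\<And>x. x \<in> set_pmf p \<Longrightarrow> 0 \<le> f x" "0 < c"
  shows "measure_pmf.prob p {x. c \<le> f x} \<le> measure_pmf.expectation p f / c"
proof -
  have "measure_pmf.prob p {x \<in> space (measure_pmf p). c \<le> f x} \<le> measure_pmf.expectation p f / c"
    by (rule integral_Markov_inequality_measure[where A = "{}"])
      (use assms in \<open>auto simp: integrable_measure_pmf_finite AE_measure_pmf_iff\<close>)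
  then show ?thesis by simp
qed

lemma prob_pmf_eq_expectation:
  "measure_pmf.prob p {x. Q x} = measure_pmf.expectation p (\<lambda>x. if Q x then 1 else 0)"
proof -
  have "(\<lambda>x. if Q x then 1 else (0::real)) = indicator {x. Q x}"
    by (auto simp: indicator_def)
  then show ?thesis by simp
qed

lemma prob_pmf_of_set_tuples:
  fixes N k :: nat
  assumes "0 < N" "U \<subseteq> {..<N}"
  shows "measure_pmf.prob (pmf_of_set ({..<k} \<rightarrow>\<^sub>E {..<N})) {w. w ` {..<k} \<subseteq> U}
    = (real (card U) / real N) ^ k"
proof -
  let ?A = "{..<k} \<rightarrow>\<^sub>E {..<N}"
  have fin: "finite ?A" by (simp add: finite_PiE)
  have ne: "?A \<noteq> {}" using assms(1) by (auto simp: PiE_eq_empty_iff)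
  have "?A \<inter> {w. w ` {..<k} \<subseteq> U} = {..<k} \<rightarrow>\<^sub>E U"
    using assms(2) unfolding PiE_def Pi_def by blast
  moreover have "card ({..<k} \<rightarrow>\<^sub>E U) = card U ^ k" by (simp add: card_PiE)
  moreover have "card ?A = N ^ k" by (simp add: card_PiE)
  ultimately show ?thesis
    using measure_pmf_of_set[OF ne fin] by (simp add: power_divide)
qed

text \<open>The deletion method. Among \<open>D * N\<close> random tuples, the expected number of
  small families spanning too few points is bounded independently of \<open>N\<close>, whereas each
  large point set contains many tuples with a failure probability that beats the
  \<open>2 ^ N\<close> sets. Deleting all tuples of defective families loses at most
  \<open>L\<close> of them. For singleton families the sparsity condition says that a tuple has no
  repeated entries.\<close>

lemma sparse_hypergraph:
  fixes k \<tau> :: nat and \<delta> :: real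
  assumes k: "2 \<le> k" and \<delta>: "0 < \<delta>"
  obtains N :: nat and IX :: "nat set" and w :: "nat \<Rightarrow> nat \<Rightarrow> nat"
  where "0 < N" "finite IX" "\<forall>j\<in>IX. w j ` {..<k} \<subseteq> {..<N}"
    "\<forall>S\<subseteq>IX. S \<noteq> {} \<longrightarrow> card S \<le> \<tau> \<longrightarrow> (k - 1) * card S + 1 \<le> card (\<Union>j\<in>S. w j ` {..<k})"
    "\<forall>S\<subseteq>{..<N}. \<delta> * N \<le> card S \<longrightarrow> (\<exists>j\<in>IX. w j ` {..<k} \<subseteq> S)"
proof -
  define q where "q = (min \<delta> 1) ^ k"
  have q: "0 < q" "q \<le> 1" using \<delta> by (auto simp: q_def power_le_one)
  \<comment> \<open>The number \<open>D\<close> of tuples per point is taken so large that the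
    failure probability for one point set is of order \<open>(1 / 4) ^ N\<close>, which survives a
    union bound over \<open>2 ^ N\<close> sets.\<close>
  have "(\<lambda>D. (1 - q / 2) ^ D) \<longlonglongrightarrow> 0" using q by (intro LIMSEQ_realpow_zero) auto
  then have "\<forall>\<^sub>F D in sequentially. (1 - q / 2) ^ D < 1 / 4"
    by (rule order_tendstoD) simp
  then obtain D where D: "(1 - q / 2) ^ D < 1 / 4"
    by (auto simp: eventually_sequentially)
  \<comment> \<open>An upper bound for the expected number of defects. Choosing \<open>t\<close>
    tuples contributes \<open>N ^ t\<close>, choosing their points \<open>N ^ ((k - 1) * t)\<close>,
    and the probability \<open>1 / N ^ (k * t)\<close>; the powers of \<open>N\<close> cancel, so
    this constant can be fixed before \<open>N\<close>.\<close>
  define \<Lambda> where "\<Lambda> = (\<Sum>t=1..\<tau>. real D ^ t * real ((k - 1) * t) ^ (k * t))"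
  have \<Lambda>: "0 \<le> \<Lambda>" unfolding \<Lambda>_def by (intro sum_nonneg) auto
  define m where "m = nat \<lfloor>2 * \<Lambda> + 1\<rfloor>"
  define L where "L = m * \<tau>"
  \<comment> \<open>The summand \<open>L + 2\<close> brings the union bound below to
    \<open>1 / 4\<close>; the summand \<open>(k - 1) * \<tau>\<close> ensures that point sets of
    every size \<open>(k - 1) * t\<close> with \<open>t \<le> \<tau>\<close> exist.\<close>
  define N where "N = L + 2 + (k - 1) * \<tau>"
  define M where "M = D * N"
  have N: "0 < N" by (simp add: N_def)
  define Tup where "Tup = {..<k} \<rightarrow>\<^sub>E {..<N}"
  have finT: "finite Tup" and neT: "Tup \<noteq> {}"
    using N by (auto simp: Tup_def finite_PiE PiE_eq_empty_iff)
  define \<Omega> where "\<Omega> = Pi_pmf {..<M} undefined (\<lambda>_. pmf_of_set Tup)"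
  have set_\<Omega>: "set_pmf \<Omega> \<subseteq> {\<omega>. \<forall>j<M. \<omega> j \<in> Tup}"
    unfolding \<Omega>_def by (subst set_Pi_pmf) (auto simp: PiE_dflt_def finT neT)
  have fin_\<Omega>: "finite (set_pmf \<Omega>)"
    unfolding \<Omega>_def by (subst set_Pi_pmf) (auto simp: finT neT intro!: finite_PiE_dflt)
  have prod_\<Omega>: "measure_pmf.expectation \<Omega> (\<lambda>\<omega>. \<Prod>j\<in>{..<M}. f j (\<omega> j))
      = (\<Prod>j\<in>{..<M}. measure_pmf.expectation (pmf_of_set Tup) (f j))"
    if "\<And>j w. 0 \<le> f j w" for f :: "nat \<Rightarrow> (nat \<Rightarrow> nat) \<Rightarrow> real"
    unfolding \<Omega>_def
    by (rule expectation_prod_Pi_pmf)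
      (use that finT neT in \<open>auto simp: integrable_measure_pmf_finite\<close>)

  define defect where "defect \<omega> \<T> \<longleftrightarrow> \<T> \<subseteq> {..<M} \<and> \<T> \<noteq> {} \<and> card \<T> \<le> \<tau> \<and>
    card (\<Union>j\<in>\<T>. \<omega> j ` {..<k}) \<le> (k - 1) * card \<T>" for \<omega> :: "nat \<Rightarrow> nat \<Rightarrow> nat" and \<T>
  define defs where "defs \<omega> = {\<T>. defect \<omega> \<T>}" for \<omega>
  have defs_sub: "defs \<omega> \<subseteq> Pow {..<M}" for \<omega> unfolding defs_def defect_def by auto
  have inside: "measure_pmf.prob \<Omega> {\<omega>. \<forall>j\<in>\<T>. \<omega> j ` {..<k} \<subseteq> U}
      = (real (card U) / real N) ^ (k * card \<T>)" if "\<T> \<subseteq> {..<M}" "U \<subseteq> {..<N}" for \<T> U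
  proof -
    define f where "f j w = (if j \<in> \<T> then if w ` {..<k} \<subseteq> U then 1 else 0 else (1::real))"
      for j and w :: "nat \<Rightarrow> nat"
    have fin: "finite \<T>" using that(1) finite_subset by blast
    have "(if \<forall>j\<in>\<T>. \<omega> j ` {..<k} \<subseteq> U then 1 else 0) = (\<Prod>j\<in>{..<M}. f j (\<omega> j))" for \<omega>
    proof (cases "\<forall>j\<in>\<T>. \<omega> j ` {..<k} \<subseteq> U")
      case True
      then have "(\<Prod>j\<in>{..<M}. f j (\<omega> j)) = (\<Prod>j\<in>{..<M}. 1)"
        by (intro prod.cong) (auto simp: f_def)
      then show ?thesis using True by simp
    next
      case False
      then obtain j where "j \<in> \<T>" "\<not> \<omega> j ` {..<k} \<subseteq> U" by auto
      then have "(\<Prod>j\<in>{..<M}. f j (\<omega> j)) = 0"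
        using that(1) by (intro prod_zero bexI[of _ j]) (auto simp: f_def)
      then show ?thesis using False by (simp only: if_False)
    qed
    then have "measure_pmf.prob \<Omega> {\<omega>. \<forall>j\<in>\<T>. \<omega> j ` {..<k} \<subseteq> U}
      = (\<Prod>j\<in>{..<M}. measure_pmf.expectation (pmf_of_set Tup) (f j))"
      by (subst prob_pmf_eq_expectation, simp only:, intro prod_\<Omega>) (auto simp: f_def)
    also have "\<dots> = (\<Prod>j\<in>{..<M}. if j \<in> \<T> then (real (card U) / real N) ^ k else 1)"
    proof (rule prod.cong)
      fix j
      show "measure_pmf.expectation (pmf_of_set Tup) (f j)
        = (if j \<in> \<T> then (real (card U) / real N) ^ k else 1)"
        using prob_pmf_of_set_tuples[OF N that(2), of k]
        unfolding f_def prob_pmf_eq_expectation Tup_def by simp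
    qed simp
    also have "\<dots> = (\<Prod>j\<in>\<T>. (real (card U) / real N) ^ k)"
      using that(1) by (simp add: prod.If_cases Int_absorb1)
    finally show ?thesis by (simp add: power_mult)
  qed
  have prob_defect: "measure_pmf.prob \<Omega> {\<omega>. defect \<omega> \<T>}
      \<le> real ((k - 1) * t) ^ (k * t) / real N ^ t"
    if \<T>: "\<T> \<subseteq> {..<M}" and t: "card \<T> = t" "1 \<le> t" "t \<le> \<tau>" for \<T> t
  proof -
    let ?c = "(k - 1) * t"
    \<comment> \<open>A union of at most \<open>?c\<close> points can be enlarged to exactly
      \<open>?c\<close> points, so the union bound runs over sets of one size.\<close>
    define Us where "Us = {U. U \<subseteq> {..<N} \<and> card U = ?c}"
    have cN: "?c \<le> N" using t unfolding N_def by (meson le_add2 mult_le_mono2 order_trans)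
    have finU: "finite Us" unfolding Us_def by simp
    have cardU: "card Us = N choose ?c" unfolding Us_def using n_subsets[of "{..<N}" ?c] by simp
    have "measure_pmf.prob \<Omega> {\<omega>. defect \<omega> \<T>}
      \<le> measure_pmf.prob \<Omega> (\<Union>U\<in>Us. {\<omega>. \<forall>j\<in>\<T>. \<omega> j ` {..<k} \<subseteq> U})"
    proof (rule measure_pmf.finite_measure_mono_AE)
      show "AE \<omega> in measure_pmf \<Omega>. \<omega> \<in> {\<omega>. defect \<omega> \<T>} \<longrightarrow> \<omega> \<in> (\<Union>U\<in>Us. {\<omega>. \<forall>j\<in>\<T>. \<omega> j ` {..<k} \<subseteq> U})"
        unfolding AE_measure_pmf_iff
      proof (intro ballI impI)
        fix \<omega> assume \<omega>: "\<omega> \<in> set_pmf \<Omega>" "\<omega> \<in> {\<omega>. defect \<omega> \<T>}"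
        let ?X = "\<Union>j\<in>\<T>. \<omega> j ` {..<k}"
        have "?X \<subseteq> {..<N}" using \<omega> set_\<Omega> \<T> unfolding Tup_def by fastforce
        moreover have "card ?X \<le> ?c" using \<omega> t unfolding defect_def by auto
        ultimately obtain U where "?X \<subseteq> U" "U \<subseteq> {..<N}" "card U = ?c"
          using exists_subset_between[of ?X ?c "{..<N}"] cN by auto
        then show "\<omega> \<in> (\<Union>U\<in>Us. {\<omega>. \<forall>j\<in>\<T>. \<omega> j ` {..<k} \<subseteq> U})" unfolding Us_def by auto
      qed
    qed simp
    also have "\<dots> \<le> (\<Sum>U\<in>Us. measure_pmf.prob \<Omega> {\<omega>. \<forall>j\<in>\<T>. \<omega> j ` {..<k} \<subseteq> U})"
      using finU by (intro measure_pmf.finite_measure_subadditive_finite) auto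
    also have "\<dots> = (\<Sum>U\<in>Us. (real ?c / real N) ^ (k * t))"
      using inside[OF \<T>] t unfolding Us_def by (intro sum.cong) auto
    also have "\<dots> = real (N choose ?c) * (real ?c / real N) ^ (k * t)" using cardU by simp
    also have "\<dots> \<le> real N ^ ?c * (real ?c / real N) ^ (k * t)"
      using binomial_le_pow[OF cN] by (intro mult_right_mono) (auto simp flip: of_nat_power)
    also have "\<dots> = real ?c ^ (k * t) / real N ^ t"
    proof -
      have "k * t = ?c + t" using k by (cases k) auto
      then have "real N ^ (k * t) = real N ^ ?c * real N ^ t" by (simp only: power_add)
      then show ?thesis using N by (simp add: power_divide)
    qed
    finally show ?thesis .
  qed
  have card_defs: "real (card (defs \<omega>)) = (\<Sum>\<T>\<in>Pow {..<M}. if defect \<omega> \<T> then 1 else 0)" for \<omega>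
  proof -
    have "defs \<omega> = Pow {..<M} \<inter> {\<T>. defect \<omega> \<T>}" using defs_sub unfolding defs_def by auto
    then show ?thesis by (simp add: sum.If_cases)
  qed
  have "measure_pmf.expectation \<Omega> (\<lambda>\<omega>. real (card (defs \<omega>)))
      = (\<Sum>\<T>\<in>Pow {..<M}. measure_pmf.prob \<Omega> {\<omega>. defect \<omega> \<T>})"
    unfolding card_defs prob_pmf_eq_expectation
    by (rule Bochner_Integration.integral_sum) (auto intro: integrable_measure_pmf_finite fin_\<Omega>)
  also have "\<dots> = (\<Sum>\<T>\<in>(\<Union>t\<in>{1..\<tau>}. {\<T>. \<T> \<subseteq> {..<M} \<and> card \<T> = t}). measure_pmf.prob \<Omega> {\<omega>. defect \<omega> \<T>})"
  proof (rule sum.mono_neutral_right)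
    show "\<forall>i\<in>Pow {..<M} - (\<Union>t\<in>{1..\<tau>}. {\<T>. \<T> \<subseteq> {..<M} \<and> card \<T> = t}).
        measure_pmf.prob \<Omega> {\<omega>. defect \<omega> i} = 0"
    proof
      fix \<T> assume a: "\<T> \<in> Pow {..<M} - (\<Union>t\<in>{1..\<tau>}. {\<T>. \<T> \<subseteq> {..<M} \<and> card \<T> = t})"
      then have "finite \<T>" using finite_subset by blast
      then have "{\<omega>. defect \<omega> \<T>} = {}"
        using a unfolding defect_def by (auto simp: Suc_le_eq card_gt_0_iff)
      then show "measure_pmf.prob \<Omega> {\<omega>. defect \<omega> \<T>} = 0" by simp
    qed
  qed auto
  also have "\<dots> = (\<Sum>t=1..\<tau>. \<Sum>\<T>\<in>{\<T>. \<T> \<subseteq> {..<M} \<and> card \<T> = t}. measure_pmf.prob \<Omega> {\<omega>. defect \<omega> \<T>})"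
    by (rule sum.UNION_disjoint) auto
  also have "\<dots> \<le> (\<Sum>t=1..\<tau>. \<Sum>\<T>\<in>{\<T>. \<T> \<subseteq> {..<M} \<and> card \<T> = t}. real ((k - 1) * t) ^ (k * t) / real N ^ t)"
    by (intro sum_mono prob_defect) auto
  also have "\<dots> = (\<Sum>t=1..\<tau>. real (M choose t) * (real ((k - 1) * t) ^ (k * t) / real N ^ t))"
    using n_subsets[of "{..<M}"] by simp
  also have "\<dots> \<le> (\<Sum>t=1..\<tau>. real D ^ t * real ((k - 1) * t) ^ (k * t))"
  proof (rule sum_mono)
    fix t
    have "real (M choose t) \<le> real M ^ t"
      by (cases "t \<le> M") (auto simp: binomial_eq_0 simp flip: of_nat_power intro: binomial_le_pow)
    then have "real (M choose t) * (real ((k - 1) * t) ^ (k * t) / real N ^ t)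
      \<le> real M ^ t * (real ((k - 1) * t) ^ (k * t) / real N ^ t)"
      by (intro mult_right_mono) auto
    also have "\<dots> = real D ^ t * real ((k - 1) * t) ^ (k * t)"
      using N by (simp add: M_def power_mult_distrib)
    finally show "real (M choose t) * (real ((k - 1) * t) ^ (k * t) / real N ^ t)
      \<le> real D ^ t * real ((k - 1) * t) ^ (k * t)" .
  qed
  finally have E_defs: "measure_pmf.expectation \<Omega> (\<lambda>\<omega>. real (card (defs \<omega>))) \<le> \<Lambda>"
    unfolding \<Lambda>_def .
  have "measure_pmf.prob \<Omega> {\<omega>. 2 * \<Lambda> + 1 \<le> real (card (defs \<omega>))}
      \<le> measure_pmf.expectation \<Omega> (\<lambda>\<omega>. real (card (defs \<omega>))) / (2 * \<Lambda> + 1)"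
    by (rule finite_pmf_prob_Markov[OF fin_\<Omega>]) (use \<Lambda> in auto)
  also have "\<dots> \<le> \<Lambda> / (2 * \<Lambda> + 1)" using E_defs \<Lambda> by (intro divide_right_mono) auto
  also have "\<dots> < 1 / 2" using \<Lambda> by (simp add: field_simps)
  finally have few_defs: "measure_pmf.prob \<Omega> {\<omega>. 2 * \<Lambda> + 1 \<le> real (card (defs \<omega>))} < 1 / 2" .

  define good where "good \<omega> S = {j \<in> {..<M}. \<omega> j ` {..<k} \<subseteq> S}" for \<omega> :: "nat \<Rightarrow> nat \<Rightarrow> nat" and S
  define Big where "Big = {S. S \<subseteq> {..<N} \<and> \<delta> * N \<le> card S}"
  have finB: "finite Big" unfolding Big_def by (rule finite_subset[of _ "Pow {..<N}"]) auto
  have cardB: "real (card Big) \<le> 2 ^ N"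
  proof -
    have "card Big \<le> card (Pow {..<N})" unfolding Big_def by (intro card_mono) auto
    then show ?thesis by (simp add: card_Pow flip: of_nat_power of_nat_le_iff)
  qed
  have prob_good: "measure_pmf.prob \<Omega> {\<omega>. card (good \<omega> S) \<le> L} \<le> 2 ^ L * (1 / 4) ^ N"
    if S: "S \<in> Big" for S
  proof -
    \<comment> \<open>An exponential moment with base \<open>1 / 2\<close>: every tuple inside
      \<open>S\<close> halves the product, so few such tuples make the product at least
      \<open>(1 / 2) ^ L\<close>, and Markov's inequality applies.\<close>
    define f where "f w = (if w ` {..<k} \<subseteq> S then 1 / 2 else (1::real))" for w :: "nat \<Rightarrow> nat"
    have prod_f: "(\<Prod>j\<in>{..<M}. f (\<omega> j)) = (1 / 2) ^ card (good \<omega> S)" for \<omega>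
    proof -
      have "(\<Prod>j\<in>{..<M}. f (\<omega> j)) = (\<Prod>j\<in>{..<M}. if j \<in> good \<omega> S then 1 / 2 else (1::real))"
        by (intro prod.cong) (auto simp: f_def good_def)
      also have "\<dots> = (1 / 2) ^ card ({..<M} \<inter> good \<omega> S)"
        by (simp add: prod.If_cases)
      finally show ?thesis by (simp add: good_def Int_def)
    qed
    have SN: "S \<subseteq> {..<N}" "\<delta> * N \<le> card S" using S unfolding Big_def by auto
    have qS: "q \<le> (real (card S) / real N) ^ k"
    proof -
      have "min \<delta> 1 \<le> real (card S) / real N"
      proof -
        have "min \<delta> 1 * real N \<le> \<delta> * real N" by (intro mult_right_mono) auto
        then have "min \<delta> 1 * real N \<le> real (card S)" using SN(2) by linarith
        then show ?thesis using N by (simp add: pos_le_divide_eq)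
      qed
      then show ?thesis unfolding q_def using \<delta> by (intro power_mono) auto
    qed
    have Ef: "measure_pmf.expectation (pmf_of_set Tup) f = 1 - (real (card S) / real N) ^ k / 2"
    proof -
      have "f = (\<lambda>w. 1 - (if w ` {..<k} \<subseteq> S then 1 else 0) / 2)" unfolding f_def by auto
      then have "measure_pmf.expectation (pmf_of_set Tup) f
        = 1 - measure_pmf.expectation (pmf_of_set Tup) (\<lambda>w. if w ` {..<k} \<subseteq> S then 1 else 0) / 2"
        using finT neT by (simp add: integrable_measure_pmf_finite)
      then show ?thesis
        using prob_pmf_of_set_tuples[OF N SN(1), of k] unfolding prob_pmf_eq_expectation Tup_def
        by simp
    qed
    have "(real (card S) / real N) ^ k \<le> 1"
    proof (rule power_le_one)
      have "card S \<le> N" using card_mono[OF _ SN(1)] by simp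
      then show "real (card S) / real N \<le> 1" using N by simp
    qed auto
    then have Ef': "0 \<le> measure_pmf.expectation (pmf_of_set Tup) f"
      "measure_pmf.expectation (pmf_of_set Tup) f \<le> 1 - q / 2"
      using qS Ef by auto
    have "measure_pmf.prob \<Omega> {\<omega>. card (good \<omega> S) \<le> L}
      = measure_pmf.prob \<Omega> {\<omega>. (1 / 2) ^ L \<le> (\<Prod>j\<in>{..<M}. f (\<omega> j))}"
    proof -
      have "(1 / 2 :: real) ^ L \<le> (1 / 2) ^ c \<longleftrightarrow> c \<le> L" for c
        by (rule power_decreasing_iff) auto
      then show ?thesis using prod_f by simp
    qed
    also have "\<dots> \<le> measure_pmf.expectation \<Omega> (\<lambda>\<omega>. \<Prod>j\<in>{..<M}. f (\<omega> j)) / (1 / 2) ^ L"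
      by (rule finite_pmf_prob_Markov[OF fin_\<Omega>]) (auto simp: f_def intro!: prod_nonneg)
    also have "measure_pmf.expectation \<Omega> (\<lambda>\<omega>. \<Prod>j\<in>{..<M}. f (\<omega> j))
      = (measure_pmf.expectation (pmf_of_set Tup) f) ^ M"
      by (subst prod_\<Omega>) (auto simp: f_def)
    also have "\<dots> \<le> (1 - q / 2) ^ M" using Ef' by (intro power_mono) auto
    also have "\<dots> = ((1 - q / 2) ^ D) ^ N" by (simp add: M_def power_mult)
    also have "\<dots> \<le> (1 / 4) ^ N" using D q by (intro power_mono) auto
    finally show ?thesis by (simp add: field_simps divide_right_mono)
  qed
  have "measure_pmf.prob \<Omega> (\<Union>S\<in>Big. {\<omega>. card (good \<omega> S) \<le> L})
      \<le> (\<Sum>S\<in>Big. measure_pmf.prob \<Omega> {\<omega>. card (good \<omega> S) \<le> L})"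
    using finB by (intro measure_pmf.finite_measure_subadditive_finite) auto
  also have "\<dots> \<le> real (card Big) * (2 ^ L * (1 / 4) ^ N)"
    using sum_bounded_above[of Big "\<lambda>S. measure_pmf.prob \<Omega> {\<omega>. card (good \<omega> S) \<le> L}"] prob_good
    by blast
  also have "\<dots> \<le> 2 ^ N * (2 ^ L * (1 / 4) ^ N)" using cardB by (intro mult_right_mono) auto
  also have "\<dots> = 2 ^ L * (1 / 2) ^ N"
  proof -
    have "(1 / 4 :: real) ^ N = (1 / 2) ^ N * (1 / 2) ^ N" by (simp flip: power_mult_distrib)
    moreover have "(2 :: real) ^ N * (1 / 2) ^ N = 1" by (simp flip: power_mult_distrib)
    ultimately show ?thesis by (simp add: algebra_simps)
  qed
  also have "\<dots> \<le> 2 ^ L * (1 / 2) ^ (L + 2)"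
    by (intro mult_left_mono power_decreasing) (auto simp: N_def)
  also have "\<dots> < 1 / 2"
  proof -
    have "(2 :: real) ^ L * (1 / 2) ^ L = 1" by (simp flip: power_mult_distrib)
    then have "(2 :: real) ^ L * (1 / 2) ^ (L + 2) = 1 / 4" by (simp add: power_add power2_eq_square)
    then show ?thesis by simp
  qed
  finally have few_bad: "measure_pmf.prob \<Omega> (\<Union>S\<in>Big. {\<omega>. card (good \<omega> S) \<le> L}) < 1 / 2" .

  let ?B1 = "{\<omega>. 2 * \<Lambda> + 1 \<le> real (card (defs \<omega>))}"
  let ?B2 = "\<Union>S\<in>Big. {\<omega>. card (good \<omega> S) \<le> L}"
  have "measure_pmf.prob \<Omega> (?B1 \<union> ?B2) < 1"
    using measure_Un_le[of ?B1 "measure_pmf \<Omega>" ?B2] few_defs few_bad by simp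
  then have "\<not> set_pmf \<Omega> \<subseteq> ?B1 \<union> ?B2"
    using measure_pmf.prob_eq_1[of "?B1 \<union> ?B2" \<Omega>] by (auto simp: AE_measure_pmf_iff)
  then obtain \<omega> where \<omega>: "\<omega> \<in> set_pmf \<Omega>" "\<omega> \<notin> ?B1" "\<omega> \<notin> ?B2" by auto
  \<comment> \<open>All members of defective families are dropped. A defective family among the
    remaining indices would be one of the original defects, hence would have been dropped.\<close>
  define IX where "IX = {..<M} - \<Union>(defs \<omega>)"
  have fin_defs: "finite (defs \<omega>)" using defs_sub finite_subset by blast
  have card_Un: "card (\<Union>(defs \<omega>)) \<le> L"
  proof -
    have "card (\<Union>(defs \<omega>)) \<le> (\<Sum>\<T>\<in>defs \<omega>. card \<T>)" by (rule card_Union_le_sum_card)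
    also have "\<dots> \<le> (\<Sum>\<T>\<in>defs \<omega>. \<tau>)"
      by (intro sum_mono) (auto simp: defs_def defect_def)
    also have "\<dots> = card (defs \<omega>) * \<tau>" by simp
    also have "card (defs \<omega>) \<le> m"
    proof -
      have "real (card (defs \<omega>)) \<le> 2 * \<Lambda> + 1" using \<omega>(2) by simp
      then show ?thesis unfolding m_def by (rule le_nat_floor)
    qed
    finally show ?thesis unfolding L_def by simp
  qed
  show ?thesis
  proof (rule that[of N IX \<omega>])
    show "\<forall>j\<in>IX. \<omega> j ` {..<k} \<subseteq> {..<N}"
      using \<omega>(1) set_\<Omega> unfolding IX_def Tup_def by fastforce
    show "\<forall>S\<subseteq>IX. S \<noteq> {} \<longrightarrow> card S \<le> \<tau> \<longrightarrow>
        (k - 1) * card S + 1 \<le> card (\<Union>j\<in>S. \<omega> j ` {..<k})"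
    proof (intro allI impI, rule ccontr)
      fix S assume S: "S \<subseteq> IX" "S \<noteq> {}" "card S \<le> \<tau>"
        "\<not> (k - 1) * card S + 1 \<le> card (\<Union>j\<in>S. \<omega> j ` {..<k})"
      then have "S \<in> defs \<omega>" unfolding defs_def defect_def IX_def by auto
      then show False using S unfolding IX_def by blast
    qed
    show "\<forall>S\<subseteq>{..<N}. \<delta> * N \<le> card S \<longrightarrow> (\<exists>j\<in>IX. \<omega> j ` {..<k} \<subseteq> S)"
    proof (intro allI impI, rule ccontr)
      fix S assume S: "S \<subseteq> {..<N}" "\<delta> * N \<le> card S"
        "\<not> (\<exists>j\<in>IX. \<omega> j ` {..<k} \<subseteq> S)"
      \<comment> \<open>If no surviving tuple fits into \<open>S\<close>, all tuples inside
        \<open>S\<close> were deleted, so there are at most \<open>L\<close> of them.\<close>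
      then have "good \<omega> S \<subseteq> \<Union>(defs \<omega>)" unfolding good_def IX_def by auto
      moreover have "finite (\<Union>(defs \<omega>))"
        using fin_defs defs_sub[of \<omega>] by (meson Sup_upper2 finite_Union finite_lessThan finite_subset
            PowD subsetD)
      ultimately have "card (good \<omega> S) \<le> L" using card_mono card_Un le_trans by blast
      then show False using \<omega>(3) S unfolding Big_def by auto
    qed
  qed (use N IX_def in auto)
qed

subsection \<open>Block graphs\<close>

locale block_graph =
  fixes k \<tau> :: nat and IX :: "nat set" and w :: "nat \<Rightarrow> nat \<Rightarrow> nat" and W :: "nat ugraph"
  assumes k: "2 \<le> k" and \<tau>: "2 \<le> \<tau>" and W: "ugraph W" "uverts W = {..<k}"
    and fin_IX: "finite IX"
    and sparse: "\<And>S. S \<subseteq> IX \<Longrightarrow> S \<noteq> {} \<Longrightarrow> card S \<le> \<tau> \<Longrightarrow>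
      (k - 1) * card S + 1 \<le> card (\<Union>j\<in>S. w j ` {..<k})"
begin

definition Bl :: "nat \<Rightarrow> nat set" where "Bl j = w j ` {..<k}"

definition EG :: "nat set set" where "EG = (\<Union>j\<in>IX. (`) (w j) ` uedges W)"

lemma finite_Bl: "finite (Bl j)" by (simp add: Bl_def)

text \<open>Sparsity for the family \<open>{j}\<close> already forces all entries of the tuple to be
  distinct.\<close>

lemma card_Bl: assumes "j \<in> IX" shows "card (Bl j) = k"
proof -
  have "(k - 1) * card {j} + 1 \<le> card (\<Union>j\<in>{j}. w j ` {..<k})"
    by (rule sparse) (use assms \<tau> in auto)
  then have "k \<le> card (w j ` {..<k})" using k by simp
  moreover have "card (w j ` {..<k}) \<le> k" using card_image_le[of "{..<k}" "w j"] by simp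
  ultimately show ?thesis unfolding Bl_def by simp
qed

lemma inj_w: "j \<in> IX \<Longrightarrow> inj_on (w j) {..<k}"
  using card_Bl unfolding Bl_def by (intro eq_card_imp_inj_on) auto

text \<open>Two blocks together have at least \<open>2 * (k - 1) + 1\<close> points, so the
  hypergraph is linear.\<close>

lemma Bl_Int: assumes "j \<in> IX" "j' \<in> IX" "j \<noteq> j'" shows "card (Bl j \<inter> Bl j') \<le> 1"
proof -
  have "(k - 1) * card {j, j'} + 1 \<le> card (\<Union>j\<in>{j, j'}. w j ` {..<k})"
    by (rule sparse) (use assms \<tau> in auto)
  then have "2 * (k - 1) + 1 \<le> card (Bl j \<union> Bl j')" using assms by (simp add: Bl_def)
  moreover have "card (Bl j) + card (Bl j') = card (Bl j \<union> Bl j') + card (Bl j \<inter> Bl j')"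
    by (rule card_Un_Int) (simp_all add: finite_Bl)
  ultimately show ?thesis using card_Bl assms k by simp
qed

text \<open>Two points lie in at most one block, so no other block adds an edge within
  \<open>Bl j\<close>: each block carries an induced copy of \<open>W\<close>.\<close>

lemma block_edge_iff:
  assumes "j \<in> IX" "a < k" "b < k"
  shows "{w j a, w j b} \<in> EG \<longleftrightarrow> {a, b} \<in> uedges W"
proof
  assume "{a, b} \<in> uedges W"
  then have "w j ` {a, b} \<in> EG" unfolding EG_def using assms(1) by blast
  then show "{w j a, w j b} \<in> EG" by simp
next
  assume "{w j a, w j b} \<in> EG"
  then obtain j' e where j': "j' \<in> IX" "e \<in> uedges W" "{w j a, w j b} = w j' ` e"
    unfolding EG_def by blast
  obtain a' b' where e: "e = {a', b'}" "a' < k" "b' < k" "a' \<noteq> b'"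
    using ugraph_edgeE[OF W(1) j'(2)] W(2) by (metis lessThan_iff)
  have ne: "w j' a' \<noteq> w j' b'" using inj_w[OF j'(1)] e by (auto dest: inj_onD)
  have eq: "{w j a, w j b} = {w j' a', w j' b'}" using j' e by simp
  have "j' = j"
  proof (rule ccontr)
    assume "j' \<noteq> j"
    have "{w j' a', w j' b'} \<subseteq> Bl j \<inter> Bl j'" unfolding Bl_def using eq assms e
      by (metis image_eqI insert_subset Int_iff empty_subsetI lessThan_iff insertCI insertE singletonD)
    then have "card {w j' a', w j' b'} \<le> card (Bl j \<inter> Bl j')"
      by (intro card_mono) (simp_all add: finite_Bl)
    then show False using Bl_Int[OF assms(1) j'(1)] \<open>j' \<noteq> j\<close> ne by simp
  qed
  then have "w j ` {a, b} = w j ` {a', b'}" using eq by simp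
  then have "{a, b} = {a', b'}"
    using inj_on_image_eq_iff[OF inj_w[OF assms(1)], of "{a, b}" "{a', b'}"] assms e by simp
  then show "{a, b} \<in> uedges W" using j' e by simp
qed

text \<open>If the blocks used by a two-connected subgraph were at least two, grow a set of blocks as
  long as its union has at most \<open>(k - 1) s + 1\<close> elements. By sparsity the last block
  meets the union of the others in a single vertex, which is then a cut vertex.\<close>

lemma two_connected_in_block:
  assumes J: "ugraph J" "two_connected J" "uedges J \<subseteq> EG" "card (uverts J) * card (uverts J) \<le> \<tau>"
  obtains j where "j \<in> IX" "uverts J \<subseteq> Bl j" "\<And>e. e \<in> uedges J \<Longrightarrow> \<exists>e'\<in>uedges W. e = w j ` e'"
proof -
  have con: "connected_graph J" and big: "2 < card (uverts J)"
    using J(2) by (auto simp: two_connected_def)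
  have finJ: "finite (uverts J)" using J(1) by (simp add: ugraph_def)
  have "\<forall>e\<in>uedges J. \<exists>j\<in>IX. \<exists>e'\<in>uedges W. e = w j ` e'" using J(3) unfolding EG_def by blast
  then obtain c where c: "\<And>e. e \<in> uedges J \<Longrightarrow> c e \<in> IX \<and> (\<exists>e'\<in>uedges W. e = w (c e) ` e')"
    by metis
  have cBl: "e \<subseteq> Bl (c e)" if e: "e \<in> uedges J" for e
  proof -
    obtain e' where "e' \<in> uedges W" "e = w (c e) ` e'" using c[OF e] by blast
    moreover have "e' \<subseteq> {..<k}" using calculation(1) W by (auto simp: ugraph_def all_edges_def)
    ultimately show ?thesis unfolding Bl_def by blast
  qed
  define \<T> where "\<T> = c ` uedges J"
  have \<T>IX: "\<T> \<subseteq> IX" unfolding \<T>_def using c by blast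
  \<comment> \<open>One block is chosen per edge, so the number of blocks involved is at most the
    number of edges and stays within the range \<open>\<tau>\<close> of the sparsity
    hypothesis.\<close>
  have "card (uedges J) \<le> card (uverts J \<times> uverts J)"
  proof (rule surj_card_le)
    show "uedges J \<subseteq> (\<lambda>(x, y). {x, y}) ` (uverts J \<times> uverts J)"
    proof
      fix e assume "e \<in> uedges J"
      then obtain x y where "e = {x, y}" "x \<in> uverts J" "y \<in> uverts J"
        using ugraph_edgeE[OF J(1)] by metis
      then show "e \<in> (\<lambda>(x, y). {x, y}) ` (uverts J \<times> uverts J)" by force
    qed
  qed (use finJ in simp)
  then have "card (uedges J) \<le> \<tau>" using J(4) by (simp add: card_cartesian_product)
  then have card\<T>: "card \<T> \<le> \<tau>"
    unfolding \<T>_def using card_image_le[OF finite_uedges[OF J(1)], of c] by linarith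
  have fin\<T>: "finite \<T>" unfolding \<T>_def using finite_uedges[OF J(1)] by simp
  have edge_at: "\<exists>y. {x, y} \<in> uedges J" if x: "x \<in> uverts J" for x
  proof (rule ccontr)
    assume no: "\<nexists>y. {x, y} \<in> uedges J"
    have "uverts J \<subseteq> {x}"
    proof
      fix y assume y: "y \<in> uverts J"
      show "y \<in> {x}"
        by (rule connected_graph_closed[OF con x _ y]) (use no in auto)
    qed
    then have "card (uverts J) \<le> 1" using card_mono[of "{x}" "uverts J"] by simp
    then show False using big by simp
  qed
  obtain x0 where x0: "x0 \<in> uverts J" using con by (auto simp: connected_graph_def)
  obtain j0 where j0: "j0 \<in> \<T>" unfolding \<T>_def using edge_at[OF x0] by blast
  define U where "U S = (\<Union>j\<in>S. Bl j)" for S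
  have finU: "finite (U S)" if "S \<subseteq> \<T>" for S
    unfolding U_def using that fin\<T> finite_subset finite_Bl by blast
  have "\<T> = {j0}"
  proof (rule ccontr)
    assume ne: "\<T> \<noteq> {j0}"
    \<comment> \<open>Proper subfamilies spanning no more points than a tree of blocks would. A
      singleton has this property, and it is proper because at least two blocks are assumed.\<close>
    define Fam where "Fam = {S. S \<subset> \<T> \<and> S \<noteq> {} \<and> card (U S) \<le> (k - 1) * card S + 1}"
    have "{j0} \<in> Fam"
      unfolding Fam_def U_def using ne j0 card_Bl[of j0] \<T>IX k by auto
    moreover have "finite Fam" unfolding Fam_def using fin\<T> by (auto intro: finite_subset[of _ "Pow \<T>"])
    ultimately obtain S where S: "S \<in> Fam" and max: "\<And>S'. S' \<in> Fam \<Longrightarrow> S \<subseteq> S' \<Longrightarrow> S' = S"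
      using finite_has_maximal2[of Fam "{j0}"] by metis
    have S\<T>: "S \<subset> \<T>" and Sne: "S \<noteq> {}" and cardUS: "card (U S) \<le> (k - 1) * card S + 1"
      using S unfolding Fam_def by auto
    have finS: "finite S" using S\<T> fin\<T> finite_subset by blast
    obtain j2 where j2: "j2 \<in> S" using Sne by auto
    then obtain e2 where e2: "e2 \<in> uedges J" "c e2 = j2" using S\<T> unfolding \<T>_def by blast
    have "\<exists>j1\<in>\<T> - S. Bl j1 \<inter> U S \<noteq> {}"
    proof (rule ccontr)
      assume no: "\<not> ?thesis"
      obtain a b where ab: "e2 = {a, b}" "a \<in> uverts J" using ugraph_edgeE[OF J(1) e2(1)] by metis
      have aU: "a \<in> U S" using cBl[OF e2(1)] e2 ab j2 unfolding U_def by blast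
      have all: "y \<in> U S" if y: "y \<in> uverts J" for y
      proof (rule connected_graph_closed[OF con ab(2) aU y])
        fix p q assume pq: "{p, q} \<in> uedges J" "p \<in> U S"
        have "c {p, q} \<in> S"
        proof (rule ccontr)
          assume "c {p, q} \<notin> S"
          then have "c {p, q} \<in> \<T> - S" using pq unfolding \<T>_def by blast
          then show False using no cBl[OF pq(1)] pq(2) by blast
        qed
        then show "q \<in> U S" using cBl[OF pq(1)] unfolding U_def by blast
      qed
      obtain j' where j': "j' \<in> \<T> - S" using S\<T> by blast
      then obtain e' where e': "e' \<in> uedges J" "c e' = j'" unfolding \<T>_def by blast
      obtain p where "p \<in> e'" "p \<in> uverts J" using ugraph_edgeE[OF J(1) e'(1)] by blast
      then show False using all[of p] cBl[OF e'(1)] e' j' no by blast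
    qed
    then obtain j1 where j1: "j1 \<in> \<T> - S" "Bl j1 \<inter> U S \<noteq> {}" by blast
    have j1IX: "j1 \<in> IX" using j1 \<T>IX by blast
    have Uins: "U (insert j1 S) = Bl j1 \<union> U S" unfolding U_def by auto
    have sum: "card (Bl j1) + card (U S) = card (U (insert j1 S)) + card (Bl j1 \<inter> U S)"
      unfolding Uins using S\<T> by (intro card_Un_Int) (auto simp: finite_Bl finU)
    have "1 \<le> card (Bl j1 \<inter> U S)"
      using j1(2) finite_Bl by (simp add: Suc_le_eq card_gt_0_iff)
    then have small: "card (U (insert j1 S)) \<le> (k - 1) * card (insert j1 S) + 1"
      using sum cardUS card_Bl[OF j1IX] finS j1 k by (cases k) (simp_all add: algebra_simps)
    \<comment> \<open>A further block that meets the union brings at most \<open>k - 1\<close> new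
      points, so it would again yield a member of \<open>Fam\<close>; by maximality it can only be
      the last missing block.\<close>
    have full: "insert j1 S = \<T>"
    proof (rule ccontr)
      assume "insert j1 S \<noteq> \<T>"
      then have "insert j1 S \<in> Fam" unfolding Fam_def using j1 S\<T> small by auto
      then show False using max[of "insert j1 S"] j1 by auto
    qed
    have "(k - 1) * card \<T> + 1 \<le> card (U \<T>)"
      unfolding U_def Bl_def by (rule sparse) (use \<T>IX j0 card\<T> in auto)
    moreover have "card \<T> = Suc (card S)" using full finS j1 by auto
    ultimately have "card (Bl j1 \<inter> U S) \<le> 1"
      using sum cardUS card_Bl[OF j1IX] full k by (cases k) (simp_all add: algebra_simps)
    then have "card (Bl j1 \<inter> U S) = 1" using \<open>1 \<le> card (Bl j1 \<inter> U S)\<close> by simp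
    then obtain x where x: "Bl j1 \<inter> U S = {x}" by (auto simp: card_1_singleton_iff)
    have con': "connected_graph (induced J (uverts J - {x}))"
    proof (cases "x \<in> uverts J")
      case True
      then show ?thesis using J(2) by (simp add: two_connected_def)
    next
      case False
      have "induced J (uverts J - {x}) = J"
        using False J(1) unfolding induced_def ugraph_def all_edges_def
        by (intro prod_eqI) auto
      then show ?thesis using con by simp
    qed
    obtain e1 where e1: "e1 \<in> uedges J" "c e1 = j1" using j1 unfolding \<T>_def by blast
    obtain p where p: "p \<in> e1" "p \<noteq> x" "p \<in> uverts J" using ugraph_edgeE[OF J(1) e1(1)]
      by (metis insertCI)
    obtain r where r: "r \<in> e2" "r \<noteq> x" "r \<in> uverts J" using ugraph_edgeE[OF J(1) e2(1)]
      by (metis insertCI)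
    \<comment> \<open>After deleting \<open>x\<close>, an edge that starts in the last block cannot
      belong to a block of \<open>S\<close>, since \<open>x\<close> is the only common point. Hence
      no walk from \<open>p\<close> leaves \<open>Bl j1\<close>, although \<open>r\<close> lies in
      \<open>U S\<close>.\<close>
    have "r \<in> Bl j1"
    proof (rule connected_graph_closed[OF con', of p])
      show "p \<in> uverts (induced J (uverts J - {x}))" "r \<in> uverts (induced J (uverts J - {x}))"
        using p r by auto
      show "p \<in> Bl j1" using p cBl[OF e1(1)] e1 by blast
      fix a b assume ab: "{a, b} \<in> uedges (induced J (uverts J - {x}))" "a \<in> Bl j1"
      then have abJ: "{a, b} \<in> uedges J" "a \<noteq> x" by auto
      have "a \<notin> U S" using x ab(2) abJ(2) by blast
      then have "c {a, b} \<notin> S" using cBl[OF abJ(1)] unfolding U_def by blast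
      then have "c {a, b} = j1" using abJ(1) full unfolding \<T>_def by blast
      then show "b \<in> Bl j1" using cBl[OF abJ(1)] by blast
    qed
    moreover have "r \<in> U S" using r cBl[OF e2(1)] e2 j2 unfolding U_def by blast
    ultimately show False using x r by blast
  qed
  then have cj: "c e = j0" if "e \<in> uedges J" for e using that unfolding \<T>_def by blast
  show ?thesis
  proof (rule that[of j0])
    show "j0 \<in> IX" using j0 \<T>IX by blast
    show "uverts J \<subseteq> Bl j0"
    proof
      fix x assume "x \<in> uverts J"
      then obtain y where "{x, y} \<in> uedges J" using edge_at by blast
      then show "x \<in> Bl j0" using cBl cj by blast
    qed
    show "\<exists>e'\<in>uedges W. e = w j0 ` e'" if "e \<in> uedges J" for e
      using c[OF that] cj[OF that] by simp
  qed
qed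

lemma two_connected_emb:
  assumes J: "ugraph J" "two_connected J" "uedges J \<subseteq> EG" "card (uverts J) * card (uverts J) \<le> \<tau>"
  obtains h where "emb h J W"
proof -
  obtain j where j: "j \<in> IX" "uverts J \<subseteq> Bl j" "\<And>e. e \<in> uedges J \<Longrightarrow> \<exists>e'\<in>uedges W. e = w j ` e'"
    using two_connected_in_block[OF assms] by blast
  let ?h = "the_inv_into {..<k} (w j)"
  have inj: "inj_on (w j) {..<k}" using inj_w j by simp
  have "emb ?h J W"
    unfolding emb_def
  proof (intro conjI ballI)
    show "inj_on ?h (uverts J)"
      using inj_on_the_inv_into[OF inj] j(2) inj_on_subset unfolding Bl_def by blast
    show "?h ` uverts J \<subseteq> uverts W"
      using j(2) W(2) the_inv_into_into[OF inj _ subset_refl] unfolding Bl_def by blast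
    fix e assume "e \<in> uedges J"
    then obtain e' where e': "e' \<in> uedges W" "e = w j ` e'" using j(3) by blast
    moreover have "e' \<subseteq> {..<k}" using e' W by (auto simp: ugraph_def all_edges_def)
    then have "?h ` (w j ` e') = e'"
      using the_inv_into_f_f[OF inj] by (force simp: image_image)
    ultimately show "?h ` e \<in> uedges W" by simp
  qed
  then show ?thesis using that by blast
qed

end

text \<open>Blocks of a sparse hypergraph are filled with \<open>W\<close>. A small two-connected
  subgraph lies in one block, thus embeds into \<open>W\<close>, and the degeneracy of
  \<open>W\<close> sends it on to \<open>A\<close>; every dense vertex set contains a whole block
  and with it an induced copy of \<open>W\<close>.\<close>

lemma degenerate_host_exists:
  fixes W :: "'c ugraph" and A :: "'b ugraph" and \<delta> :: real and g :: nat
  assumes W: "ugraph W" "2 \<le> card (uverts W)" "degenerate A W" and \<delta>: "0 < \<delta>"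
  obtains N :: nat and EG :: "nat set set"
  where "0 < N" "ugraph ({..<N}, EG)"
    "\<forall>J. subgraph J ({..<N}, EG) \<longrightarrow> two_connected J \<longrightarrow> card (uverts J) \<le> g \<longrightarrow> (\<exists>f. emb f J A)"
    "\<forall>S\<subseteq>{..<N}. \<delta> * N \<le> card S \<longrightarrow>
      (\<exists>\<psi>. inj_on \<psi> (uverts W) \<and> \<psi> ` uverts W \<subseteq> S \<and>
        (\<forall>x\<in>uverts W. \<forall>y\<in>uverts W. {\<psi> x, \<psi> y} \<in> EG \<longleftrightarrow> {x, y} \<in> uedges W))"
proof -
  define k where "k = card (uverts W)"
  have finW: "finite (uverts W)" using W by (simp add: ugraph_def)
  obtain \<beta> where \<beta>: "bij_betw \<beta> (uverts W) {..<k}"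
    using ex_bij_betw_finite_nat[OF finW] unfolding k_def by (auto simp: atLeast0LessThan)
  define W' where "W' = map_graph \<beta> W"
  have inj\<beta>: "inj_on \<beta> (uverts W)" using \<beta> by (simp add: bij_betw_def)
  have W': "ugraph W'" "uverts W' = {..<k}"
    using ugraph_map_graph[OF W(1) inj\<beta>] \<beta> by (auto simp: W'_def map_graph_def bij_betw_def)
  have edge': "{\<beta> x, \<beta> y} \<in> uedges W' \<longleftrightarrow> {x, y} \<in> uedges W"
    if "x \<in> uverts W" "y \<in> uverts W" for x y
  proof
    assume "{x, y} \<in> uedges W"
    then have "\<beta> ` {x, y} \<in> uedges W'" unfolding W'_def map_graph_def snd_conv by (rule imageI)
    then show "{\<beta> x, \<beta> y} \<in> uedges W'" by simp
  next
    assume "{\<beta> x, \<beta> y} \<in> uedges W'"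
    then obtain e where e: "e \<in> uedges W" "\<beta> ` {x, y} = \<beta> ` e" unfolding W'_def map_graph_def by auto
    moreover have "e \<subseteq> uverts W" using e W by (auto simp: ugraph_def all_edges_def)
    ultimately have "{x, y} = e"
      using inj_on_image_eq_iff[OF inj\<beta>, of "{x, y}" e] that by blast
    then show "{x, y} \<in> uedges W" using e by simp
  qed
  have embW': "emb (the_inv_into (uverts W) \<beta>) W' W"
    unfolding emb_def
  proof (intro conjI ballI)
    show "inj_on (the_inv_into (uverts W) \<beta>) (uverts W')"
      using inj_on_the_inv_into[OF inj\<beta>] \<beta> W'(2) by (simp add: bij_betw_def)
    show "the_inv_into (uverts W) \<beta> ` uverts W' \<subseteq> uverts W"
      using the_inv_into_into[OF inj\<beta> _ subset_refl] \<beta> W'(2) by (auto simp: bij_betw_def)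
    fix e assume "e \<in> uedges W'"
    then obtain e' where e': "e' \<in> uedges W" "e = \<beta> ` e'" unfolding W'_def map_graph_def by auto
    moreover have "e' \<subseteq> uverts W" using e' W by (auto simp: ugraph_def all_edges_def)
    then have "the_inv_into (uverts W) \<beta> ` (\<beta> ` e') = e'"
      using the_inv_into_f_f[OF inj\<beta>] by (force simp: image_image)
    ultimately show "the_inv_into (uverts W) \<beta> ` e \<in> uedges W" by simp
  qed
  \<comment> \<open>The \<open>2\<close> makes the sparsity condition apply to pairs of blocks;
    \<open>g * g\<close> bounds the number of edges of a graph on \<open>g\<close> vertices, hence
    the number of blocks that it uses.\<close>
  define \<tau> where "\<tau> = 2 + g * g"
  have k2: "2 \<le> k" using W(2) k_def by simp
  obtain N :: nat and IX and w :: "nat \<Rightarrow> nat \<Rightarrow> nat" where h: "0 < N" "finite IX"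
      "\<forall>j\<in>IX. w j ` {..<k} \<subseteq> {..<N}"
    "\<forall>S\<subseteq>IX. S \<noteq> {} \<longrightarrow> card S \<le> \<tau> \<longrightarrow> (k - 1) * card S + 1 \<le> card (\<Union>j\<in>S. w j ` {..<k})"
    "\<forall>S\<subseteq>{..<N}. \<delta> * N \<le> card S \<longrightarrow> (\<exists>j\<in>IX. w j ` {..<k} \<subseteq> S)"
    by (rule sparse_hypergraph[OF k2 \<delta>, of \<tau>], rule that, assumption+)
  interpret block_graph k \<tau> IX w W'
    by unfold_locales (use h W' W(2) k_def \<tau>_def in auto)
  show ?thesis
  proof (rule that[of N EG])
    show "ugraph ({..<N}, EG)"
      unfolding ugraph_def
    proof (intro conjI subsetI)
      fix e assume "e \<in> uedges ({..<N}, EG)"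
      then obtain j e' where e: "j \<in> IX" "e' \<in> uedges W'" "e = w j ` e'" unfolding EG_def by auto
      have e': "e' \<subseteq> {..<k}" "card e' = 2" using e(2) W' by (auto simp: ugraph_def all_edges_def)
      then have "card e = 2" using e card_image[OF inj_on_subset[OF inj_w[OF e(1)]]] by simp
      then show "e \<in> all_edges (uverts ({..<N}, EG))"
        using e e' h(3) unfolding all_edges_def by fastforce
    qed simp
    have "\<exists>f. emb f J A"
      if J: "subgraph J ({..<N}, EG)" "two_connected J" "card (uverts J) \<le> g" for J
    proof -
      have J': "ugraph J" "uedges J \<subseteq> EG" using J by (auto simp: subgraph_def)
      have "card (uverts J) * card (uverts J) \<le> \<tau>"
        using mult_le_mono[OF J(3) J(3)] unfolding \<tau>_def by simp
      then obtain f where "emb f J W'" using two_connected_emb[OF J'(1) J(2) J'(2)] by blast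
      then have "degenerate A J"
        using degenerate_emb[OF assms(3)] emb_comp[OF _ embW'] by blast
      then show ?thesis
        unfolding degenerate_iff_emb using J(2) J'(1) by (metis order_refl subgraph_def)
    qed
    then show "\<forall>J. subgraph J ({..<N}, EG) \<longrightarrow> two_connected J \<longrightarrow> card (uverts J) \<le> g \<longrightarrow>
        (\<exists>f. emb f J A)" by blast
    have "\<exists>\<psi>. inj_on \<psi> (uverts W) \<and> \<psi> ` uverts W \<subseteq> S \<and>
        (\<forall>x\<in>uverts W. \<forall>y\<in>uverts W. {\<psi> x, \<psi> y} \<in> EG \<longleftrightarrow> {x, y} \<in> uedges W)"
      if S: "S \<subseteq> {..<N}" "\<delta> * N \<le> card S" for S
    proof -
      obtain j where j: "j \<in> IX" "w j ` {..<k} \<subseteq> S" using h(5) S by blast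
      have \<beta>k: "\<beta> x < k" if "x \<in> uverts W" for x using that \<beta> by (auto simp: bij_betw_def)
      have "inj_on (w j \<circ> \<beta>) (uverts W)"
        using comp_inj_on[OF inj\<beta>] inj_w[OF j(1)] \<beta> by (simp add: bij_betw_def)
      moreover have "(w j \<circ> \<beta>) ` uverts W \<subseteq> S" using j(2) \<beta>k by auto
      moreover have "{(w j \<circ> \<beta>) x, (w j \<circ> \<beta>) y} \<in> EG \<longleftrightarrow> {x, y} \<in> uedges W"
        if "x \<in> uverts W" "y \<in> uverts W" for x y
        using block_edge_iff[OF j(1) \<beta>k \<beta>k] edge' that by simp
      ultimately show ?thesis by blast
    qed
    then show "\<forall>S\<subseteq>{..<N}. \<delta> * N \<le> card S \<longrightarrow>
      (\<exists>\<psi>. inj_on \<psi> (uverts W) \<and> \<psi> ` uverts W \<subseteq> S \<and>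
        (\<forall>x\<in>uverts W. \<forall>y\<in>uverts W. {\<psi> x, \<psi> y} \<in> EG \<longleftrightarrow> {x, y} \<in> uedges W))" by blast
  qed (use h in auto)
qed

subsection \<open>The host graph\<close>

context star_graph
begin

text \<open>The extensional function space makes this set finite, so that its elements can index the
  bodies. The equivalence asks for induced copies: an edge between two attachment vertices must come
  from an edge of \<open>F\<close>.\<close>

definition Emb :: "'a set \<Rightarrow> nat \<Rightarrow> nat set set \<Rightarrow> ('a \<Rightarrow> nat) set" where
  "Emb Rs N EG = {\<psi> \<in> Rs \<rightarrow>\<^sub>E {..<N}. inj_on \<psi> Rs \<and>
     (\<forall>x\<in>Rs. \<forall>y\<in>Rs. {\<psi> x, \<psi> y} \<in> EG \<longleftrightarrow> {x, y} \<in> E)}"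

definition rich :: "'a set \<Rightarrow> nat \<Rightarrow> nat set set \<Rightarrow> real \<Rightarrow> bool" where
  "rich Rs N EG \<delta> \<longleftrightarrow> 0 < N \<and> ugraph ({..<N}, EG) \<and>
    (\<forall>J. subgraph J ({..<N}, EG) \<longrightarrow> two_connected J \<longrightarrow> card (uverts J) \<le> card V \<longrightarrow> (\<exists>f. emb f J F0)) \<and>
    (\<forall>S\<subseteq>{..<N}. \<delta> * N \<le> card S \<longrightarrow>
      (\<exists>\<phi>. inj_on \<phi> (V - {u, v}) \<and> \<phi> ` (V - {u, v}) \<subseteq> S \<and>
         (\<forall>x\<in>V - {u, v}. \<forall>y\<in>V - {u, v}. {x, y} \<in> E \<longrightarrow> {\<phi> x, \<phi> y} \<in> EG)) \<and>
      (\<exists>\<psi>\<in>Emb Rs N EG. \<psi> ` Rs \<subseteq> S))"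

text \<open>The blocks are filled with the disjoint union of \<open>F0\<close> and the graph induced
  by \<open>Rs\<close>. A two-connected graph lies in one summand, and both summands are
  \<open>F0\<close>-degenerate.\<close>

lemma rich_exists:
  assumes Rs: "Rs \<subseteq> V" "Rs \<noteq> {}" "deg Rs" and \<delta>: "0 < \<delta>"
  shows "\<exists>N EG. rich Rs N EG \<delta>"
proof -
  define W :: "('a + 'a) ugraph" where
    "W = (Inl ` (V - {u, v}) \<union> Inr ` Rs,
      (`) Inl ` uedges F0 \<union> (`) Inr ` uedges (induced F Rs))"
  have finRs: "finite Rs" using Rs finite_V finite_subset by blast
  have F0: "ugraph F0" "ugraph (induced F Rs)" using ugraph_induced[OF ugraph_F] Rs by auto
  have uW: "ugraph W"
  proof -
    have "ugraph (map_graph (Inl :: 'a \<Rightarrow> 'a + 'a) F0)"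
      "ugraph (map_graph (Inr :: 'a \<Rightarrow> 'a + 'a) (induced F Rs))"
      using ugraph_map_graph F0 inj_on_subset[OF inj_Inl] inj_on_subset[OF inj_Inr] by blast+
    then have m: "(`) (Inl :: 'a \<Rightarrow> 'a + 'a) ` uedges F0 \<subseteq> all_edges (Inl ` (V - {u, v}))"
      "(`) (Inr :: 'a \<Rightarrow> 'a + 'a) ` uedges (induced F Rs) \<subseteq> all_edges (Inr ` Rs)"
      unfolding ugraph_def map_graph_def by (simp_all del: uedges_induced)
    have mono: "all_edges A \<subseteq> all_edges (A \<union> B)" "all_edges B \<subseteq> all_edges (A \<union> B)"
      for A B :: "('a + 'a) set" unfolding all_edges_def by auto
    show ?thesis
      unfolding W_def ugraph_def fst_conv snd_conv
    proof (intro conjI Un_least)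
      show "finite (Inl ` (V - {u, v}) \<union> Inr ` Rs)" using finite_V finRs by simp
    qed (rule order_trans[OF m(1) mono(1)], rule order_trans[OF m(2) mono(2)])
  qed
  \<comment> \<open>Blocks need at least two points, so \<open>F0\<close> must have a vertex. With
    the empty independent set, the star property provides a two-connected subgraph and thereby a
    third vertex.\<close>
  have V3: "V - {u, v} \<noteq> {}"
  proof
    assume "V - {u, v} = {}"
    then have "V \<subseteq> {u, v}" by auto
    then have "card V \<le> 2" using card_mono[of "{u, v}" V] E_V[OF uv] by simp
    moreover have "\<not> degenerate F0 (induced F (V - {}))"
      by (rule star) (rule indepI, auto)
    then obtain J where J: "subgraph J (induced F (V - {}))" "two_connected J"
      unfolding degenerate_def by blast
    then have "uverts J \<subseteq> V" by (simp add: subgraph_def)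
    then have "2 < card V"
      using card_mono[OF finite_V, of "uverts J"] J(2) unfolding two_connected_def by linarith
    ultimately show False by simp
  qed
  have "card (uverts W) = card (V - {u, v}) + card Rs"
  proof -
    have "(Inl ` (V - {u, v}) :: ('a + 'a) set) \<inter> Inr ` Rs = {}" by auto
    then have "card (uverts W) = card (Inl ` (V - {u, v}) :: ('a + 'a) set) + card (Inr ` Rs :: ('a + 'a)
        set)"
      unfolding W_def fst_conv using finite_V finRs by (intro card_Un_disjoint) auto
    then show ?thesis by (simp add: card_image)
  qed
  moreover have "1 \<le> card (V - {u, v})" using V3 finite_V by (simp add: Suc_le_eq card_gt_0_iff)
  moreover have "1 \<le> card Rs" using Rs(2) finRs by (simp add: Suc_le_eq card_gt_0_iff)
  ultimately have cW: "2 \<le> card (uverts W)" by linarith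
  have edgeW: "{Inl x, Inl y} \<in> uedges W \<longleftrightarrow> {x, y} \<in> uedges F0"
      "{Inr x, Inr y} \<in> uedges W \<longleftrightarrow> {x, y} \<in> uedges (induced F Rs)" for x y
  proof -
    have i: "Inl ` {x, y} = {Inl x, Inl y}" "Inr ` {x, y} = {Inr x, Inr y}" by auto
    have l: "(Inl ` e = Inl ` e') = (e = e')" and r: "(Inr ` e = Inr ` e') = (e = e')"
      for e e' :: "'a set" by (auto simp: inj_image_eq_iff)
    have lr: "{Inl x, Inl y} \<noteq> Inr ` e" "{Inr x, Inr y} \<noteq> Inl ` e" for e by auto
    show "{Inl x, Inl y} \<in> uedges W \<longleftrightarrow> {x, y} \<in> uedges F0"
      unfolding W_def snd_conv Un_iff image_iff using lr(1) l by (metis i(1))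
    show "{Inr x, Inr y} \<in> uedges W \<longleftrightarrow> {x, y} \<in> uedges (induced F Rs)"
      unfolding W_def snd_conv Un_iff image_iff using lr(2) r by (metis i(2))
  qed
  have mixed: "{Inl x, Inr y} \<notin> uedges W" for x y
  proof -
    have "{Inl x, Inr y} \<noteq> Inl ` e" "{Inl x, Inr y} \<noteq> Inr ` e" for e :: "'a set" by blast+
    then show ?thesis unfolding W_def snd_conv Un_iff image_iff by blast
  qed
  have degW: "degenerate F0 W"
    unfolding degenerate_iff_emb
  proof (intro allI impI, elim conjE)
    fix J assume J: "subgraph J W" "two_connected J"
    have JW: "uverts J \<subseteq> uverts W" "uedges J \<subseteq> uedges W" "ugraph J"
      using J(1) by (auto simp: subgraph_def)
    have con: "connected_graph J" using J by (simp add: two_connected_def)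
    obtain x0 where x0: "x0 \<in> uverts J" using con by (auto simp: connected_graph_def)
    have side: "isl x = isl x0" if "x \<in> uverts J" for x
    proof (rule connected_graph_constant[OF con _ that x0])
      fix p q assume "{p, q} \<in> uedges J"
      then have "{p, q} \<in> uedges W" using JW by blast
      then show "isl p = isl q"
        using mixed by (cases p; cases q) (auto simp: insert_commute)
    qed
    show "\<exists>f. emb f J F0"
    proof (cases "isl x0")
      case True
      then have J1: "\<exists>y. x = Inl y" if "x \<in> uverts J" for x
        using side[OF that] by (auto simp: isl_def)
      have "emb projl J F0"
        unfolding emb_def
      proof (intro conjI ballI)
        show "inj_on projl (uverts J)" by (rule inj_onI) (metis J1 sum.sel(1))
        show "projl ` uverts J \<subseteq> uverts F0" using J1 JW(1) unfolding W_def by fastforce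
        fix e assume e: "e \<in> uedges J"
        obtain p q where pq: "e = {p, q}" "p \<in> uverts J" "q \<in> uverts J"
          using ugraph_edgeE[OF JW(3) e] by metis
        obtain x y where "p = Inl x" "q = Inl y" using J1 pq by metis
        then show "projl ` e \<in> uedges F0" using e JW(2) edgeW(1)[of x y] pq by auto
      qed
      then show ?thesis by blast
    next
      case False
      then have J1: "\<exists>y. x = Inr y" if "x \<in> uverts J" for x
        using side[OF that] by (cases x) auto
      have "emb projr J (induced F Rs)"
        unfolding emb_def
      proof (intro conjI ballI)
        show "inj_on projr (uverts J)" by (rule inj_onI) (metis J1 sum.sel(2))
        show "projr ` uverts J \<subseteq> uverts (induced F Rs)" using J1 JW(1) unfolding W_def by fastforce
        fix e assume e: "e \<in> uedges J"
        obtain p q where pq: "e = {p, q}" "p \<in> uverts J" "q \<in> uverts J"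
          using ugraph_edgeE[OF JW(3) e] by metis
        obtain x y where "p = Inr x" "q = Inr y" using J1 pq by metis
        then show "projr ` e \<in> uedges (induced F Rs)" using e JW(2) edgeW(2)[of x y] pq by auto
      qed
      then have "degenerate F0 J" using degenerate_emb Rs(3) unfolding deg_def by blast
      then show ?thesis
        unfolding degenerate_iff_emb using J(2) JW(3) by (metis order_refl subgraph_def)
    qed
  qed
  obtain N :: nat and EG :: "nat set set" where h: "0 < N" "ugraph ({..<N}, EG)"
    "\<forall>J. subgraph J ({..<N}, EG) \<longrightarrow> two_connected J \<longrightarrow> card (uverts J) \<le> card V \<longrightarrow> (\<exists>f. emb f J F0)"
    "\<forall>S\<subseteq>{..<N}. \<delta> * N \<le> card S \<longrightarrow>
      (\<exists>\<psi>. inj_on \<psi> (uverts W) \<and> \<psi> ` uverts W \<subseteq> S \<and>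
        (\<forall>x\<in>uverts W. \<forall>y\<in>uverts W. {\<psi> x, \<psi> y} \<in> EG \<longleftrightarrow> {x, y} \<in> uedges W))"
    by (rule degenerate_host_exists[OF uW cW degW \<delta>, of "card V"], rule that, assumption+)
  have "rich Rs N EG \<delta>"
    unfolding rich_def
  proof (intro conjI)
    show "\<forall>S\<subseteq>{..<N}. \<delta> * N \<le> card S \<longrightarrow>
      (\<exists>\<phi>. inj_on \<phi> (V - {u, v}) \<and> \<phi> ` (V - {u, v}) \<subseteq> S \<and>
         (\<forall>x\<in>V - {u, v}. \<forall>y\<in>V - {u, v}. {x, y} \<in> E \<longrightarrow> {\<phi> x, \<phi> y} \<in> EG)) \<and>
      (\<exists>\<psi>\<in>Emb Rs N EG. \<psi> ` Rs \<subseteq> S)"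
    proof (intro allI impI)
      fix S assume S: "S \<subseteq> {..<N}" "\<delta> * N \<le> card S"
      then obtain \<psi> where \<psi>: "inj_on \<psi> (uverts W)" "\<psi> ` uverts W \<subseteq> S"
        "\<forall>x\<in>uverts W. \<forall>y\<in>uverts W. {\<psi> x, \<psi> y} \<in> EG \<longleftrightarrow> {x, y} \<in> uedges W"
        using h(4) by blast
      have vW: "Inl x \<in> uverts W" if "x \<in> V - {u, v}" for x using that unfolding W_def by auto
      have vW': "Inr x \<in> uverts W" if "x \<in> Rs" for x using that unfolding W_def by auto
      show "(\<exists>\<phi>. inj_on \<phi> (V - {u, v}) \<and> \<phi> ` (V - {u, v}) \<subseteq> S \<and>
         (\<forall>x\<in>V - {u, v}. \<forall>y\<in>V - {u, v}. {x, y} \<in> E \<longrightarrow> {\<phi> x, \<phi> y} \<in> EG)) \<and>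
        (\<exists>\<psi>\<in>Emb Rs N EG. \<psi> ` Rs \<subseteq> S)"
      proof
        show "\<exists>\<phi>. inj_on \<phi> (V - {u, v}) \<and> \<phi> ` (V - {u, v}) \<subseteq> S \<and>
         (\<forall>x\<in>V - {u, v}. \<forall>y\<in>V - {u, v}. {x, y} \<in> E \<longrightarrow> {\<phi> x, \<phi> y} \<in> EG)"
        proof (rule exI[of _ "\<psi> \<circ> Inl"], intro conjI ballI impI)
          show "inj_on (\<psi> \<circ> Inl) (V - {u, v})"
            by (rule inj_onI) (metis \<psi>(1) vW comp_apply inj_onD sum.inject(1))
          show "(\<psi> \<circ> Inl) ` (V - {u, v}) \<subseteq> S" using \<psi>(2) vW by auto
          show "{(\<psi> \<circ> Inl) x, (\<psi> \<circ> Inl) y} \<in> EG"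
            if "x \<in> V - {u, v}" "y \<in> V - {u, v}" "{x, y} \<in> E" for x y
            using \<psi>(3) vW that edgeW(1)[of x y] by simp
        qed
        let ?\<psi> = "restrict (\<psi> \<circ> Inr) Rs"
        have "?\<psi> \<in> Emb Rs N EG"
          unfolding Emb_def
        proof (intro CollectI conjI ballI)
          have "\<psi> (Inr x) < N" if "x \<in> Rs" for x using \<psi>(2) S(1) vW'[OF that] by blast
          then show "?\<psi> \<in> Rs \<rightarrow>\<^sub>E {..<N}" by auto
          show "inj_on ?\<psi> Rs"
            by (rule inj_onI) (metis \<psi>(1) vW' comp_apply inj_onD sum.inject(2) restrict_apply')
          show "{?\<psi> x, ?\<psi> y} \<in> EG \<longleftrightarrow> {x, y} \<in> E" if "x \<in> Rs" "y \<in> Rs" for x y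
            using \<psi>(3) vW' that edgeW(2)[of x y] by simp
        qed
        moreover have "?\<psi> ` Rs \<subseteq> S" using \<psi>(2) vW' by auto
        ultimately show "\<exists>\<psi>\<in>Emb Rs N EG. \<psi> ` Rs \<subseteq> S" by blast
      qed
    qed
  qed (use h in auto)
  then show ?thesis by blast
qed

lemma finite_Emb: "finite Rs \<Longrightarrow> finite (Emb Rs N EG)"
  unfolding Emb_def by (rule finite_subset[of _ "Rs \<rightarrow>\<^sub>E {..<N}"]) (auto intro: finite_PiE)

end

text \<open>The copies and bodies are cliques of \<open>G\<close> and \<open>A2\<close> is
  completely joined to \<open>TT\<close>, so any desired wiring is available inside
  \<open>G\<close>. Bodies are indexed by every induced copy \<open>\<psi>\<close> of
  \<open>Rs\<close> in \<open>\<Gamma>\<close>, because the copy that a vertex with many neighbours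
  in \<open>A2\<close> will see is not known in advance; each occurs \<open>K\<close> times so that
  most vertices see one of them completely.\<close>

locale host = star_graph F u v
  for F :: "'a ugraph" and u v :: 'a +
  fixes Is Rs Ts :: "'a set" and a b :: nat and N :: nat and EG :: "nat set set" and \<delta> :: real
    and G :: "'v ugraph" and M1 M2 K :: nat
    and c1 c2 :: "nat \<Rightarrow> nat \<Rightarrow> 'v" and tb :: "('a \<Rightarrow> nat) \<Rightarrow> nat \<Rightarrow> 'a \<Rightarrow> 'v"
    and A1 A2 TT X :: "'v set"
  assumes min: "minimal_conf Is Rs Ts a b"
    and rich: "rich Rs N EG \<delta>" and \<delta>: "0 < \<delta>"
    and G: "ugraph G"
    and A1: "A1 = (\<lambda>(s, i). c1 s i) ` ({..<M1} \<times> {..<N})" "inj_on (\<lambda>(s, i). c1 s i) ({..<M1} \<times> {..<N})"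
    and A2: "A2 = (\<lambda>(s, i). c2 s i) ` ({..<M2} \<times> {..<N})" "inj_on (\<lambda>(s, i). c2 s i) ({..<M2} \<times> {..<N})"
    and TT: "TT = (\<lambda>(\<psi>, j, t). tb \<psi> j t) ` (Emb Rs N EG \<times> {..<K} \<times> Ts)"
      "inj_on (\<lambda>(\<psi>, j, t). tb \<psi> j t) (Emb Rs N EG \<times> {..<K} \<times> Ts)"
    and disj: "A1 \<inter> A2 = {}" "A1 \<inter> TT = {}" "A2 \<inter> TT = {}"
    and sub: "A1 \<subseteq> uverts G" "A2 \<subseteq> uverts G" "TT \<subseteq> uverts G"
    and X: "X \<subseteq> uverts G - A1 - A2 - TT"
    and clique1: "\<And>s i i'. s < M1 \<Longrightarrow> i < N \<Longrightarrow> i' < N \<Longrightarrow> i \<noteq> i' \<Longrightarrow> {c1 s i, c1 s i'} \<in> uedges G"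
    and clique2: "\<And>s i i'. s < M2 \<Longrightarrow> i < N \<Longrightarrow> i' < N \<Longrightarrow> i \<noteq> i' \<Longrightarrow> {c2 s i, c2 s i'} \<in> uedges G"
    and cliqueT: "\<And>\<psi> j t t'. \<psi> \<in> Emb Rs N EG \<Longrightarrow> j < K \<Longrightarrow> t \<in> Ts \<Longrightarrow> t' \<in> Ts \<Longrightarrow> t \<noteq> t' \<Longrightarrow>
      {tb \<psi> j t, tb \<psi> j t'} \<in> uedges G"
    and joined: "\<And>x y. x \<in> A2 \<Longrightarrow> y \<in> TT \<Longrightarrow> {x, y} \<in> uedges G"
begin

abbreviation "EE \<equiv> Emb Rs N EG"

definition Ou :: "'v set" where "Ou = uverts G - A1 - A2 - TT"
definition B :: "'v set" where "B = Ou - X"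

definition adj1 :: "'v \<Rightarrow> 'v \<Rightarrow> bool" where
  "adj1 x y \<longleftrightarrow> (\<exists>s<M1. \<exists>i i'. {i, i'} \<in> EG \<and> x = c1 s i \<and> y = c1 s i')"
definition adj2 :: "'v \<Rightarrow> 'v \<Rightarrow> bool" where
  "adj2 x y \<longleftrightarrow> (\<exists>s<M2. \<exists>i i'. {i, i'} \<in> EG \<and> x = c2 s i \<and> y = c2 s i')"
definition adjT :: "'v \<Rightarrow> 'v \<Rightarrow> bool" where
  "adjT x y \<longleftrightarrow> (\<exists>\<psi>\<in>EE. \<exists>j<K. \<exists>t\<in>Ts. \<exists>t'\<in>Ts. {t, t'} \<in> E \<and> x = tb \<psi> j t \<and> y = tb \<psi> j t')"
text \<open>A body is wired to all \<open>M2\<close> copies of \<open>\<Gamma>\<close> in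
  \<open>A2\<close> simultaneously, in each of them along its own \<open>\<psi>\<close>.\<close>

definition adj2T :: "'v \<Rightarrow> 'v \<Rightarrow> bool" where
  "adj2T x y \<longleftrightarrow> (\<exists>s<M2. \<exists>\<psi>\<in>EE. \<exists>j<K. \<exists>r\<in>Rs. \<exists>t\<in>Ts. {r, t} \<in> E \<and> x = c2 s (\<psi> r) \<and> y = tb \<psi> j t)"
definition adjO :: "'v \<Rightarrow> 'v \<Rightarrow> bool" where
  "adjO x y \<longleftrightarrow> {x, y} \<in> uedges G \<and> (x \<in> Ou \<and> y \<in> A1 \<or> x \<in> X \<and> y \<in> A2 \<or> x \<in> B \<and> y \<in> TT)"

definition hadj :: "'v \<Rightarrow> 'v \<Rightarrow> bool" where
  "hadj x y \<longleftrightarrow> adj1 x y \<or> adj2 x y \<or> adjT x y \<or> adj2T x y \<or> adjO x y"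

definition HE :: "'v set set" where "HE = {{x, y} | x y. hadj x y}"

lemma EG_lt: assumes "{i, i'} \<in> EG" shows "i < N" "i' < N" "i \<noteq> i'"
  using ugraph_edgeD[of "({..<N}, EG)" i i'] rich assms unfolding rich_def by auto

lemma Emb_lt: "\<psi> \<in> EE \<Longrightarrow> r \<in> Rs \<Longrightarrow> \<psi> r < N" unfolding Emb_def by auto

lemma c1A1: "s < M1 \<Longrightarrow> i < N \<Longrightarrow> c1 s i \<in> A1" unfolding A1(1) by auto
lemma c2A2: "s < M2 \<Longrightarrow> i < N \<Longrightarrow> c2 s i \<in> A2" unfolding A2(1) by auto
lemma tbTT: "\<psi> \<in> EE \<Longrightarrow> j < K \<Longrightarrow> t \<in> Ts \<Longrightarrow> tb \<psi> j t \<in> TT" unfolding TT(1) by force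

lemma c2_inj: "s < M2 \<Longrightarrow> i < N \<Longrightarrow> s' < M2 \<Longrightarrow> i' < N \<Longrightarrow> c2 s i = c2 s' i' \<Longrightarrow> s = s' \<and> i = i'"
  using inj_onD[OF A2(2), of "(s, i)" "(s', i')"] by auto
lemma tb_inj: "\<psi> \<in> EE \<Longrightarrow> j < K \<Longrightarrow> t \<in> Ts \<Longrightarrow> \<psi>' \<in> EE \<Longrightarrow> j' < K \<Longrightarrow> t' \<in> Ts \<Longrightarrow>
    tb \<psi> j t = tb \<psi>' j' t' \<Longrightarrow> \<psi> = \<psi>' \<and> j = j' \<and> t = t'"
  using inj_onD[OF TT(2), of "(\<psi>, j, t)" "(\<psi>', j', t')"] by auto

lemma confs: "Is \<union> Rs \<union> Ts = V" "Is \<inter> Rs = {}" "Is \<inter> Ts = {}" "Rs \<inter> Ts = {}"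
    "independent_set F Is" "deg Rs" "deg Ts"
  using min unfolding minimal_conf_def conf_def by auto

lemma fin: "finite Rs" "finite Ts" "finite EE"
  using confs(1) finite_V finite_Emb by (metis finite_Un)+

lemma adj_types:
  "adj1 x y \<Longrightarrow> x \<in> A1 \<and> y \<in> A1" "adj2 x y \<Longrightarrow> x \<in> A2 \<and> y \<in> A2" "adjT x y \<Longrightarrow> x \<in> TT \<and> y \<in> TT"
  "adj2T x y \<Longrightarrow> x \<in> A2 \<and> y \<in> TT"
  "adjO x y \<Longrightarrow> x \<in> Ou \<and> y \<in> A1 \<or> x \<in> X \<and> y \<in> A2 \<or> x \<in> B \<and> y \<in> TT"
  unfolding adj1_def adj2_def adjT_def adj2T_def adjO_def
  using EG_lt c1A1 c2A2 tbTT Emb_lt by blast+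

lemma hadj_types:
  assumes "hadj x y"
  shows "x \<in> A1 \<and> y \<in> A1 \<or> x \<in> A2 \<and> y \<in> A2 \<or> x \<in> TT \<and> y \<in> TT \<or> x \<in> A2 \<and> y \<in> TT \<or>
    x \<in> Ou \<and> y \<in> A1 \<or> x \<in> X \<and> y \<in> A2 \<or> x \<in> B \<and> y \<in> TT"
  using assms adj_types unfolding hadj_def by blast

lemma dOu: "x \<in> Ou \<Longrightarrow> x \<notin> A1 \<and> x \<notin> A2 \<and> x \<notin> TT" unfolding Ou_def by auto
lemma dX: "x \<in> X \<Longrightarrow> x \<in> Ou \<and> x \<notin> B" using X unfolding Ou_def B_def by auto
lemma dB: "x \<in> B \<Longrightarrow> x \<in> Ou \<and> x \<notin> X" unfolding B_def by auto
lemma dA1: "x \<in> A1 \<Longrightarrow> x \<notin> A2 \<and> x \<notin> TT \<and> x \<notin> Ou" using disj unfolding Ou_def by auto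
lemma dA2: "x \<in> A2 \<Longrightarrow> x \<notin> A1 \<and> x \<notin> TT \<and> x \<notin> Ou" using disj unfolding Ou_def by auto
lemma dTT: "x \<in> TT \<Longrightarrow> x \<notin> A1 \<and> x \<notin> A2 \<and> x \<notin> Ou" using disj unfolding Ou_def by auto

lemma HE_sym: assumes "{x, y} \<in> HE" shows "hadj x y \<or> hadj y x"
  using assms unfolding HE_def by (auto simp: doubleton_eq_iff)

lemma HE_types:
  assumes "{x, y} \<in> HE"
  shows "(x \<in> X \<longrightarrow> y \<in> A1 \<union> A2) \<and> (x \<in> B \<longrightarrow> y \<in> A1 \<union> TT) \<and> (x \<in> A1 \<longrightarrow> y \<in> X \<union> B \<union> A1)"
proof -
  have y: "y \<in> Ou \<longrightarrow> y \<in> X \<or> y \<in> B" unfolding B_def by auto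
  from HE_sym[OF assms] show ?thesis
  proof
    assume "hadj x y"
    from hadj_types[OF this] show ?thesis
      using y dOu[of x] dX[of x] dB[of x] dA1[of x] dA2[of x] dTT[of x] by blast
  next
    assume "hadj y x"
    from hadj_types[OF this] show ?thesis
      using y dOu[of x] dX[of x] dB[of x] dA1[of x] dA2[of x] dTT[of x] dX[of y] dB[of y] by blast
  qed
qed

lemma adj_sym: "adj1 x y \<Longrightarrow> adj1 y x" "adj2 x y \<Longrightarrow> adj2 y x" "adjT x y \<Longrightarrow> adjT y x"
proof -
  have EG_sym: "{i', i} \<in> EG" if "{i, i'} \<in> EG" for i i' using that by (simp add: insert_commute)
  show "adj1 x y \<Longrightarrow> adj1 y x" unfolding adj1_def using EG_sym by blast
  show "adj2 x y \<Longrightarrow> adj2 y x" unfolding adj2_def using EG_sym by blast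
  show "adjT x y \<Longrightarrow> adjT y x" unfolding adjT_def using E_sym by blast
qed

lemma HE_A1: assumes "{x, y} \<in> HE" "x \<in> A1" "y \<in> A1" shows "adj1 x y"
proof -
  have "adj1 p q" if "hadj p q" "p \<in> A1" "q \<in> A1" for p q
    using that(1) dA1[OF that(2)] dA1[OF that(3)] dX[of p] dB[of p] adj_types[of p q]
    unfolding hadj_def by blast
  then show ?thesis using HE_sym[OF assms(1)] assms(2,3) adj_sym by blast
qed

lemma HE_A2: assumes "{x, y} \<in> HE" "x \<in> A2" "y \<in> A2" shows "adj2 x y"
proof -
  have "adj2 p q" if "hadj p q" "p \<in> A2" "q \<in> A2" for p q
    using that(1) dA2[OF that(2)] dA2[OF that(3)] dX[of p] dB[of p] adj_types[of p q]
    unfolding hadj_def by blast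
  then show ?thesis using HE_sym[OF assms(1)] assms(2,3) adj_sym by blast
qed

lemma HE_TT: assumes "{x, y} \<in> HE" "x \<in> TT" "y \<in> TT" shows "adjT x y"
proof -
  have "adjT p q" if "hadj p q" "p \<in> TT" "q \<in> TT" for p q
    using that(1) dTT[OF that(2)] dTT[OF that(3)] dX[of p] dB[of p] adj_types[of p q]
    unfolding hadj_def by blast
  then show ?thesis using HE_sym[OF assms(1)] assms(2,3) adj_sym by blast
qed

lemma HE_A2_TT: assumes "{x, y} \<in> HE" "x \<in> A2" "y \<in> TT" shows "adj2T x y"
proof -
  have "\<not> hadj y x"
    using hadj_types[of y x] dA2[OF assms(2)] dTT[OF assms(3)] dX[of y] dB[of y] by blast
  then have "hadj x y" using HE_sym[OF assms(1)] by blast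
  then show ?thesis
    using dA2[OF assms(2)] dTT[OF assms(3)] dX[of x] dB[of x] adj_types[of x y]
    unfolding hadj_def by blast
qed

text \<open>The first component of \<open>dec\<close> names a copy of \<open>\<Gamma>\<close>, the
  second a position in it. A two-connected subgraph stays in one copy, so positions embed it into
  \<open>\<Gamma>\<close>; having at most \<open>card V\<close> vertices, it embeds into
  \<open>F0\<close> by \<open>rich\<close>.\<close>

lemma deg_copies:
  fixes dec :: "'a \<Rightarrow> nat \<times> nat"
  assumes S: "S \<subseteq> V" and inj: "inj_on dec S" and lt: "\<And>x. x \<in> S \<Longrightarrow> snd (dec x) < N"
    and edge: "\<And>x y. x \<in> S \<Longrightarrow> y \<in> S \<Longrightarrow> {x, y} \<in> E \<Longrightarrow>
      fst (dec x) = fst (dec y) \<and> {snd (dec x), snd (dec y)} \<in> EG"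
  shows "deg S"
  unfolding deg_def degenerate_iff_emb
proof (intro allI impI, elim conjE)
  fix J assume J: "subgraph J (induced F S)" "two_connected J"
  have JS: "uverts J \<subseteq> S" "uedges J \<subseteq> E" "ugraph J" using J(1) by (auto simp: subgraph_def)
  have con: "connected_graph J" using J(2) by (simp add: two_connected_def)
  define d where "d = (\<lambda>x. snd (dec x))"
  have "emb d J ({..<N}, EG)"
    unfolding emb_def
  proof (intro conjI ballI)
    show "inj_on d (uverts J)"
    proof (rule inj_onI)
      fix x y assume xy: "x \<in> uverts J" "y \<in> uverts J" "d x = d y"
      have "fst (dec x) = fst (dec y)"
      proof (rule connected_graph_constant[OF con _ xy(1,2)])
        fix p q assume pq: "{p, q} \<in> uedges J"
        then show "fst (dec p) = fst (dec q)"
          using edge ugraph_edgeD[OF JS(3) pq] JS by blast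
      qed
      then have "dec x = dec y" using xy(3) unfolding d_def by (simp add: prod_eq_iff)
      then show "x = y" using inj xy JS(1) by (auto dest: inj_onD)
    qed
    show "d ` uverts J \<subseteq> uverts ({..<N}, EG)" using lt JS(1) unfolding d_def by auto
    fix e assume e: "e \<in> uedges J"
    obtain p q where "e = {p, q}" "p \<in> uverts J" "q \<in> uverts J" using ugraph_edgeE[OF JS(3) e] by metis
    then show "d ` e \<in> uedges ({..<N}, EG)" using edge[of p q] e JS unfolding d_def by auto
  qed
  note d = this
  have injd: "inj_on d (uverts J)" using d by (simp add: emb_def)
  have "subgraph J J" using JS(3) by (simp add: subgraph_def)
  then have "subgraph (map_graph d J) ({..<N}, EG)" using subgraph_map_graph[OF d] by blast
  moreover have "two_connected (map_graph d J)" using two_connected_map[OF JS(3) injd J(2)] .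
  moreover have "card (uverts (map_graph d J)) \<le> card V"
  proof -
    have "card (uverts (map_graph d J)) = card (uverts J)"
      using injd by (simp add: map_graph_def card_image)
    also have "\<dots> \<le> card V" using JS(1) S finite_V by (intro card_mono) auto
    finally show ?thesis .
  qed
  moreover have "\<forall>J. subgraph J ({..<N}, EG) \<longrightarrow> two_connected J \<longrightarrow> card (uverts J) \<le> card V \<longrightarrow>
      (\<exists>f. emb f J F0)" using rich unfolding rich_def by (elim conjE)
  ultimately obtain f where "emb f (map_graph d J) F0" by blast
  then show "\<exists>f. emb f J F0" using emb_comp[OF emb_map_graph[OF injd]] by blast
qed

text \<open>The vertex classes of the host are pulled back along a hypothetical embedding and
  decoded into the data of \<open>no_layered_decomposition\<close>: \<open>\<iota>\<close> is the
  body, \<open>pT\<close> the position in it, and \<open>\<kappa>\<close> the copy of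
  \<open>\<Gamma>\<close> within \<open>A2\<close>.\<close>

lemma HE_free: "\<not> contains_copy (uverts G, HE) F"
proof
  assume "contains_copy (uverts G, HE) F"
  then obtain f where f: "emb f F (uverts G, HE)" using contains_copy_iff_emb[OF ugraph_F] by blast
  have inj: "inj_on f V" and fV: "f ` V \<subseteq> uverts G" using f unfolding emb_def by auto
  have fE: "{f x, f y} \<in> HE" if "{x, y} \<in> E" for x y
  proof -
    have "f ` {x, y} \<in> HE" using f that unfolding emb_def by (metis snd_conv)
    then show ?thesis by simp
  qed
  define pre where "pre S = {x \<in> V. f x \<in> S}" for S
  define d1 where "d1 = the_inv_into ({..<M1} \<times> {..<N}) (\<lambda>(s, i). c1 s i)"
  define d2 where "d2 = the_inv_into ({..<M2} \<times> {..<N}) (\<lambda>(s, i). c2 s i)"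
  define dT where "dT = the_inv_into (EE \<times> {..<K} \<times> Ts) (\<lambda>(\<psi>, j, t). tb \<psi> j t)"
  have d1: "d1 (c1 s i) = (s, i)" if "s < M1" "i < N" for s i
    unfolding d1_def using the_inv_into_f_f[OF A1(2), of "(s, i)"] that by simp
  have d2: "d2 (c2 s i) = (s, i)" if "s < M2" "i < N" for s i
    unfolding d2_def using the_inv_into_f_f[OF A2(2), of "(s, i)"] that by simp
  have dT: "dT (tb \<psi> j t) = (\<psi>, j, t)" if "\<psi> \<in> EE" "j < K" "t \<in> Ts" for \<psi> j t
    unfolding dT_def using the_inv_into_f_f[OF TT(2), of "(\<psi>, j, t)"] that by simp
  have E1: "\<exists>s<M1. \<exists>i<N. p = c1 s i" if "p \<in> A1" for p using that unfolding A1(1) by auto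
  have E2: "\<exists>s<M2. \<exists>i<N. p = c2 s i" if "p \<in> A2" for p using that unfolding A2(1) by auto
  have ET: "\<exists>\<psi>\<in>EE. \<exists>j<K. \<exists>t\<in>Ts. p = tb \<psi> j t" if "p \<in> TT" for p using that unfolding TT(1) by auto
  define \<iota> where "\<iota> x = (fst (dT (f x)), fst (snd (dT (f x))))" for x
  define pT where "pT x = snd (snd (dT (f x)))" for x
  define \<kappa> where "\<kappa> x = fst (d2 (f x))" for x
  \<comment> \<open>The position is relative to a body: the same vertex of \<open>A2\<close> may be
    attached to several bodies along different maps, and \<open>fst q\<close> is the map that
    belongs to the body \<open>q\<close>.\<close>
  define pR where "pR q x = the_inv_into Rs (fst q) (snd (d2 (f x)))" for q :: "('a \<Rightarrow> nat) \<times> nat" and x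
  have pR\<psi>: "the_inv_into Rs \<psi> (\<psi> r) = r" if "\<psi> \<in> EE" "r \<in> Rs" for \<psi> r
    using that the_inv_into_f_f[of \<psi> Rs r] unfolding Emb_def by auto
  have att: "\<exists>s<M2. \<exists>\<psi>\<in>EE. \<exists>j<K. \<exists>\<rho>\<in>Rs. \<exists>t'\<in>Ts. {\<rho>, t'} \<in> E \<and> f r = c2 s (\<psi> \<rho>) \<and> \<iota> t = (\<psi>, j) \<and>
      pT t = t' \<and> \<kappa> r = s \<and> pR (\<psi>, j) r = \<rho>" if rt: "{r, t} \<in> E" "r \<in> pre A2" "t \<in> pre TT" for r t
  proof -
    obtain s \<psi> j \<rho> t' where *: "s < M2" "\<psi> \<in> EE" "j < K" "\<rho> \<in> Rs" "t' \<in> Ts" "{\<rho>, t'} \<in> E"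
      "f r = c2 s (\<psi> \<rho>)" "f t = tb \<psi> j t'"
      using HE_A2_TT[OF fE[OF rt(1)]] rt(2,3) unfolding pre_def adj2T_def by blast
    have "d2 (f r) = (s, \<psi> \<rho>)" using d2 * Emb_lt by simp
    moreover have "dT (f t) = (\<psi>, j, t')" using dT * by simp
    ultimately show ?thesis using * pR\<psi>[OF *(2,4)] unfolding \<iota>_def pT_def \<kappa>_def pR_def by force
  qed
  have "deg (pre A1)"
  proof (rule deg_copies[where dec = "\<lambda>x. d1 (f x)"])
    show "pre A1 \<subseteq> V" unfolding pre_def by auto
    show "inj_on (\<lambda>x. d1 (f x)) (pre A1)"
    proof (rule inj_onI)
      fix x y assume xy: "x \<in> pre A1" "y \<in> pre A1" "d1 (f x) = d1 (f y)"
      obtain s i s' i' where *: "s < M1" "i < N" "s' < M1" "i' < N" "f x = c1 s i" "f y = c1 s' i'"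
        using E1[of "f x"] E1[of "f y"] xy unfolding pre_def by blast
      then have "f x = f y" using xy(3) d1 by simp
      then show "x = y" using inj xy unfolding pre_def by (auto dest: inj_onD)
    qed
    show "snd (d1 (f x)) < N" if "x \<in> pre A1" for x
      using E1[of "f x"] that d1 unfolding pre_def by auto
    show "fst (d1 (f x)) = fst (d1 (f y)) \<and> {snd (d1 (f x)), snd (d1 (f y))} \<in> EG"
      if xy: "x \<in> pre A1" "y \<in> pre A1" "{x, y} \<in> E" for x y
    proof -
      obtain s i i' where *: "s < M1" "{i, i'} \<in> EG" "f x = c1 s i" "f y = c1 s i'"
        using HE_A1[OF fE[OF xy(3)]] xy unfolding pre_def adj1_def by blast
      then show ?thesis using d1 EG_lt[OF *(2)] by simp
    qed
  qed
  note degA1 = this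
  have edgeA2: "fst (d2 (f x)) = fst (d2 (f y)) \<and> {snd (d2 (f x)), snd (d2 (f y))} \<in> EG"
      if xy: "x \<in> pre A2" "y \<in> pre A2" "{x, y} \<in> E" for x y
  proof -
    obtain s i i' where *: "s < M2" "{i, i'} \<in> EG" "f x = c2 s i" "f y = c2 s i'"
      using HE_A2[OF fE[OF xy(3)]] xy unfolding pre_def adj2_def by blast
    then show ?thesis using d2 EG_lt[OF *(2)] by simp
  qed
  have "deg (pre A2)"
  proof (rule deg_copies[where dec = "\<lambda>x. d2 (f x)"])
    show "pre A2 \<subseteq> V" unfolding pre_def by auto
    show "inj_on (\<lambda>x. d2 (f x)) (pre A2)"
    proof (rule inj_onI)
      fix x y assume xy: "x \<in> pre A2" "y \<in> pre A2" "d2 (f x) = d2 (f y)"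
      obtain s i s' i' where *: "s < M2" "i < N" "s' < M2" "i' < N" "f x = c2 s i" "f y = c2 s' i'"
        using E2[of "f x"] E2[of "f y"] xy unfolding pre_def by blast
      then have "f x = f y" using xy(3) d2 by simp
      then show "x = y" using inj xy unfolding pre_def by (auto dest: inj_onD)
    qed
    show "snd (d2 (f x)) < N" if "x \<in> pre A2" for x
      using E2[of "f x"] that d2 unfolding pre_def by auto
  qed (use edgeA2 in blast)
  note degA2 = this
  have inV: "f x \<in> uverts G" if "x \<in> V" for x using that fV by auto
  show False
  proof (rule no_layered_decomposition[OF min, where X = "pre X" and B = "pre B" and A = "pre A1"
        and R = "pre A2" and T = "pre TT" and \<iota> = \<iota> and \<kappa> = \<kappa> and pT = pT and pR = pR])
    show "V = pre X \<union> pre B \<union> pre A1 \<union> pre A2 \<union> pre TT"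
      using inV unfolding pre_def B_def Ou_def by blast
    show "pre X \<inter> pre B = {}" "pre X \<inter> pre A1 = {}" "pre X \<inter> pre A2 = {}" "pre X \<inter> pre TT = {}"
      "pre B \<inter> pre A1 = {}" "pre B \<inter> pre A2 = {}" "pre B \<inter> pre TT = {}" "pre A1 \<inter> pre A2 = {}"
      "pre A1 \<inter> pre TT = {}" "pre A2 \<inter> pre TT = {}"
      unfolding pre_def using dX dB dA1 dA2 dOu by blast+
    show "y \<in> pre A1 \<union> pre A2" if e: "{x, y} \<in> E" "x \<in> pre X" for x y
      using HE_types[OF fE[OF e(1)]] e(2) E_V[OF e(1)] unfolding pre_def by blast
    show "y \<in> pre A1 \<union> pre TT" if e: "{x, y} \<in> E" "x \<in> pre B" for x y
      using HE_types[OF fE[OF e(1)]] e(2) E_V[OF e(1)] unfolding pre_def by blast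
    show "y \<in> pre X \<union> pre B \<union> pre A1" if e: "{x, y} \<in> E" "x \<in> pre A1" for x y
      using HE_types[OF fE[OF e(1)]] e(2) E_V[OF e(1)] unfolding pre_def by blast
    show "deg (pre A1)" "deg (pre A2)" using degA1 degA2 .
    have TTe: "\<exists>\<psi>\<in>EE. \<exists>j<K. \<exists>t\<in>Ts. \<exists>t'\<in>Ts. {t, t'} \<in> E \<and> dT (f x) = (\<psi>, j, t) \<and> dT (f y) = (\<psi>, j, t')"
      if e: "{x, y} \<in> E" "x \<in> pre TT" "y \<in> pre TT" for x y
    proof -
      obtain \<psi> j t t' where "\<psi> \<in> EE" "j < K" "t \<in> Ts" "t' \<in> Ts" "{t, t'} \<in> E" "f x = tb \<psi> j t"
          "f y = tb \<psi> j t'"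
        using HE_TT[OF fE[OF e(1)]] e(2,3) unfolding pre_def adjT_def by blast
      then show ?thesis using dT by force
    qed
    show "\<iota> x = \<iota> y" if "{x, y} \<in> E" "x \<in> pre TT" "y \<in> pre TT" for x y
      using TTe[OF that] unfolding \<iota>_def by auto
    show "{pT x, pT y} \<in> E" if "{x, y} \<in> E" "x \<in> pre TT" "y \<in> pre TT" for x y
      using TTe[OF that] unfolding pT_def by auto
    show "x = y" if xy: "x \<in> pre TT" "y \<in> pre TT" "\<iota> x = \<iota> y" "pT x = pT y" for x y
    proof -
      have "dT (f x) = dT (f y)" using xy(3,4) unfolding \<iota>_def pT_def by (simp add: prod_eq_iff)
      moreover have "\<exists>\<psi>\<in>EE. \<exists>j<K. \<exists>t\<in>Ts. f x = tb \<psi> j t" "\<exists>\<psi>\<in>EE. \<exists>j<K. \<exists>t\<in>Ts. f y = tb \<psi> j t"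
        using ET xy(1,2) unfolding pre_def by blast+
      ultimately have "f x = f y" using dT by auto
      then show ?thesis using inj xy(1,2) unfolding pre_def by (auto dest: inj_onD)
    qed
    show "pT x \<in> Ts" if x: "x \<in> pre TT" for x
      using ET[of "f x"] x dT unfolding pre_def pT_def by auto
    show "pR (\<iota> t) r \<in> Rs \<and> {pR (\<iota> t) r, pT t} \<in> E" if "{r, t} \<in> E" "r \<in> pre A2" "t \<in> pre TT" for r t
      using att[OF that] by auto
    show "\<kappa> x = \<kappa> y" if "{x, y} \<in> E" "x \<in> pre A2" "y \<in> pre A2" for x y
      using edgeA2[OF that(2,3,1)] unfolding \<kappa>_def by simp
    show "r = r'" if h: "{r, t} \<in> E" "{r', t'} \<in> E" "r \<in> pre A2" "r' \<in> pre A2" "t \<in> pre TT" "t' \<in> pre TT"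
      "\<iota> t = \<iota> t'" "\<kappa> r = \<kappa> r'" "pR (\<iota> t) r = pR (\<iota> t) r'" for r r' t t'
    proof -
      have "f r = f r'" using att[OF h(1,3,5)] att[OF h(2,4,6)] h(7-9) by auto
      then show ?thesis using inj h(3,4) unfolding pre_def by (auto dest: inj_onD)
    qed
    show "{pR (\<iota> t) r, pR (\<iota> t) r'} \<in> E" if h: "{r, t} \<in> E" "{r', t'} \<in> E" "r \<in> pre A2" "r' \<in> pre A2"
      "t \<in> pre TT" "t' \<in> pre TT" "\<iota> t = \<iota> t'" "{r, r'} \<in> E" for r r' t t'
    proof -
      obtain s \<psi> j \<rho> where 1: "s < M2" "\<psi> \<in> EE" "\<rho> \<in> Rs" "f r = c2 s (\<psi> \<rho>)" "\<iota> t = (\<psi>, j)" "pR (\<psi>, j) r = \<rho>"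
        using att[OF h(1,3,5)] by blast
      obtain s' \<rho>' where 2: "s' < M2" "\<rho>' \<in> Rs" "f r' = c2 s' (\<psi> \<rho>')" "pR (\<psi>, j) r' = \<rho>'"
        using att[OF h(2,4,6)] h(7) 1(5) by auto
      have "{\<psi> \<rho>, \<psi> \<rho>'} \<in> EG"
        using edgeA2[OF h(3,4,8)] d2[OF 1(1) Emb_lt[OF 1(2,3)]] d2[OF 2(1) Emb_lt[OF 1(2) 2(2)]] 1 2 by simp
      \<comment> \<open>Here the copies of \<open>Rs\<close> have to be induced.\<close>
      then have "{\<rho>, \<rho>'} \<in> E" using 1(2,3) 2(2) unfolding Emb_def by blast
      then show ?thesis using 1 2 by simp
    qed
  qed
qed

lemma HE_G: "HE \<subseteq> uedges G"
proof
  fix e assume "e \<in> HE"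
  then obtain x y where e: "e = {x, y}" "hadj x y" unfolding HE_def by auto
  have "adj1 x y \<Longrightarrow> {x, y} \<in> uedges G" "adj2 x y \<Longrightarrow> {x, y} \<in> uedges G"
    unfolding adj1_def adj2_def using clique1 clique2 EG_lt by blast+
  moreover have "adjT x y \<Longrightarrow> {x, y} \<in> uedges G" unfolding adjT_def using cliqueT E_V by blast
  moreover have "adj2T x y \<Longrightarrow> {x, y} \<in> uedges G" using adj_types(4) joined by blast
  moreover have "adjO x y \<Longrightarrow> {x, y} \<in> uedges G" unfolding adjO_def by blast
  ultimately have "{x, y} \<in> uedges G" using e(2) unfolding hadj_def by blast
  then show "e \<in> uedges G" using e by simp
qed

end

subsection \<open>Counting the edges of a saturated extension\<close>

lemma saturated_extension:
  assumes G: "ugraph G" and E0: "E0 \<subseteq> uedges G" "\<not> contains_copy (uverts G, E0) F"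
  obtains E' where "E0 \<subseteq> E'" "E' \<subseteq> uedges G" "\<not> contains_copy (uverts G, E') F"
    "saturated F G (uverts G, E')"
proof -
  let ?S = "{E. E0 \<subseteq> E \<and> E \<subseteq> uedges G \<and> \<not> contains_copy (uverts G, E) F}"
  have fin: "finite ?S"
    using finite_uedges[OF G] by (auto intro: finite_subset[where B = "Pow (uedges G)"])
  have "E0 \<in> ?S" using E0 by auto
  then obtain E' where E': "E' \<in> ?S" and max: "\<And>E. E \<in> ?S \<Longrightarrow> E' \<subseteq> E \<Longrightarrow> E = E'"
    using finite_has_maximal2[OF fin] by (metis (no_types, lifting))
  have "saturated F G (uverts G, E')"
    unfolding saturated_def
  proof (intro conjI ballI)
    show "subgraph (uverts G, E') G" using E' G by (auto simp: subgraph_def ugraph_def)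
    show "\<not> contains_copy (uverts G, E') F" using E' by simp
    fix e assume e: "e \<in> uedges G - uedges (uverts G, E')"
    then have "add_edge (uverts G, E') e = (uverts G, insert e E')"
      using G by (auto simp: add_edge_def ugraph_def all_edges_def)
    moreover have "insert e E' \<notin> ?S" using e max[of "insert e E'"] by auto
    ultimately show "contains_copy (add_edge (uverts G, E') e) F" using e E' by auto
  qed
  then show ?thesis using that E' by blast
qed

lemma sat_le: "saturated F G H \<Longrightarrow> sat G F \<le> card (uedges H)"
  unfolding sat_def by (rule Least_le) blast

text \<open>Averaging over the \<open>M\<close> copies: density \<open>\<delta>\<close> in their
  union gives density \<open>\<delta>\<close> inside one copy, which is what \<open>rich\<close> can
  exploit.\<close>

lemma dense_block:
  fixes c :: "nat \<Rightarrow> nat \<Rightarrow> 'v" and \<delta> :: real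
  assumes inj: "inj_on (\<lambda>(s, i). c s i) ({..<M} \<times> {..<N})"
    and S: "S \<subseteq> (\<lambda>(s, i). c s i) ` ({..<M} \<times> {..<N})" "\<delta> * (real M * real N) \<le> card S" and M: "0 < M"
  obtains s where "s < M" "\<delta> * N \<le> card {i. i < N \<and> c s i \<in> S}"
proof -
  have "S = (\<Union>s<M. c s ` {i. i < N \<and> c s i \<in> S})"
  proof (intro equalityI subsetI)
    fix x assume x: "x \<in> S"
    then obtain s i where "s < M" "i < N" "x = c s i" using S(1) by auto
    then show "x \<in> (\<Union>s<M. c s ` {i. i < N \<and> c s i \<in> S})" using x by auto
  qed auto
  then have "card S \<le> (\<Sum>s<M. card (c s ` {i. i < N \<and> c s i \<in> S}))"
    using card_UN_le[of "{..<M}" "\<lambda>s. c s ` {i. i < N \<and> c s i \<in> S}"] by simp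
  also have "\<dots> \<le> (\<Sum>s<M. card {i. i < N \<and> c s i \<in> S})"
    by (intro sum_mono card_image_le) auto
  finally have le: "card S \<le> (\<Sum>s<M. card {i. i < N \<and> c s i \<in> S})" .
  have "\<exists>s<M. \<delta> * N \<le> card {i. i < N \<and> c s i \<in> S}"
  proof (rule ccontr)
    assume "\<not> ?thesis"
    then have lt: "real (card {i. i < N \<and> c s i \<in> S}) < \<delta> * N" if "s < M" for s
      using that by (auto simp: not_le)
    have "real (card S) \<le> (\<Sum>s<M. real (card {i. i < N \<and> c s i \<in> S}))"
      using of_nat_mono[OF le, where ?'a = real] by simp
    also have "\<dots> < (\<Sum>s<M. \<delta> * N)" using lt M by (intro sum_strict_mono) auto
    finally show False using S(2) by (simp add: algebra_simps)
  qed
  then show ?thesis using that by blast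
qed

section \<open>Edges that an extension without a copy of the forbidden graph can have\<close>

context host
begin

text \<open>For every \<open>\<psi>\<close> at least one of its \<open>K\<close> bodies is
  completely adjacent to \<open>y\<close>. The quantifier over \<open>\<psi>\<close> is there
  because the relevant map depends on the extension, which is chosen later.\<close>

definition good :: "'v \<Rightarrow> bool" where
  "good y \<longleftrightarrow> (\<forall>\<psi>\<in>EE. \<exists>j<K. \<forall>t\<in>Ts. {y, tb \<psi> j t} \<in> uedges G)"

definition codeg :: "'v set \<Rightarrow> 'v \<Rightarrow> 'v \<Rightarrow> nat" where
  "codeg A x y = card {z \<in> A. {x, z} \<in> uedges G \<and> {y, z} \<in> uedges G}"

context
  fixes E' :: "'v set set"
  assumes HE_E': "HE \<subseteq> E'" and E'_G: "E' \<subseteq> uedges G" and free: "\<not> contains_copy (uverts G, E') F"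
begin

lemma no_emb: "\<not> emb f F (uverts G, E')"
  using free contains_copy_iff_emb[OF ugraph_F] by blast

lemma E'_sym: "{x, y} \<in> E' \<Longrightarrow> {y, x} \<in> E'" by (simp add: insert_commute)

lemma hadj_E': "hadj x y \<Longrightarrow> {x, y} \<in> E'" using HE_E' unfolding HE_def by blast

text \<open>Many common neighbours contain \<open>F0\<close> within one copy of
  \<open>\<Gamma>\<close>, and an edge between \<open>x\<close> and \<open>y\<close> would complete
  it, with \<open>x\<close> and \<open>y\<close> in the roles of \<open>u\<close> and
  \<open>v\<close>. The set \<open>A\<close> is kept abstract to serve both \<open>A1\<close> and
  \<open>A2\<close>.\<close>

lemma codeg_small:
  fixes c :: "nat \<Rightarrow> nat \<Rightarrow> 'v"
  assumes A: "A = (\<lambda>(s, i). c s i) ` ({..<M} \<times> {..<N})" "inj_on (\<lambda>(s, i). c s i) ({..<M} \<times> {..<N})"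
    "A \<subseteq> uverts G" and M: "0 < M"
    and edges: "\<And>s i i'. s < M \<Longrightarrow> {i, i'} \<in> EG \<Longrightarrow> {c s i, c s i'} \<in> E'"
    and xy: "x \<in> uverts G - A" "y \<in> uverts G - A" "{x, y} \<in> E'"
    and to: "\<And>z. z \<in> A \<Longrightarrow> {x, z} \<in> uedges G \<Longrightarrow> {x, z} \<in> E'"
      "\<And>z. z \<in> A \<Longrightarrow> {y, z} \<in> uedges G \<Longrightarrow> {y, z} \<in> E'"
  shows "codeg A x y < \<delta> * (real M * real N)"
proof (rule ccontr)
  assume big: "\<not> codeg A x y < \<delta> * (real M * real N)"
  define S where "S = {z \<in> A. {x, z} \<in> uedges G \<and> {y, z} \<in> uedges G}"
  have "\<delta> * (real M * real N) \<le> card S" using big unfolding S_def codeg_def by simp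
  moreover have "S \<subseteq> (\<lambda>(s, i). c s i) ` ({..<M} \<times> {..<N})"
    unfolding S_def A(1)[symmetric] by auto
  ultimately obtain s where s: "s < M" "\<delta> * N \<le> card {i. i < N \<and> c s i \<in> S}"
    using dense_block[OF A(2) _ _ M, of S \<delta>] by blast
  have "{i. i < N \<and> c s i \<in> S} \<subseteq> {..<N}" by auto
  then obtain \<phi> where \<phi>: "inj_on \<phi> (V - {u, v})" "\<phi> ` (V - {u, v}) \<subseteq> {i. i < N \<and> c s i \<in> S}"
     "\<forall>x\<in>V - {u, v}. \<forall>y\<in>V - {u, v}. {x, y} \<in> E \<longrightarrow> {\<phi> x, \<phi> y} \<in> EG"
    using rich s(2) unfolding rich_def by meson
  define f where "f w = (if w = u then x else if w = v then y else c s (\<phi> w))" for w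
  have uV: "u \<in> V" "v \<in> V" "u \<noteq> v" using E_V[OF uv] by auto
  have xney: "x \<noteq> y" using ugraph_edgeD[OF G] xy(3) E'_G by blast
  have \<phi>S: "\<phi> w < N" "c s (\<phi> w) \<in> S" if "w \<in> V - {u, v}" for w using \<phi>(2) that by auto
  have SA: "z \<in> A" "{x, z} \<in> E'" "{y, z} \<in> E'" if "z \<in> S" for z
    using that to unfolding S_def by auto
  have "emb f F (uverts G, E')"
    unfolding emb_def fst_conv snd_conv
  proof (intro conjI ballI)
    show "inj_on f V"
    proof (rule inj_onI)
      fix p q assume pq: "p \<in> V" "q \<in> V" "f p = f q"
      have "p = q" if "p \<in> V - {u, v}" "q \<in> V - {u, v}"
      proof -
        have "c s (\<phi> p) = c s (\<phi> q)" using pq(3) that unfolding f_def by auto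
        then have "\<phi> p = \<phi> q"
          using inj_onD[OF A(2), of "(s, \<phi> p)" "(s, \<phi> q)"] s(1) \<phi>S that by auto
        then show ?thesis using \<phi>(1) that by (auto dest: inj_onD)
      qed
      moreover have "c s (\<phi> w) \<noteq> x" "c s (\<phi> w) \<noteq> y" if "w \<in> V - {u, v}" for w
        using SA(1)[OF \<phi>S(2)[OF that]] xy by auto
      ultimately show "p = q" using pq xney unfolding f_def
        by (metis Diff_iff empty_iff insert_iff)
    qed
    show "f ` V \<subseteq> uverts G"
    proof
      fix z assume "z \<in> f ` V"
      then obtain w where w: "w \<in> V" "z = f w" by auto
      show "z \<in> uverts G"
      proof (cases "w \<in> {u, v}")
        case True
        then show ?thesis using w xy unfolding f_def by auto
      next
        case False
        then have "z = c s (\<phi> w)" "w \<in> V - {u, v}" using w unfolding f_def by auto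
        then show ?thesis using SA(1)[OF \<phi>S(2)] A(3) by blast
      qed
    qed
    fix e assume e: "e \<in> E"
    obtain p q where pq: "e = {p, q}" "p \<in> V" "q \<in> V" "p \<noteq> q" using ugraph_edgeE[OF ugraph_F e] by metis
    have to_xy: "{f r, f w} \<in> E'" if "r \<in> {u, v}" "w \<in> V - {u, v}" for r w
    proof -
      have "f w = c s (\<phi> w)" "f r = x \<or> f r = y" using that unfolding f_def by auto
      then show ?thesis using SA(2,3)[OF \<phi>S(2)[OF that(2)]] by auto
    qed
    have "{f p, f q} \<in> E'"
    proof (cases "p \<in> {u, v}")
      case True
      show ?thesis
      proof (cases "q \<in> {u, v}")
        case True
        then have "{f p, f q} = {x, y}" using \<open>p \<in> {u, v}\<close> pq(4) uV unfolding f_def by auto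
        then show ?thesis using xy(3) by simp
      qed (use True to_xy pq in auto)
    next
      case False
      show ?thesis
      proof (cases "q \<in> {u, v}")
        case True
        then show ?thesis using to_xy[of q p] False pq E'_sym by auto
      next
        case q: False
        have "{\<phi> p, \<phi> q} \<in> EG" using \<phi>(3) False q pq e by auto
        then show ?thesis using edges[OF s(1)] False q unfolding f_def by auto
      qed
    qed
    then show "f ` e \<in> E'" using pq by simp
  qed
  then show False using no_emb by blast
qed

lemma codeg_A1_small:
  assumes "x \<in> Ou" "y \<in> Ou" "{x, y} \<in> E'" "0 < M1"
  shows "codeg A1 x y < \<delta> * (real M1 * real N)"
proof (rule codeg_small[OF A1 sub(1) assms(4)])
  show "{c1 s i, c1 s i'} \<in> E'" if "s < M1" "{i, i'} \<in> EG" for s i i'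
    using hadj_E' that unfolding hadj_def adj1_def by blast
  have *: "{w, z} \<in> E'" if "w \<in> Ou" "z \<in> A1" "{w, z} \<in> uedges G" for w z
    using hadj_E' that unfolding hadj_def adjO_def by blast
  show "{x, z} \<in> E'" if "z \<in> A1" "{x, z} \<in> uedges G" for z using * assms that by blast
  show "{y, z} \<in> E'" if "z \<in> A1" "{y, z} \<in> uedges G" for z using * assms that by blast
qed (use assms in \<open>auto simp: Ou_def\<close>)

lemma codeg_A2_small:
  assumes "x \<in> X" "y \<in> X" "{x, y} \<in> E'" "0 < M2"
  shows "codeg A2 x y < \<delta> * (real M2 * real N)"
proof (rule codeg_small[OF A2 sub(2) assms(4)])
  show "{c2 s i, c2 s i'} \<in> E'" if "s < M2" "{i, i'} \<in> EG" for s i i'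
    using hadj_E' that unfolding hadj_def adj2_def by blast
  have *: "{w, z} \<in> E'" if "w \<in> X" "z \<in> A2" "{w, z} \<in> uedges G" for w z
    using hadj_E' that unfolding hadj_def adjO_def by blast
  show "{x, z} \<in> E'" if "z \<in> A2" "{x, z} \<in> uedges G" for z using * assms that by blast
  show "{y, z} \<in> E'" if "z \<in> A2" "{y, z} \<in> uedges G" for z using * assms that by blast
qed (use assms X in auto)

definition nbA2 :: "'v \<Rightarrow> 'v set" where "nbA2 y = {z \<in> A2. {y, z} \<in> E'}"

definition heavy :: "'v set" where
  "heavy = {y \<in> B. good y \<and> \<delta> * (real M2 * real N) \<le> card (nbA2 y)}"

lemma finite_vertices: "finite (uverts G)" using G by (simp add: ugraph_def)

lemma B_G: "B \<subseteq> uverts G" unfolding B_def Ou_def by auto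

text \<open>If too many vertices shared the same tuple of \<open>A2\<close> and the same body, they could serve as the
  independent part of a copy of the forbidden graph.\<close>

lemma card_heavy:
  assumes M2: "0 < M2"
  shows "card heavy \<le> M2 * card EE * K * card V"
proof -
  have finh: "finite heavy" unfolding heavy_def using finite_vertices B_G by (auto intro: finite_subset)
  define Q where "Q y s \<psi> j \<longleftrightarrow> s < M2 \<and> \<psi> \<in> EE \<and> j < K \<and> (\<forall>r\<in>Rs. c2 s (\<psi> r) \<in> nbA2 y) \<and>
    (\<forall>t\<in>Ts. {y, tb \<psi> j t} \<in> uedges G)" for y s \<psi> j
  have "\<exists>s \<psi> j. Q y s \<psi> j" if y: "y \<in> heavy" for y
  proof -
    have "nbA2 y \<subseteq> (\<lambda>(s, i). c2 s i) ` ({..<M2} \<times> {..<N})"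
      unfolding nbA2_def A2(1)[symmetric] by auto
    moreover have "\<delta> * (real M2 * real N) \<le> card (nbA2 y)" using y unfolding heavy_def by blast
    ultimately obtain s where s: "s < M2" "\<delta> * N \<le> card {i. i < N \<and> c2 s i \<in> nbA2 y}"
      using dense_block[OF A2(2) _ _ M2, of "nbA2 y" \<delta>] by blast
    have "{i. i < N \<and> c2 s i \<in> nbA2 y} \<subseteq> {..<N}" by auto
    then obtain \<psi> where \<psi>: "\<psi> \<in> EE" "\<psi> ` Rs \<subseteq> {i. i < N \<and> c2 s i \<in> nbA2 y}"
      using rich s(2) unfolding rich_def by meson
    obtain j where "j < K" "\<forall>t\<in>Ts. {y, tb \<psi> j t} \<in> uedges G"
      using y \<psi>(1) unfolding heavy_def good_def by blast
    then show ?thesis unfolding Q_def using s \<psi> by blast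
  qed
  then obtain sf \<psi>f jf where Q: "\<And>y. y \<in> heavy \<Longrightarrow> Q y (sf y) (\<psi>f y) (jf y)" by metis
  \<comment> \<open>Heavy vertices are sorted by the copy, the map and the body that they see. There
    are \<open>M2 * card EE * K\<close> such triples, and \<open>card V\<close> bounds the size of
    \<open>Is\<close>.\<close>
  define fib where "fib q = {y \<in> heavy. (sf y, \<psi>f y, jf y) = q}" for q
  let ?I = "{..<M2} \<times> EE \<times> {..<K}"
  have "heavy = (\<Union>q\<in>?I. fib q)" unfolding fib_def using Q unfolding Q_def by blast
  then have "card heavy \<le> (\<Sum>q\<in>?I. card (fib q))"
    using card_UN_le[of ?I fib] fin by simp
  also have "\<dots> \<le> (\<Sum>q\<in>?I. card V)"
  proof (rule sum_mono)
    fix q assume "q \<in> ?I"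
    obtain s \<psi> j where q: "q = (s, \<psi>, j)" by (cases q)
    have Qf: "Q y s \<psi> j" "y \<in> B" if "y \<in> fib q" for y
      using Q[of y] that unfolding fib_def q heavy_def by auto
    show "card (fib q) \<le> card V"
    proof (rule ccontr)
      assume big: "\<not> card (fib q) \<le> card V"
      have "card Is \<le> card V" using confs(1) finite_V by (intro card_mono) auto
      then have "card Is \<le> card (fib q)" using big by simp
      moreover have "finite (fib q)" unfolding fib_def using finh by simp
      moreover have finIs: "finite Is" using confs(1) finite_V by (metis finite_Un)
      ultimately obtain g where g: "g ` Is \<subseteq> fib q" "inj_on g Is"
        using card_le_inj[of Is "fib q"] by blast
      have "fib q \<noteq> {}" using big by auto
      then obtain y0 where y0: "y0 \<in> fib q" by blast
      have s: "s < M2" "\<psi> \<in> EE" "j < K" using Qf[OF y0] unfolding Q_def by auto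
      \<comment> \<open>The fibre supplies \<open>Is\<close>, the copy \<open>s\<close> supplies
        \<open>Rs\<close> and the body supplies \<open>Ts\<close>. All edges come from the host
        except those between \<open>Is\<close> and \<open>Rs\<close>, which are edges of the
        extension by the choice of \<open>\<psi>\<close>.\<close>
      define f where "f w = (if w \<in> Is then g w else if w \<in> Rs then c2 s (\<psi> w) else tb \<psi> j w)" for w
      have fI: "f w = g w" if "w \<in> Is" for w using that unfolding f_def by simp
      have fR: "f w = c2 s (\<psi> w)" if "w \<in> Rs" for w using that confs(2) unfolding f_def by auto
      have fT: "f w = tb \<psi> j w" if "w \<in> Ts" for w using that confs(3,4) unfolding f_def by auto
      have gB: "g w \<in> B" "Q (g w) s \<psi> j" if "w \<in> Is" for w using Qf g that by blast+
      have cls: "w \<in> Is \<or> w \<in> Rs \<or> w \<in> Ts" if "w \<in> V" for w using that confs(1) by blast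
      have RA2: "c2 s (\<psi> w) \<in> A2" if "w \<in> Rs" for w using c2A2 s Emb_lt that by blast
      have TTT: "tb \<psi> j w \<in> TT" if "w \<in> Ts" for w using tbTT s that by blast
      have "emb f F (uverts G, E')"
        unfolding emb_def fst_conv snd_conv
      proof (intro conjI ballI)
        have injR: "inj_on \<psi> Rs" using s(2) unfolding Emb_def by auto
        show "inj_on f V"
        proof (rule inj_onI)
          fix p q assume pq: "p \<in> V" "q \<in> V" "f p = f q"
          have ft: "(w \<in> Is \<longrightarrow> f w \<in> B) \<and> (w \<in> Rs \<longrightarrow> f w \<in> A2) \<and> (w \<in> Ts \<longrightarrow> f w \<in> TT)" for w
            using fI fR fT gB(1) RA2 TTT by auto
          have dB': "z \<notin> A2 \<and> z \<notin> TT" if "z \<in> B" for z using dB[OF that] dOu by blast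
          have "p \<in> Is \<and> q \<in> Is \<or> p \<in> Rs \<and> q \<in> Rs \<or> p \<in> Ts \<and> q \<in> Ts"
            using cls[OF pq(1)] cls[OF pq(2)] ft[of p] ft[of q] pq(3) dB'[of "f p"] dA2[of "f p"]
            by metis
          then show "p = q"
          proof (elim disjE conjE)
            assume "p \<in> Is" "q \<in> Is"
            then show ?thesis using pq(3) fI g(2) by (auto dest: inj_onD)
          next
            assume pR: "p \<in> Rs" "q \<in> Rs"
            then have "\<psi> p = \<psi> q" using pq(3) fR c2_inj[OF s(1) Emb_lt[OF s(2)] s(1) Emb_lt[OF s(2)]]
                by auto
            then show ?thesis using injR pR by (auto dest: inj_onD)
          next
            assume pT: "p \<in> Ts" "q \<in> Ts"
            then show ?thesis using pq(3) fT tb_inj[OF s(2,3) _ s(2,3)] by auto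
          qed
        qed
        show "f ` V \<subseteq> uverts G"
        proof
          fix z assume "z \<in> f ` V"
          then obtain w where w: "w \<in> V" "z = f w" by auto
          show "z \<in> uverts G"
            using cls[OF w(1)] w(2) fI fR fT gB(1) RA2 TTT sub B_G by (metis subsetD)
        qed
        have RR: "{f p, f q} \<in> E'" if "p \<in> Rs" "q \<in> Rs" "{p, q} \<in> E" for p q
        proof -
          have "{\<psi> p, \<psi> q} \<in> EG" using that s(2) unfolding Emb_def by blast
          then have "adj2 (f p) (f q)" unfolding adj2_def using s that fR by blast
          then show ?thesis using hadj_E' unfolding hadj_def by blast
        qed
        have T: "{f p, f q} \<in> E'" if "p \<in> Ts" "q \<in> Ts" "{p, q} \<in> E" for p q
        proof -
          have "adjT (f p) (f q)" unfolding adjT_def using s that fT by blast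
          then show ?thesis using hadj_E' unfolding hadj_def by blast
        qed
        have RT: "{f p, f q} \<in> E'" if "p \<in> Rs" "q \<in> Ts" "{p, q} \<in> E" for p q
        proof -
          have "adj2T (f p) (f q)" unfolding adj2T_def using s that fR fT by blast
          then show ?thesis using hadj_E' unfolding hadj_def by blast
        qed
        have IR: "{f p, f q} \<in> E'" if "p \<in> Is" "q \<in> Rs" for p q
          using gB(2)[OF that(1)] that fI fR unfolding Q_def nbA2_def by auto
        have IT: "{f p, f q} \<in> E'" if "p \<in> Is" "q \<in> Ts" for p q
        proof -
          have "adjO (f p) (f q)"
            using gB[OF that(1)] that fI fT TTT unfolding Q_def adjO_def by auto
          then show ?thesis using hadj_E' unfolding hadj_def by blast
        qed
        fix e assume e: "e \<in> E"
        obtain p q where pq: "e = {p, q}" "p \<in> V" "q \<in> V" using ugraph_edgeE[OF ugraph_F e] by metis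
        have e1: "{p, q} \<in> E" "{q, p} \<in> E" using e pq E_sym by auto
        have nI: "\<not> (p \<in> Is \<and> q \<in> Is)" using indepD[OF confs(5)] e1 by blast
        have "{f p, f q} \<in> E' \<or> {f q, f p} \<in> E'"
          using cls[OF pq(2)] cls[OF pq(3)] nI RR[OF _ _ e1(1)] T[OF _ _ e1(1)] RT[OF _ _ e1(1)]
            RT[OF _ _ e1(2)] IR[of p q] IR[of q p] IT[of p q] IT[of q p] by blast
        then show "f ` e \<in> E'" using pq E'_sym by auto
      qed
      then show False using no_emb by blast
    qed
  qed
  also have "\<dots> = M2 * card EE * K * card V" by (simp add: card_cartesian_product)
  finally show ?thesis .
qed

end

text \<open>Every edge of the extension either meets \<open>A1\<close> or is charged to an ordered
  pair from one of eight sets. Edges between \<open>A2\<close> and \<open>B\<close> are split by the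
  end in \<open>B\<close>: not good, good and heavy, or good with few neighbours in
  \<open>A2\<close>. Pairs of outer vertices are adjacent only if their common degree is
  small.\<close>

theorem sat_bound:
  assumes M: "0 < M1" "0 < M2"
  shows "real (sat G F) \<le> real (card {e \<in> uedges G. e \<inter> A1 \<noteq> {}})
    + real (card TT) * card (uverts G) + real (card A2) * card A2 + real (card A2) * card X
    + real (card A2) * card {y \<in> B. \<not> good y} + real (card A2) * (M2 * card EE * K * card V)
    + card (uverts G) * (\<delta> * (real M2 * real N))
    + card {(x, y). x \<in> B \<and> y \<in> Ou \<and> x \<noteq> y \<and> codeg A1 x y < \<delta> * (real M1 * real N)}
    + card {(x, y). x \<in> X \<and> y \<in> X \<and> x \<noteq> y \<and> codeg A2 x y < \<delta> * (real M2 * real N)}"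
proof -
  obtain E' where E': "HE \<subseteq> E'" "E' \<subseteq> uedges G" "\<not> contains_copy (uverts G, E') F"
    "saturated F G (uverts G, E')"
    using saturated_extension[OF G HE_G HE_free] by blast
  note small1 = codeg_A1_small[OF E'(1-3) _ _ _ M(1)]
  note small2 = codeg_A2_small[OF E'(1-3) _ _ _ M(2)]
  define nbA where "nbA y = {z \<in> A2. {y, z} \<in> E'}" for y
  define hv where "hv = {y \<in> B. good y \<and> \<delta> * (real M2 * real N) \<le> card (nbA y)}"
  have card_hv: "card hv \<le> M2 * card EE * K * card V"
    using card_heavy[OF E'(1-3) M(2)] unfolding heavy_def[OF E'(1-3)] nbA2_def[OF E'(1-3)] hv_def nbA_def .
  have finG: "finite (uverts G)" using G by (simp add: ugraph_def)
  have BG: "B \<subseteq> uverts G" unfolding B_def Ou_def by auto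
  have finA: "finite A2" "finite TT" "finite X" "finite B" "finite Ou"
    using finG sub X BG unfolding Ou_def by (auto intro: finite_subset)
  define light where "light = {y \<in> B. good y \<and> card (nbA y) < \<delta> * (real M2 * real N)}"
  define P1 where "P1 = {(x, y). x \<in> B \<and> y \<in> Ou \<and> x \<noteq> y \<and> codeg A1 x y < \<delta> * (real M1 * real N)}"
  define P2 where "P2 = {(x, y). x \<in> X \<and> y \<in> X \<and> x \<noteq> y \<and> codeg A2 x y < \<delta> * (real M2 * real N)}"
  define pr where "pr = (\<lambda>(x::'v, y). {x, y})"
  define U0 where "U0 = {e \<in> uedges G. e \<inter> A1 \<noteq> {}}"
  \<comment> \<open>The order matches the summands of the bound after the edges meeting
    \<open>A1\<close>. The extension has no control over edges at \<open>TT\<close>, so these are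
    charged with all vertices of the graph.\<close>
  let ?L = "[TT \<times> uverts G, A2 \<times> A2, A2 \<times> X, A2 \<times> {y \<in> B. \<not> good y}, A2 \<times> hv, Sigma light nbA, P1, P2]"
  have finP: "finite P1" "finite P2"
    using finA unfolding P1_def P2_def
    by (auto intro: finite_subset[of _ "B \<times> Ou"] finite_subset[of _ "X \<times> X"])
  have fin_nbA: "finite (nbA y)" for y unfolding nbA_def using finA by simp
  have finl: "finite light" "finite hv" unfolding light_def hv_def using finA by auto
  have cover: "E' \<subseteq> U0 \<union> pr ` (\<Union>(set ?L))"
  proof
    fix e assume e: "e \<in> E'"
    obtain p q where pq: "e = {p, q}" "p \<in> uverts G" "q \<in> uverts G" "p \<noteq> q"
      using ugraph_edgeE[OF G] e E'(2) by (metis subsetD)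
    have prI: "e \<in> pr ` (\<Union>(set ?L))" if "(x, y) \<in> \<Union>(set ?L)" "{x, y} = e" for x y
      by (rule rev_image_eqI[OF that(1)]) (simp add: that(2) pr_def)
    have main: "e \<in> pr ` (\<Union>(set ?L))"
      if h: "e = {x, y}" "x \<noteq> y" "x \<in> A2 \<union> TT \<union> Ou" "y \<in> A2 \<union> TT \<union> Ou" "x \<in> uverts G" "y \<in> uverts G"
        "x \<in> TT \<or> x \<in> A2 \<and> y \<notin> TT \<or> x \<in> B \<and> y \<in> Ou \<or> x \<in> X \<and> y \<in> X" for x y
      using h(7)
    proof (elim disjE conjE)
      assume "x \<in> TT"
      then show ?thesis using prI[of x y] h by auto
    next
      assume x: "x \<in> A2" "y \<notin> TT"
      show ?thesis
      proof (cases "y \<in> A2 \<or> y \<in> X \<or> y \<in> hv \<or> (y \<in> B \<and> \<not> good y)")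
        case True
        then show ?thesis using prI[of x y] h x by auto
      next
        case False
        then have "y \<in> light" using h(4) x(2) unfolding light_def hv_def B_def by auto
        moreover have "x \<in> nbA y" using x e h(1) unfolding nbA_def by (simp add: insert_commute)
        ultimately show ?thesis using prI[of y x] h(1) by (auto simp: insert_commute)
      qed
    next
      assume x: "x \<in> B" "y \<in> Ou"
      then have "(x, y) \<in> P1" using small1[of x y] e h(1,2) dB unfolding P1_def by auto
      then show ?thesis using prI[of x y] h(1) by auto
    next
      assume x: "x \<in> X" "y \<in> X"
      then have "(x, y) \<in> P2" using small2[of x y] e h(1,2) unfolding P2_def by auto
      then show ?thesis using prI[of x y] h(1) by auto
    qed
    show "e \<in> U0 \<union> pr ` (\<Union>(set ?L))"
    proof (cases "p \<in> A1 \<or> q \<in> A1")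
      case True
      then show ?thesis using e E'(2) pq(1) unfolding U0_def by auto
    next
      case False
      then have t: "p \<in> A2 \<union> TT \<union> Ou" "q \<in> A2 \<union> TT \<union> Ou" using pq unfolding Ou_def by auto
      have OX: "z \<in> Ou \<Longrightarrow> z \<in> B \<or> z \<in> X" for z unfolding B_def by auto
      have "(p \<in> TT \<or> p \<in> A2 \<and> q \<notin> TT \<or> p \<in> B \<and> q \<in> Ou \<or> p \<in> X \<and> q \<in> X) \<or>
        (q \<in> TT \<or> q \<in> A2 \<and> p \<notin> TT \<or> q \<in> B \<and> p \<in> Ou \<or> q \<in> X \<and> p \<in> X)"
        using t OX[of p] OX[of q] by blast
      then show ?thesis
      proof (rule disjE)
        assume h: "p \<in> TT \<or> p \<in> A2 \<and> q \<notin> TT \<or> p \<in> B \<and> q \<in> Ou \<or> p \<in> X \<and> q \<in> X"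
        show ?thesis by (rule UnI2, rule main[OF pq(1) pq(4) t pq(2,3) h])
      next
        assume h: "q \<in> TT \<or> q \<in> A2 \<and> p \<notin> TT \<or> q \<in> B \<and> p \<in> Ou \<or> q \<in> X \<and> p \<in> X"
        have "e = {q, p}" using pq(1) by (simp add: insert_commute)
        then show ?thesis
          by (rule UnI2[OF main[OF _ pq(4)[symmetric] t(2,1) pq(3,2) h]])
      qed
    qed
  qed
  have fU: "finite U0" unfolding U0_def using finite_uedges[OF G] by simp
  have fL: "finite (\<Union>(set ?L))"
    using finA finG finP finl fin_nbA by (auto intro: finite_subset[of "nbA _"] finite_SigmaI)
  have "card E' \<le> card (U0 \<union> pr ` (\<Union>(set ?L)))"
    using cover fU fL by (intro card_mono) auto
  also have "\<dots> \<le> card U0 + card (pr ` (\<Union>(set ?L)))" by (rule card_Un_le)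
  also have "\<dots> \<le> card U0 + card (\<Union>(set ?L))" using card_image_le[OF fL] by simp
  also have "card (\<Union>(set ?L)) \<le> card (TT \<times> uverts G) + (card (A2 \<times> A2) + (card (A2 \<times> X) +
      (card (A2 \<times> {y \<in> B. \<not> good y}) + (card (A2 \<times> hv) + (card (Sigma light nbA) + (card P1 + card P2))))))"
  proof -
    have "\<Union>(set ?L) = TT \<times> uverts G \<union> (A2 \<times> A2 \<union> (A2 \<times> X \<union> (A2 \<times> {y \<in> B. \<not> good y} \<union>
      (A2 \<times> hv \<union> (Sigma light nbA \<union> (P1 \<union> P2))))))" by simp
    then show ?thesis
      by (simp only:) (intro order_trans[OF card_Un_le] add_left_mono card_Un_le)
  qed
  finally have bound: "card E' \<le> card U0 + (card TT * card (uverts G) + (card A2 * card A2 + (card A2 *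
      card X +
      (card A2 * card {y \<in> B. \<not> good y} + (card A2 * card hv + (card (Sigma light nbA) + (card P1 + card
          P2)))))))"
    by (simp add: card_cartesian_product)
  have "card (Sigma light nbA) = (\<Sum>y\<in>light. card (nbA y))"
    using finl fin_nbA by (intro card_SigmaI) auto
  then have "real (card (Sigma light nbA)) = (\<Sum>y\<in>light. real (card (nbA y)))" by simp
  also have "\<dots> \<le> (\<Sum>y\<in>light. \<delta> * (real M2 * real N))" unfolding light_def by (intro sum_mono) auto
  also have "\<dots> = card light * (\<delta> * (real M2 * real N))" by simp
  also have "\<dots> \<le> card (uverts G) * (\<delta> * (real M2 * real N))"
  proof (rule mult_right_mono)
    have "light \<subseteq> uverts G" using BG unfolding light_def by auto
    then show "real (card light) \<le> real (card (uverts G))" using finG card_mono by auto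
  qed (use \<delta> in simp)
  finally have sl: "real (card (Sigma light nbA)) \<le> card (uverts G) * (\<delta> * (real M2 * real N))" .
  have sh: "real (card A2) * card hv \<le> real (card A2) * (M2 * card EE * K * card V)"
    using card_hv by (intro mult_left_mono) (auto simp flip: of_nat_mult)
  have "real (sat G F) \<le> real (card E')" using sat_le[OF E'(4)] by simp
  also have "\<dots> \<le> card U0 + (real (card TT) * card (uverts G) + (real (card A2) * card A2 + (real (card
      A2) * card X +
      (real (card A2) * card {y \<in> B. \<not> good y} + (real (card A2) * card hv + (real (card (Sigma light
          nbA)) + (real (card P1) + card P2)))))))"
    using bound by (simp flip: of_nat_mult of_nat_add)
  finally show ?thesis using sl sh unfolding U0_def P1_def P2_def by linarith
qed

end

subsection \<open>Independent coin flips\<close>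

abbreviation coins :: "real \<Rightarrow> 'e set \<Rightarrow> ('e \<Rightarrow> bool) pmf" where
  "coins p E \<equiv> Pi_pmf E False (\<lambda>_. bernoulli_pmf p)"

text \<open>The coins outside \<open>D\<close> are exposed first; the inner measure is the
  conditional probability given their outcome \<open>g\<close>.\<close>

lemma coins_split:
  assumes "finite E" "D \<subseteq> E"
  shows "emeasure (coins p E) {\<omega>. Q \<omega>}
    = (\<integral>\<^sup>+g. emeasure (coins p D) {f. Q (\<lambda>e. if e \<in> D then f e else g e)} \<partial>coins p (E - D))"
proof -
  have E: "E = D \<union> (E - D)" and fin: "finite D" "finite (E - D)"
    using assms finite_subset by auto
  have "coins p E = map_pmf (\<lambda>(f, g) x. if x \<in> D then f x else g x)
      (pair_pmf (coins p D) (coins p (E - D)))"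
    by (subst E, rule Pi_pmf_union) (use fin in auto)
  also have "\<dots> = bind_pmf (coins p (E - D))
      (\<lambda>g. map_pmf (\<lambda>f x. if x \<in> D then f x else g x) (coins p D))"
    by (subst pair_commute_pmf)
      (simp add: pair_pmf_def map_pmf_def bind_assoc_pmf bind_return_pmf)
  finally show ?thesis by (simp add: vimage_def)
qed

text \<open>A bound valid for every outcome outside \<open>D\<close> holds unconditionally. This is
  how random sets such as \<open>A1\<close> are frozen before the edges towards them are looked
  at.\<close>

lemma coins_slice:
  assumes "finite E" "D \<subseteq> E" "0 \<le> c"
    and "\<And>g. measure_pmf.prob (coins p D) {f. Q (\<lambda>e. if e \<in> D then f e else g e)} \<le> c"
  shows "measure_pmf.prob (coins p E) {\<omega>. Q \<omega>} \<le> c"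
proof -
  have "emeasure (coins p E) {\<omega>. Q \<omega>} \<le> (\<integral>\<^sup>+g. ennreal c \<partial>coins p (E - D))"
    unfolding coins_split[OF assms(1,2)]
    by (rule nn_integral_mono) (use assms(3,4) in \<open>simp add: measure_pmf.emeasure_eq_measure\<close>)
  also have "\<dots> = ennreal c" by simp
  finally show ?thesis using assms(3) by (simp add: measure_pmf.emeasure_eq_measure)
qed

lemma finite_set_coins: "finite E \<Longrightarrow> finite (set_pmf (coins p E))"
  by (subst set_Pi_pmf) (auto intro!: finite_PiE_dflt)

lemma coins_all:
  assumes "0 \<le> p" "p \<le> 1" "finite A"
  shows "measure_pmf.prob (coins p A) {f. \<forall>e\<in>A. f e} = p ^ card A"
proof -
  have "{f. \<forall>e\<in>A. f e} = Pi A (\<lambda>_. {True})" by auto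
  then have "measure_pmf.prob (coins p A) {f. \<forall>e\<in>A. f e}
      = (\<Prod>x\<in>A. measure_pmf.prob (bernoulli_pmf p) {True})"
    using measure_Pi_pmf_Pi[OF assms(3), of False "\<lambda>_. bernoulli_pmf p" "\<lambda>_. {True}"] by simp
  then show ?thesis using assms by (simp add: measure_pmf_single)
qed

text \<open>The blocks use disjoint sets of coins, so they fail independently. The induction exposes
  all coins outside one block and multiplies by the failure probability of that block.\<close>

lemma coins_blocks_fail:
  assumes p: "0 \<le> p" "p \<le> 1" and "finite Bs" "finite D"
    and "\<And>b. b \<in> Bs \<Longrightarrow> Nb b \<subseteq> D" "\<And>b. b \<in> Bs \<Longrightarrow> card (Nb b) \<le> r"
    and "\<And>b b'. b \<in> Bs \<Longrightarrow> b' \<in> Bs \<Longrightarrow> b \<noteq> b' \<Longrightarrow> Nb b \<inter> Nb b' = {}"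
  shows "measure_pmf.prob (coins p D) {f. \<forall>b\<in>Bs. \<exists>e\<in>Nb b. \<not> f e} \<le> (1 - p ^ r) ^ card Bs"
  using assms(3-)
proof (induction Bs arbitrary: D rule: finite_induct)
  case empty
  then show ?case by simp
next
  case (insert b Bs)
  have q: "0 \<le> 1 - p ^ r" using p by (simp add: power_le_one)
  have Nb1: "Nb b \<subseteq> D" using insert.prems(2) by simp
  note Nb = Nb1 finite_subset[OF Nb1 insert.prems(1)]
  have disj: "Nb b' \<inter> Nb b = {}" if "b' \<in> Bs" for b' using insert.prems(4)[of b' b] insert.hyps that by auto
  let ?R = "\<lambda>g. \<forall>b'\<in>Bs. \<exists>e\<in>Nb b'. \<not> g e"
  have eq: "(\<forall>b'\<in>insert b Bs. \<exists>e\<in>Nb b'. \<not> (if e \<in> Nb b then f e else g e)) \<longleftrightarrow>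
      (\<exists>e\<in>Nb b. \<not> f e) \<and> ?R g" for f g
  proof -
    have "(\<exists>e\<in>Nb b'. \<not> (if e \<in> Nb b then f e else g e)) \<longleftrightarrow> (\<exists>e\<in>Nb b'. \<not> g e)" if "b' \<in> Bs" for b'
      using disj[OF that] by (metis disjoint_iff)
    moreover have "(\<exists>e\<in>Nb b. \<not> (if e \<in> Nb b then f e else g e)) \<longleftrightarrow> (\<exists>e\<in>Nb b. \<not> f e)" by auto
    ultimately show ?thesis by auto
  qed
  have one: "measure_pmf.prob (coins p (Nb b)) {f. \<exists>e\<in>Nb b. \<not> f e} \<le> 1 - p ^ r"
  proof -
    have "{f. \<exists>e\<in>Nb b. \<not> f e} = space (measure_pmf (coins p (Nb b))) - {f. \<forall>e\<in>Nb b. f e}" by auto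
    then have "measure_pmf.prob (coins p (Nb b)) {f. \<exists>e\<in>Nb b. \<not> f e} = 1 - p ^ card (Nb b)"
      using measure_pmf.prob_compl[of "{f. \<forall>e\<in>Nb b. f e}" "coins p (Nb b)"] coins_all[OF p Nb(2)] by simp
    moreover have "p ^ r \<le> p ^ card (Nb b)" using insert.prems(3)[of b] p by (intro power_decreasing) auto
    ultimately show ?thesis by simp
  qed
  have "emeasure (coins p D) {f. \<forall>b'\<in>insert b Bs. \<exists>e\<in>Nb b'. \<not> f e}
      = (\<integral>\<^sup>+g. emeasure (coins p (Nb b)) {f. (\<exists>e\<in>Nb b. \<not> f e) \<and> ?R g} \<partial>coins p (D - Nb b))"
    unfolding coins_split[OF insert.prems(1) Nb(1)] eq ..
  also have "\<dots> \<le> (\<integral>\<^sup>+g. ennreal (1 - p ^ r) * indicator {g. ?R g} g \<partial>coins p (D - Nb b))"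
  proof (rule nn_integral_mono)
    fix g
    show "emeasure (coins p (Nb b)) {f. (\<exists>e\<in>Nb b. \<not> f e) \<and> ?R g}
        \<le> ennreal (1 - p ^ r) * indicator {g. ?R g} g"
    proof (cases "?R g")
      case True
      then have "{f. (\<exists>e\<in>Nb b. \<not> f e) \<and> ?R g} = {f. \<exists>e\<in>Nb b. \<not> f e}" by blast
      then show ?thesis using True one q by (simp add: measure_pmf.emeasure_eq_measure)
    next
      case False
      then have "{f. (\<exists>e\<in>Nb b. \<not> f e) \<and> ?R g} = {}" by blast
      then show ?thesis by (simp only: emeasure_empty) simp
    qed
  qed
  also have "\<dots> = ennreal (1 - p ^ r) * emeasure (coins p (D - Nb b)) {g. ?R g}"
    by (simp add: nn_integral_cmult)
  also have "\<dots> = ennreal ((1 - p ^ r) * measure_pmf.prob (coins p (D - Nb b)) {g. ?R g})"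
    using q by (simp add: measure_pmf.emeasure_eq_measure ennreal_mult')
  finally have "measure_pmf.prob (coins p D) {f. \<forall>b'\<in>insert b Bs. \<exists>e\<in>Nb b'. \<not> f e}
      \<le> (1 - p ^ r) * measure_pmf.prob (coins p (D - Nb b)) {g. ?R g}"
    using q by (simp add: measure_pmf.emeasure_eq_measure)
  also have "\<dots> \<le> (1 - p ^ r) * (1 - p ^ r) ^ card Bs"
  proof (rule mult_left_mono[OF _ q], rule insert.IH)
    show "Nb b' \<subseteq> D - Nb b" if "b' \<in> Bs" for b' using insert.prems(2)[of b'] disj that by auto
  qed (use insert.prems in auto)
  finally show ?case using insert.hyps by simp
qed

text \<open>The probability generating function of a binomial variable; \<open>h\<close> assigns to
  each element its own coin, usually the edge from a fixed vertex.\<close>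

lemma expectation_coins_power:
  assumes p: "0 \<le> p" "p \<le> 1" and D: "finite D" and z: "0 \<le> z"
    and Z: "finite Z" "inj_on h Z" "h ` Z \<subseteq> D"
  shows "measure_pmf.expectation (coins p D) (\<lambda>f. z ^ card {a \<in> Z. f (h a)})
    = (1 - p + p * z) ^ card Z"
proof -
  define k where "k e v = (if e \<in> h ` Z then if v then z else 1 else (1::real))" for e and v :: bool
  have "z ^ card {a \<in> Z. f (h a)} = (\<Prod>e\<in>D. k e (f e))" for f
  proof -
    have "(\<Prod>e\<in>D. k e (f e)) = (\<Prod>e\<in>h ` Z. k e (f e))"
      by (rule prod.mono_neutral_right[OF D Z(3)]) (auto simp: k_def)
    also have "\<dots> = (\<Prod>a\<in>Z. k (h a) (f (h a)))" using Z(2) by (simp add: prod.reindex)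
    also have "\<dots> = (\<Prod>a\<in>Z. if f (h a) then z else 1)" by (intro prod.cong) (auto simp: k_def)
    also have "\<dots> = z ^ card {a \<in> Z. f (h a)}" using Z(1) by (simp add: prod.If_cases Int_def)
    finally show ?thesis by simp
  qed
  then have "measure_pmf.expectation (coins p D) (\<lambda>f. z ^ card {a \<in> Z. f (h a)})
      = measure_pmf.expectation (coins p D) (\<lambda>f. \<Prod>e\<in>D. k e (f e))" by simp
  also have "\<dots> = (\<Prod>e\<in>D. measure_pmf.expectation (bernoulli_pmf p) (k e))"
    by (rule expectation_prod_Pi_pmf[OF D]) (use z in \<open>auto simp: k_def integrable_measure_pmf_finite\<close>)
  also have "\<dots> = (\<Prod>e\<in>D. if e \<in> h ` Z then 1 - p + p * z else 1)"
    by (intro prod.cong refl) (use p in \<open>auto simp: k_def algebra_simps\<close>)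
  also have "\<dots> = (1 - p + p * z) ^ card (h ` Z)"
    using Z D by (simp add: prod.If_cases Int_absorb1)
  finally show ?thesis using Z(2) by (simp add: card_image)
qed

text \<open>Chernoff's method with the base \<open>z\<close> left free. Thresholds as close to the
  mean as a factor \<open>1 + \<epsilon>\<close> require a carefully chosen base, which is fixed
  only in the asymptotic part.\<close>

lemma coins_tail_le:
  assumes p: "0 \<le> p" "p \<le> 1" and D: "finite D" and z: "0 < z" "z \<le> 1"
    and Z: "finite Z" "inj_on h Z" "h ` Z \<subseteq> D"
  shows "measure_pmf.prob (coins p D) {f. real (card {a \<in> Z. f (h a)}) \<le> x}
    \<le> (1 - p + p * z) ^ card Z / z powr x"
proof -
  have "measure_pmf.prob (coins p D) {f. real (card {a \<in> Z. f (h a)}) \<le> x}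
      \<le> measure_pmf.prob (coins p D) {f. z powr x \<le> z ^ card {a \<in> Z. f (h a)}}"
  proof (rule measure_pmf.finite_measure_mono)
    show "{f. real (card {a \<in> Z. f (h a)}) \<le> x} \<subseteq> {f. z powr x \<le> z ^ card {a \<in> Z. f (h a)}}"
    proof (intro subsetI CollectI)
      fix f assume "f \<in> {f. real (card {a \<in> Z. f (h a)}) \<le> x}"
      then have "z powr x \<le> z powr real (card {a \<in> Z. f (h a)})"
        using z by (intro powr_mono') auto
      then show "z powr x \<le> z ^ card {a \<in> Z. f (h a)}" using z by (simp add: powr_realpow)
    qed
  qed simp
  also have "\<dots> \<le> measure_pmf.expectation (coins p D) (\<lambda>f. z ^ card {a \<in> Z. f (h a)}) / z powr x"
    by (rule finite_pmf_prob_Markov[OF finite_set_coins[OF D]]) (use z in auto)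
  finally show ?thesis using expectation_coins_power[OF p D _ Z, of z] z by simp
qed

lemma coins_tail_ge:
  assumes p: "0 \<le> p" "p \<le> 1" and D: "finite D" and z: "1 \<le> z"
    and Z: "finite Z" "inj_on h Z" "h ` Z \<subseteq> D"
  shows "measure_pmf.prob (coins p D) {f. x \<le> real (card {a \<in> Z. f (h a)})}
    \<le> (1 - p + p * z) ^ card Z / z powr x"
proof -
  have "measure_pmf.prob (coins p D) {f. x \<le> real (card {a \<in> Z. f (h a)})}
      \<le> measure_pmf.prob (coins p D) {f. z powr x \<le> z ^ card {a \<in> Z. f (h a)}}"
  proof (rule measure_pmf.finite_measure_mono)
    show "{f. x \<le> real (card {a \<in> Z. f (h a)})} \<subseteq> {f. z powr x \<le> z ^ card {a \<in> Z. f (h a)}}"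
    proof (intro subsetI CollectI)
      fix f assume "f \<in> {f. x \<le> real (card {a \<in> Z. f (h a)})}"
      then have "z powr x \<le> z powr real (card {a \<in> Z. f (h a)})"
        using z by (intro powr_mono) auto
      then show "z powr x \<le> z ^ card {a \<in> Z. f (h a)}" using z by (simp add: powr_realpow)
    qed
  qed simp
  also have "\<dots> \<le> measure_pmf.expectation (coins p D) (\<lambda>f. z ^ card {a \<in> Z. f (h a)}) / z powr x"
    by (rule finite_pmf_prob_Markov[OF finite_set_coins[OF D]]) (use z in auto)
  finally show ?thesis using expectation_coins_power[OF p D _ Z, of z] z by simp
qed

text \<open>A first moment bound, so dependence between the events for different \<open>x\<close>
  does no harm.\<close>

lemma prob_count_ge:
  fixes Q :: "'b \<Rightarrow> 'c \<Rightarrow> bool"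
  assumes fin: "finite (set_pmf M)" "finite A" and c: "\<And>x. x \<in> A \<Longrightarrow> measure_pmf.prob M {\<omega>. Q x \<omega>} \<le> c"
    and t: "0 < t"
  shows "measure_pmf.prob M {\<omega>. t \<le> real (card {x \<in> A. Q x \<omega>})} \<le> real (card A) * c / t"
proof -
  have "measure_pmf.expectation M (\<lambda>\<omega>. real (card {x \<in> A. Q x \<omega>}))
      = measure_pmf.expectation M (\<lambda>\<omega>. \<Sum>x\<in>A. if Q x \<omega> then 1 else 0)"
    using fin(2) by (simp add: sum.If_cases Int_def)
  also have "\<dots> = (\<Sum>x\<in>A. measure_pmf.expectation M (\<lambda>\<omega>. if Q x \<omega> then 1 else 0))"
    by (rule Bochner_Integration.integral_sum) (auto intro: integrable_measure_pmf_finite fin)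
  also have "\<dots> = (\<Sum>x\<in>A. measure_pmf.prob M {\<omega>. Q x \<omega>})" unfolding prob_pmf_eq_expectation ..
  also have "\<dots> \<le> real (card A) * c" using c by (intro sum_bounded_above) auto
  finally have "measure_pmf.expectation M (\<lambda>\<omega>. real (card {x \<in> A. Q x \<omega>})) \<le> real (card A) * c" .
  moreover have "measure_pmf.prob M {\<omega>. t \<le> real (card {x \<in> A. Q x \<omega>})}
      \<le> measure_pmf.expectation M (\<lambda>\<omega>. real (card {x \<in> A. Q x \<omega>})) / t"
    by (rule finite_pmf_prob_Markov[OF fin(1)]) (use t in auto)
  ultimately show ?thesis using t by (smt (verit) divide_right_mono)
qed

lemma prob_exists_le:
  fixes Q :: "'b \<Rightarrow> 'c \<Rightarrow> bool"
  assumes "finite A" "\<And>x. x \<in> A \<Longrightarrow> measure_pmf.prob M {\<omega>. Q x \<omega>} \<le> c"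
  shows "measure_pmf.prob M {\<omega>. \<exists>x\<in>A. Q x \<omega>} \<le> real (card A) * c"
proof -
  have "{\<omega>. \<exists>x\<in>A. Q x \<omega>} = (\<Union>x\<in>A. {\<omega>. Q x \<omega>})" by auto
  then have "measure_pmf.prob M {\<omega>. \<exists>x\<in>A. Q x \<omega>} \<le> (\<Sum>x\<in>A. measure_pmf.prob M {\<omega>. Q x \<omega>})"
    using measure_pmf.finite_measure_subadditive_finite[OF assms(1), of "\<lambda>x. {\<omega>. Q x \<omega>}" M] by simp
  also have "\<dots> \<le> real (card A) * c" using assms by (intro sum_bounded_above) auto
  finally show ?thesis .
qed

subsection \<open>The host graph in a random graph\<close>

lemma all_edges_mono: "A \<subseteq> B \<Longrightarrow> all_edges A \<subseteq> all_edges B"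
  unfolding all_edges_def by auto

lemma finite_all_edges: "finite A \<Longrightarrow> finite (all_edges A)"
  unfolding all_edges_def by (auto intro: finite_subset[of _ "Pow A"])

lemma all_edges_pair: "x \<in> A \<Longrightarrow> y \<in> A \<Longrightarrow> x \<noteq> y \<Longrightarrow> {x, y} \<in> all_edges A"
  unfolding all_edges_def by auto

lemma card_all_edges_le:
  assumes "finite A" shows "card (all_edges A) \<le> card A * card A"
proof -
  have "card (all_edges A) \<le> card (A \<times> A)"
  proof (rule surj_card_le)
    show "all_edges A \<subseteq> (\<lambda>(x, y). {x, y}) ` (A \<times> A)"
      unfolding all_edges_def by (auto simp: card_2_iff)
  qed (use assms in simp)
  then show ?thesis by (simp add: card_cartesian_product)
qed

lemma all_edges_disjoint:
  assumes "A \<inter> B = {}" shows "all_edges A \<inter> all_edges B = {}"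
proof -
  have False if "e \<in> all_edges A" "e \<in> all_edges B" for e
  proof -
    have "e \<subseteq> A \<inter> B" "card e = 2" using that unfolding all_edges_def by auto
    then show False using assms by simp
  qed
  then show ?thesis by blast
qed

text \<open>Vertices are taken from reservoirs: the \<open>g\<close>-th copy of the host structure is placed into the
  first suitable one among \<open>L\<close> disjoint blocks, so that the choice does not depend on the edges
  leaving the block.\<close>

locale random_host = star_graph F u v
  for F :: "'a ugraph" and u v :: 'a +
  fixes Is Rs Ts :: "'a set" and ka kb :: nat and N :: nat and EG :: "nat set set" and \<delta> :: real
    and p :: real and n M1 M2 L K :: nat
    and p1 p2 :: "nat \<Rightarrow> nat \<Rightarrow> nat \<Rightarrow> nat" and p3 :: "nat \<Rightarrow> ('a \<Rightarrow> nat) \<times> nat \<times> 'a \<Rightarrow> nat"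
  assumes min: "minimal_conf Is Rs Ts ka kb"
    and rich: "rich Rs N EG \<delta>" and \<delta>: "0 < \<delta>"
    and p: "0 < p" "p < 1" and pos: "0 < M1" "0 < M2" "0 < L"
    and inj1: "inj_on (\<lambda>(g, b, i). p1 g b i) ({..<M1} \<times> {..<L} \<times> {..<N})"
    and inj2: "inj_on (\<lambda>(g, b, i). p2 g b i) ({..<M2} \<times> {..<L} \<times> {..<N})"
    and inj3: "inj_on (\<lambda>(b, q). p3 b q) ({..<L} \<times> Emb Rs N EG \<times> {..<K} \<times> Ts)"
    and ran1: "\<And>g b i. g < M1 \<Longrightarrow> b < L \<Longrightarrow> i < N \<Longrightarrow> p1 g b i \<in> {1..n}"
    and ran2: "\<And>g b i. g < M2 \<Longrightarrow> b < L \<Longrightarrow> i < N \<Longrightarrow> p2 g b i \<in> {1..n}"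
    and ran3: "\<And>b q. b < L \<Longrightarrow> q \<in> Emb Rs N EG \<times> {..<K} \<times> Ts \<Longrightarrow> p3 b q \<in> {1..n}"
    and dis12: "\<And>g b i g' b' i'. g < M1 \<Longrightarrow> b < L \<Longrightarrow> i < N \<Longrightarrow> g' < M2 \<Longrightarrow> b' < L \<Longrightarrow> i' < N \<Longrightarrow>
      p1 g b i \<noteq> p2 g' b' i'"
    and dis13: "\<And>g b i b' q. g < M1 \<Longrightarrow> b < L \<Longrightarrow> i < N \<Longrightarrow> b' < L \<Longrightarrow> q \<in> Emb Rs N EG \<times> {..<K} \<times> Ts \<Longrightarrow>
      p1 g b i \<noteq> p3 b' q"
    and dis23: "\<And>g b i b' q. g < M2 \<Longrightarrow> b < L \<Longrightarrow> i < N \<Longrightarrow> b' < L \<Longrightarrow> q \<in> Emb Rs N EG \<times> {..<K} \<times> Ts \<Longrightarrow>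
      p2 g b i \<noteq> p3 b' q"
begin

abbreviation "EE \<equiv> Emb Rs N EG"
abbreviation "TI \<equiv> EE \<times> {..<K} \<times> Ts"
abbreviation "EV \<equiv> all_edges {1..n}"
abbreviation "\<mu> \<equiv> coins p EV"

definition "bl1 g b = p1 g b ` {..<N}"
definition "bl2 g b = p2 g b ` {..<N}"
definition "bl3 b = p3 b ` TI"
definition "S1 = (\<Union>g<M1. \<Union>b<L. bl1 g b)"
definition "S2 = (\<Union>g<M2. \<Union>b<L. bl2 g b)"
definition "S3 = (\<Union>b<L. bl3 b)"
definition "SS = S1 \<union> S2 \<union> S3"

text \<open>The default \<open>0\<close> is an admissible block because \<open>0 < L\<close>. Hence
  the selected sets have the intended sizes and lie in their reservoirs for every outcome, also when
  the selection fails.\<close>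

definition pick :: "(nat \<Rightarrow> bool) \<Rightarrow> nat" where
  "pick P = (if \<exists>b<L. P b then SOME b. b < L \<and> P b else 0)"

definition "ok1 \<omega> g b \<longleftrightarrow> (\<forall>e\<in>all_edges (bl1 g b). \<omega> e)"
definition "s1 \<omega> g = pick (ok1 \<omega> g)"
definition "A1 \<omega> = (\<Union>g<M1. bl1 g (s1 \<omega> g))"
definition "ok3 \<omega> b \<longleftrightarrow> (\<forall>e\<in>all_edges (bl3 b). \<omega> e)"
definition "s3 \<omega> = pick (ok3 \<omega>)"
definition "T \<omega> = bl3 (s3 \<omega>)"
text \<open>The bodies are selected before \<open>A2\<close>, so suitability of a block can include
  all edges to the set \<open>T \<omega>\<close> that was actually chosen.\<close>

definition "ok2 \<omega> g b \<longleftrightarrow> (\<forall>e\<in>all_edges (bl2 g b). \<omega> e) \<and> (\<forall>x\<in>bl2 g b. \<forall>y\<in>T \<omega>. \<omega> {x, y})"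
definition "s2 \<omega> g = pick (ok2 \<omega> g)"
definition "A2 \<omega> = (\<Union>g<M2. bl2 g (s2 \<omega> g))"

definition "sel \<omega> \<longleftrightarrow> (\<forall>g<M1. \<exists>b<L. ok1 \<omega> g b) \<and> (\<exists>b<L. ok3 \<omega> b) \<and> (\<forall>g<M2. \<exists>b<L. ok2 \<omega> g b)"

lemma pick_lt: "pick P < L"
  unfolding pick_def using pos(3) someI_ex[of "\<lambda>b. b < L \<and> P b"] by auto

lemma pick_ok: "\<exists>b<L. P b \<Longrightarrow> P (pick P)"
  unfolding pick_def using someI_ex[of "\<lambda>b. b < L \<and> P b"] by auto

lemma pick_cong: "(\<And>b. b < L \<Longrightarrow> P b = P' b) \<Longrightarrow> pick P = pick P'"
proof -
  assume h: "\<And>b. b < L \<Longrightarrow> P b = P' b"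
  then have "(\<lambda>b. b < L \<and> P b) = (\<lambda>b. b < L \<and> P' b)" by auto
  then show "pick P = pick P'" unfolding pick_def by (simp cong: conj_cong)
qed

lemma fin_sets: "finite Rs" "finite Ts" "finite EE" "finite TI"
proof -
  have V: "Is \<union> Rs \<union> Ts = V" using min unfolding minimal_conf_def conf_def by simp
  show R: "finite Rs" and Tf: "finite Ts" using V finite_V by (metis finite_Un)+
  show E: "finite EE" using finite_Emb[OF R] .
  show "finite TI" using E Tf by simp
qed

lemma fin_bl: "finite (bl1 g b)" "finite (bl2 g b)" "finite (bl3 b)"
  unfolding bl1_def bl2_def bl3_def using fin_sets(4) by auto

lemma bl_S: "g < M1 \<Longrightarrow> b < L \<Longrightarrow> bl1 g b \<subseteq> S1" "g < M2 \<Longrightarrow> b < L \<Longrightarrow> bl2 g b \<subseteq> S2" "b < L \<Longrightarrow> bl3 b \<subseteq> S3"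
  unfolding S1_def S2_def S3_def by blast+

lemma bl_n: "g < M1 \<Longrightarrow> b < L \<Longrightarrow> bl1 g b \<subseteq> {1..n}" "g < M2 \<Longrightarrow> b < L \<Longrightarrow> bl2 g b \<subseteq> {1..n}" "b < L \<Longrightarrow> bl3 b \<subseteq> {1..n}"
  unfolding bl1_def bl2_def bl3_def using ran1 ran2 ran3 by blast+

lemma S_n: "S1 \<subseteq> {1..n}" "S2 \<subseteq> {1..n}" "S3 \<subseteq> {1..n}" "SS \<subseteq> {1..n}"
  using bl_n unfolding SS_def S1_def S2_def S3_def by blast+

lemma S_disj: "S1 \<inter> S2 = {}" "S1 \<inter> S3 = {}" "S2 \<inter> S3 = {}"
proof -
  show "S1 \<inter> S2 = {}" unfolding S1_def S2_def bl1_def bl2_def using dis12 by blast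
  show "S1 \<inter> S3 = {}" unfolding S1_def S3_def bl1_def bl3_def using dis13 by blast
  show "S2 \<inter> S3 = {}" unfolding S2_def S3_def bl2_def bl3_def using dis23 by blast
qed

lemma bl1_disj:
  assumes "g < M1" "b < L" "g' < M1" "b' < L" "x \<in> bl1 g b" "x \<in> bl1 g' b'"
  shows "g = g' \<and> b = b'"
proof -
  obtain i i' where "i < N" "i' < N" "x = p1 g b i" "x = p1 g' b' i'"
    using assms(5,6) unfolding bl1_def by auto
  then show ?thesis using inj_onD[OF inj1, of "(g, b, i)" "(g', b', i')"] assms(1-4) by simp
qed

lemma bl2_disj:
  assumes "g < M2" "b < L" "g' < M2" "b' < L" "x \<in> bl2 g b" "x \<in> bl2 g' b'"
  shows "g = g' \<and> b = b'"
proof -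
  obtain i i' where "i < N" "i' < N" "x = p2 g b i" "x = p2 g' b' i'"
    using assms(5,6) unfolding bl2_def by auto
  then show ?thesis using inj_onD[OF inj2, of "(g, b, i)" "(g', b', i')"] assms(1-4) by simp
qed

lemma bl3_disj:
  assumes "b < L" "b' < L" "x \<in> bl3 b" "x \<in> bl3 b'"
  shows "b = b'"
proof -
  obtain q q' where "q \<in> TI" "q' \<in> TI" "x = p3 b q" "x = p3 b' q'"
    using assms(3,4) unfolding bl3_def by blast
  then show ?thesis using inj_onD[OF inj3, of "(b, q)" "(b', q')"] assms(1,2) by simp
qed

lemma A_S: "A1 \<omega> \<subseteq> S1" "A2 \<omega> \<subseteq> S2" "T \<omega> \<subseteq> S3"
  unfolding A1_def A2_def T_def using bl_S pick_lt unfolding s1_def s2_def s3_def by blast+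

lemma inj_c1: "inj_on (\<lambda>(g, i). p1 g (s1 \<omega> g) i) ({..<M1} \<times> {..<N})"
proof (rule inj_onI, clarify)
  fix g i g' i' assume h: "g < M1" "i < N" "g' < M1" "i' < N" "p1 g (s1 \<omega> g) i = p1 g' (s1 \<omega> g') i'"
  show "g = g' \<and> i = i'"
    using inj_onD[OF inj1, of "(g, s1 \<omega> g, i)" "(g', s1 \<omega> g', i')"] h pick_lt unfolding s1_def by auto
qed

lemma inj_c2: "inj_on (\<lambda>(g, i). p2 g (s2 \<omega> g) i) ({..<M2} \<times> {..<N})"
proof (rule inj_onI, clarify)
  fix g i g' i' assume h: "g < M2" "i < N" "g' < M2" "i' < N" "p2 g (s2 \<omega> g) i = p2 g' (s2 \<omega> g') i'"
  show "g = g' \<and> i = i'"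
    using inj_onD[OF inj2, of "(g, s2 \<omega> g, i)" "(g', s2 \<omega> g', i')"] h pick_lt unfolding s2_def by auto
qed

lemma A1_image: "A1 \<omega> = (\<lambda>(g, i). p1 g (s1 \<omega> g) i) ` ({..<M1} \<times> {..<N})"
  unfolding A1_def bl1_def by force

lemma A2_image: "A2 \<omega> = (\<lambda>(g, i). p2 g (s2 \<omega> g) i) ` ({..<M2} \<times> {..<N})"
  unfolding A2_def bl2_def by force

lemma card_A: "card (A1 \<omega>) = M1 * N" "card (A2 \<omega>) = M2 * N"
  unfolding A1_image A2_image by (simp_all add: card_image inj_c1 inj_c2)

lemma card_T: "card (T \<omega>) = card TI"
proof -
  have "inj_on (p3 (s3 \<omega>)) TI"
  proof (rule inj_onI)
    fix q q' assume "q \<in> TI" "q' \<in> TI" "p3 (s3 \<omega>) q = p3 (s3 \<omega>) q'"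
    then show "q = q'"
      using inj_onD[OF inj3, of "(s3 \<omega>, q)" "(s3 \<omega>, q')"] pick_lt unfolding s3_def by auto
  qed
  then show ?thesis unfolding T_def bl3_def by (rule card_image)
qed

lemma card_SS: "card SS \<le> (M1 + M2) * L * N + L * card TI"
proof -
  have "S1 = (\<lambda>(g, b, i). p1 g b i) ` ({..<M1} \<times> {..<L} \<times> {..<N})" unfolding S1_def bl1_def by force
  then have 1: "card S1 \<le> M1 * L * N"
    using card_image_le[of "{..<M1} \<times> {..<L} \<times> {..<N}" "\<lambda>(g, b, i). p1 g b i"] by simp
  have "S2 = (\<lambda>(g, b, i). p2 g b i) ` ({..<M2} \<times> {..<L} \<times> {..<N})" unfolding S2_def bl2_def by force
  then have 2: "card S2 \<le> M2 * L * N"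
    using card_image_le[of "{..<M2} \<times> {..<L} \<times> {..<N}" "\<lambda>(g, b, i). p2 g b i"] by simp
  have "S3 = (\<lambda>(b, q). p3 b q) ` ({..<L} \<times> TI)" unfolding S3_def bl3_def by force
  then have 3: "card S3 \<le> L * card TI"
    using card_image_le[of "{..<L} \<times> TI" "\<lambda>(b, q). p3 b q"] fin_sets(4)
        by (simp add: card_cartesian_product)
  have "card SS \<le> card S1 + card S2 + card S3"
    unfolding SS_def by (meson add_le_mono1 card_Un_le order_trans)
  then show ?thesis using 1 2 3 by (simp add: algebra_simps)
qed

lemma fin_EV: "finite EV" by (simp add: finite_all_edges)

lemma p01: "0 \<le> p" "p \<le> 1" using p by auto

lemma A1_cong:
  assumes "\<And>g b e. g < M1 \<Longrightarrow> b < L \<Longrightarrow> e \<in> all_edges (bl1 g b) \<Longrightarrow> \<omega> e = \<omega>' e"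
  shows "A1 \<omega> = A1 \<omega>'"
proof -
  have "s1 \<omega> g = s1 \<omega>' g" if "g < M1" for g
    unfolding s1_def by (rule pick_cong) (use assms that in \<open>auto simp: ok1_def\<close>)
  then show ?thesis unfolding A1_def by auto
qed

lemma T_cong:
  assumes "\<And>b e. b < L \<Longrightarrow> e \<in> all_edges (bl3 b) \<Longrightarrow> \<omega> e = \<omega>' e"
  shows "T \<omega> = T \<omega>'"
proof -
  have "s3 \<omega> = s3 \<omega>'"
    unfolding s3_def by (rule pick_cong) (use assms in \<open>auto simp: ok3_def\<close>)
  then show ?thesis unfolding T_def by auto
qed

text \<open>The selection of \<open>A2\<close> inspects edges between two reservoirs, not only edges
  inside blocks; agreement on all pairs within \<open>SS\<close> is a convenient sufficient
  condition.\<close>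

lemma SS_cong:
  assumes "\<And>e. e \<subseteq> SS \<Longrightarrow> \<omega> e = \<omega>' e"
  shows "A2 \<omega> = A2 \<omega>'" "T \<omega> = T \<omega>'"
proof -
  have sub: "bl2 g b \<subseteq> SS" "bl3 b \<subseteq> SS" if "g < M2" "b < L" for g b
    using bl_S(2)[OF that] bl_S(3)[OF that(2)] unfolding SS_def by auto
  have al: "e \<subseteq> A" if "e \<in> all_edges A" for e and A :: "nat set" using that by (simp add: all_edges_def)
  show T: "T \<omega> = T \<omega>'"
    by (rule T_cong) (metis assms al sub(2) pos(2) order_trans)
  have TS: "T \<omega>' \<subseteq> SS" using A_S(3) unfolding SS_def by auto
  have "ok2 \<omega> g b = ok2 \<omega>' g b" if "g < M2" "b < L" for g b
  proof -
    have "\<omega> e = \<omega>' e" if "e \<in> all_edges (bl2 g b)" for e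
      using assms al[OF that] sub(1)[OF \<open>g < M2\<close> \<open>b < L\<close>] by (meson order_trans)
    moreover have "\<omega> {x, y} = \<omega>' {x, y}" if "x \<in> bl2 g b" "y \<in> T \<omega>'" for x y
      using assms[of "{x, y}"] that sub(1)[OF \<open>g < M2\<close> \<open>b < L\<close>] TS by auto
    ultimately show ?thesis unfolding ok2_def T by auto
  qed
  then have "s2 \<omega> g = s2 \<omega>' g" if "g < M2" for g
    unfolding s2_def using that by (intro pick_cong) auto
  then show "A2 \<omega> = A2 \<omega>'" unfolding A2_def by auto
qed

text \<open>An upper bound for the number of edges that any candidate block asks for, so a candidate
  is suitable with probability at least \<open>p ^ rq\<close>. It is a constant, as neither
  \<open>N\<close> nor \<open>TI\<close> depends on \<open>n\<close>.\<close>

definition rq :: nat where "rq = N * N + N * card TI + card TI * card TI"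

lemma card_bl: "card (bl1 g b) \<le> N" "card (bl2 g b) \<le> N" "card (bl3 b) \<le> card TI"
  unfolding bl1_def bl2_def bl3_def
  using card_image_le[of "{..<N}" "p1 g b"] card_image_le[of "{..<N}" "p2 g b"]
    card_image_le[OF fin_sets(4), of "p3 b"] by auto

text \<open>The \<open>L\<close> candidates for one slot inspect disjoint sets of edges and fail
  independently; a union bound runs over the \<open>M1 + M2 + 1\<close> slots.\<close>

lemma prob_not_sel:
  "measure_pmf.prob \<mu> {\<omega>. \<not> sel \<omega>} \<le> (real M1 + real M2 + 1) * (1 - p ^ rq) ^ L"
proof -
  let ?c = "(1 - p ^ rq) ^ L"
  have c: "0 \<le> ?c" using p by (simp add: power_le_one)
  have edges_n: "all_edges A \<subseteq> EV" if "A \<subseteq> {1..n}" for A using all_edges_mono[OF that] .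
  have 1: "measure_pmf.prob \<mu> {\<omega>. \<exists>g\<in>{..<M1}. \<forall>b\<in>{..<L}. \<exists>e\<in>all_edges (bl1 g b). \<not> \<omega> e}
      \<le> real (card {..<M1}) * ?c"
  proof (rule prob_exists_le)
    fix g assume g: "g \<in> {..<M1}"
    have "measure_pmf.prob \<mu> {\<omega>. \<forall>b\<in>{..<L}. \<exists>e\<in>all_edges (bl1 g b). \<not> \<omega> e} \<le> (1 - p ^ rq) ^ card {..<L}"
    proof (rule coins_blocks_fail[OF p01 _ fin_EV])
      show "all_edges (bl1 g b) \<subseteq> EV" if "b \<in> {..<L}" for b
        using edges_n bl_n(1)[of g b] g that by auto
      show "card (all_edges (bl1 g b)) \<le> rq" for b
        using card_all_edges_le[OF fin_bl(1), of g b] mult_le_mono[OF card_bl(1) card_bl(1), of g b g b]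
        unfolding rq_def by linarith
      show "all_edges (bl1 g b) \<inter> all_edges (bl1 g b') = {}"
        if "b \<in> {..<L}" "b' \<in> {..<L}" "b \<noteq> b'" for b b'
        using bl1_disj[of g b g b'] g that by (intro all_edges_disjoint) auto
    qed simp
    then show "measure_pmf.prob \<mu> {\<omega>. \<forall>b\<in>{..<L}. \<exists>e\<in>all_edges (bl1 g b). \<not> \<omega> e} \<le> ?c" by simp
  qed simp
  have 3: "measure_pmf.prob \<mu> {\<omega>. \<forall>b\<in>{..<L}. \<exists>e\<in>all_edges (bl3 b). \<not> \<omega> e} \<le> (1 - p ^ rq) ^ card {..<L}"
  proof (rule coins_blocks_fail[OF p01 _ fin_EV])
    show "all_edges (bl3 b) \<subseteq> EV" if "b \<in> {..<L}" for b using edges_n bl_n(3)[of b] that by auto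
    show "card (all_edges (bl3 b)) \<le> rq" for b
      using card_all_edges_le[OF fin_bl(3), of b] mult_le_mono[OF card_bl(3) card_bl(3), of b b]
      unfolding rq_def by linarith
    show "all_edges (bl3 b) \<inter> all_edges (bl3 b') = {}" if "b \<in> {..<L}" "b' \<in> {..<L}" "b \<noteq> b'" for b b'
      using bl3_disj[of b b'] that by (intro all_edges_disjoint) auto
  qed simp
  have 2: "measure_pmf.prob \<mu> {\<omega>. \<exists>g\<in>{..<M2}. \<forall>b<L. \<not> ok2 \<omega> g b} \<le> real (card {..<M2}) * ?c"
  proof (rule prob_exists_le)
    fix g assume "g \<in> {..<M2}"
    then have g: "g < M2" by simp
    \<comment> \<open>Edges that avoid \<open>S2\<close> are exposed first. They determine
      \<open>T\<close>, after which the tests for the blocks of \<open>A2\<close> refer to a fixed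
      set.\<close>
    define D where "D = {e \<in> EV. e \<inter> S2 \<noteq> {}}"
    show "measure_pmf.prob \<mu> {\<omega>. \<forall>b<L. \<not> ok2 \<omega> g b} \<le> ?c"
    proof (rule coins_slice[OF fin_EV _ c])
      show "D \<subseteq> EV" unfolding D_def by auto
      fix h :: "nat set \<Rightarrow> bool"
      define Nb where "Nb b = all_edges (bl2 g b) \<union> (\<lambda>(x, y). {x, y}) ` (bl2 g b \<times> T h)" for b
      have Te: "T (\<lambda>e. if e \<in> D then f e else h e) = T h" for f
      proof (rule T_cong)
        fix b e assume "b < L" "e \<in> all_edges (bl3 b)"
        then have "e \<subseteq> S3" using bl_S(3)[of b] unfolding all_edges_def by auto
        then have "e \<notin> D" using S_disj(3) unfolding D_def by auto
        then show "(if e \<in> D then f e else h e) = h e" by simp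
      qed
      have bS2: "bl2 g b \<subseteq> S2" if "b < L" for b using bl_S(2)[OF g that] .
      have Nb_D: "Nb b \<subseteq> D" if b: "b < L" for b
      proof -
        have n2: "bl2 g b \<subseteq> {1..n}" using bl_n(2)[OF g b] .
        have "e \<in> D" if "e \<in> all_edges (bl2 g b)" for e
        proof -
          have "e \<noteq> {}" "e \<subseteq> bl2 g b" using that unfolding all_edges_def by auto
          then show ?thesis unfolding D_def using that edges_n[OF n2] bS2[OF b] by blast
        qed
        moreover have "{x, y} \<in> D" if "x \<in> bl2 g b" "y \<in> T h" for x y
        proof -
          have "x \<in> S2" "y \<in> S3" using that bS2[OF b] A_S(3) by blast+
          moreover have "x \<noteq> y" using calculation S_disj(3) by auto
          ultimately show ?thesis using S_n unfolding D_def by (auto intro!: all_edges_pair)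
        qed
        ultimately show ?thesis unfolding Nb_def by auto
      qed
      have "{f. \<forall>b<L. \<not> ok2 (\<lambda>e. if e \<in> D then f e else h e) g b} \<subseteq> {f. \<forall>b\<in>{..<L}. \<exists>e\<in>Nb b. \<not> f e}"
      proof (intro subsetI CollectI ballI, elim CollectE)
        fix f b assume f: "\<forall>b<L. \<not> ok2 (\<lambda>e. if e \<in> D then f e else h e) g b" and b: "b \<in> {..<L}"
        then have "\<not> ok2 (\<lambda>e. if e \<in> D then f e else h e) g b" by simp
        then obtain e where e: "e \<in> Nb b" "\<not> (if e \<in> D then f e else h e)"
          unfolding ok2_def Te Nb_def by blast
        moreover have "e \<in> D" using Nb_D[of b] b e(1) by auto
        ultimately show "\<exists>e\<in>Nb b. \<not> f e" by auto
      qed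
      then have "measure_pmf.prob (coins p D) {f. \<forall>b<L. \<not> ok2 (\<lambda>e. if e \<in> D then f e else h e) g b}
          \<le> measure_pmf.prob (coins p D) {f. \<forall>b\<in>{..<L}. \<exists>e\<in>Nb b. \<not> f e}"
        by (intro measure_pmf.finite_measure_mono) auto
      also have "\<dots> \<le> (1 - p ^ rq) ^ card {..<L}"
      proof (rule coins_blocks_fail[OF p01])
        show "finite D" unfolding D_def using fin_EV by simp
        show "Nb b \<subseteq> D" if "b \<in> {..<L}" for b using Nb_D that by simp
        show "card (Nb b) \<le> rq" for b
        proof -
          have "card (Nb b) \<le> card (all_edges (bl2 g b)) + card ((\<lambda>(x, y). {x, y}) ` (bl2 g b \<times> T h))"
            unfolding Nb_def by (rule card_Un_le)
          also have "card (all_edges (bl2 g b)) \<le> N * N"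
            using card_all_edges_le[OF fin_bl(2), of g b] mult_le_mono[OF card_bl(2) card_bl(2), of g b g b]
            by linarith
          also have "card ((\<lambda>(x, y). {x, y}) ` (bl2 g b \<times> T h)) \<le> card (bl2 g b \<times> T h)"
            using fin_bl(2,3) unfolding T_def by (intro card_image_le) simp
          also have "\<dots> \<le> N * card TI"
            using card_bl(2)[of g b] by (simp only: card_cartesian_product card_T) (rule mult_le_mono1)
          finally show ?thesis unfolding rq_def by simp
        qed
        show "Nb b \<inter> Nb b' = {}" if bb: "b \<in> {..<L}" "b' \<in> {..<L}" "b \<noteq> b'" for b b'
        proof -
          \<comment> \<open>Any tested edge has an end in its own block, and both ends in that block
            or in \<open>S3\<close>; this separates the tests of different blocks.\<close>
          have *: "\<exists>x\<in>bl2 g b. x \<in> e \<and> e \<subseteq> bl2 g b \<union> S3" if "e \<in> Nb b" for e b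
          proof -
            have "e \<in> all_edges (bl2 g b) \<or> (\<exists>x\<in>bl2 g b. \<exists>y\<in>T h. e = {x, y})" using that unfolding Nb_def
                by auto
            then show ?thesis
            proof
              assume "e \<in> all_edges (bl2 g b)"
              then have "e \<noteq> {}" "e \<subseteq> bl2 g b" unfolding all_edges_def by auto
              then show ?thesis by blast
            qed (use A_S(3) in blast)
          qed
          have False if e: "e \<in> Nb b" "e \<in> Nb b'" for e
          proof -
            obtain x where x: "x \<in> bl2 g b" "x \<in> e" using *[OF e(1)] by blast
            then have "x \<in> bl2 g b' \<union> S3" using *[OF e(2)] by blast
            moreover have "x \<notin> S3" using x bS2[of b] bb S_disj(3) by auto
            ultimately show False using bl2_disj[of g b g b' x] g x bb by auto
          qed
          then show ?thesis by blast
        qed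
      qed simp
      finally show "measure_pmf.prob (coins p D) {f. \<forall>b<L. \<not> ok2 (\<lambda>e. if e \<in> D then f e else h e) g b}
          \<le> ?c" by simp
    qed
  qed simp
  have "{\<omega>. \<not> sel \<omega>} = {\<omega>. \<exists>g\<in>{..<M1}. \<forall>b\<in>{..<L}. \<exists>e\<in>all_edges (bl1 g b). \<not> \<omega> e} \<union>
      ({\<omega>. \<exists>g\<in>{..<M2}. \<forall>b<L. \<not> ok2 \<omega> g b} \<union> {\<omega>. \<forall>b\<in>{..<L}. \<exists>e\<in>all_edges (bl3 b). \<not> \<omega> e})"
    (is "_ = ?A \<union> (?B \<union> ?C)")
    unfolding sel_def ok1_def ok3_def by blast
  then have "measure_pmf.prob \<mu> {\<omega>. \<not> sel \<omega>} \<le> measure_pmf.prob \<mu> ?A + measure_pmf.prob \<mu> (?B \<union> ?C)"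
    using measure_Un_le[of ?A "measure_pmf \<mu>" "?B \<union> ?C"] by simp
  also have "measure_pmf.prob \<mu> (?B \<union> ?C) \<le> measure_pmf.prob \<mu> ?B + measure_pmf.prob \<mu> ?C"
    using measure_Un_le[of ?B "measure_pmf \<mu>" ?C] by simp
  finally show ?thesis using 1 2 3 by (simp add: algebra_simps)
qed

section \<open>Degrees and common degrees into the selected sets\<close>

definition dg :: "(nat set \<Rightarrow> bool) \<Rightarrow> nat set \<Rightarrow> nat \<Rightarrow> nat" where
  "dg \<omega> A y = card {z \<in> A. \<omega> {y, z}}"

definition cdg :: "(nat set \<Rightarrow> bool) \<Rightarrow> nat set \<Rightarrow> nat \<Rightarrow> nat \<Rightarrow> nat" where
  "cdg \<omega> A x y = card {z \<in> A. \<omega> {x, z} \<and> \<omega> {y, z}}"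

definition D1 :: "nat \<Rightarrow> nat set set" where
  "D1 y = {{y, z} | z. z \<in> S1 \<and> z \<noteq> y \<and> (\<forall>g<M1. \<forall>b<L. \<not> (y \<in> bl1 g b \<and> z \<in> bl1 g b))}"

lemma D1_EV: "y \<in> {1..n} \<Longrightarrow> D1 y \<subseteq> EV"
  unfolding D1_def using S_n(1) by (auto intro!: all_edges_pair)

lemma A1_D1: "A1 (\<lambda>e. if e \<in> D1 y then f e else h e) = A1 h"
proof (rule A1_cong)
  fix g b e assume gb: "g < M1" "b < L" and e: "e \<in> all_edges (bl1 g b)"
  have "e \<notin> D1 y"
  proof
    assume "e \<in> D1 y"
    then obtain z where "e = {y, z}" "\<not> (y \<in> bl1 g b \<and> z \<in> bl1 g b)" unfolding D1_def using gb by auto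
    then show False using e unfolding all_edges_def by auto
  qed
  then show "(if e \<in> D1 y then f e else h e) = h e" by simp
qed

text \<open>Blocks are pairwise disjoint and \<open>y\<close> is in no selected one, so
  \<open>y\<close> and \<open>z\<close> never share a block.\<close>

lemma A1_edges_D1: "y \<notin> A1 h \<Longrightarrow> z \<in> A1 h \<Longrightarrow> {y, z} \<in> D1 y"
proof -
  assume y: "y \<notin> A1 h" and z: "z \<in> A1 h"
  have zS: "z \<in> S1" using A_S(1) z by auto
  have "False" if "g < M1" "b < L" "y \<in> bl1 g b" "z \<in> bl1 g b" for g b
  proof -
    obtain g' where g': "g' < M1" "z \<in> bl1 g' (s1 h g')" using z unfolding A1_def by auto
    then have "g = g' \<and> b = s1 h g'" using bl1_disj[OF that(1,2) g'(1) _ that(4) g'(2)] pick_lt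
        unfolding s1_def by auto
    then show False using y that(3) g' unfolding A1_def by auto
  qed
  then show "{y, z} \<in> D1 y" unfolding D1_def using zS y z by auto
qed

lemma inj_pair: "y \<notin> Z \<Longrightarrow> inj_on (\<lambda>z. {y, z}) Z"
  by (rule inj_onI) (auto simp: doubleton_eq_iff)

lemma finA: "finite (A1 \<omega>)" "finite (A2 \<omega>)" "finite (T \<omega>)"
  unfolding A1_def A2_def T_def using fin_bl by auto

lemma tail_nonneg: "0 \<le> (1 - p + p * z) ^ m / z powr x" if "0 \<le> z" for z x :: real and m :: nat
  using that p by (intro divide_nonneg_nonneg zero_le_power) auto

text \<open>With all edges outside \<open>D1 y\<close> frozen, \<open>A1\<close> is a fixed set of
  \<open>M1 * N\<close> vertices and the edges from \<open>y\<close> to it are fresh coins.\<close>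

lemma prob_low:
  assumes y: "y \<in> {1..n}" and z: "0 < z" "z \<le> 1"
  shows "measure_pmf.prob \<mu> {\<omega>. y \<notin> A1 \<omega> \<and> real (dg \<omega> (A1 \<omega>) y) \<le> d}
    \<le> (1 - p + p * z) ^ (M1 * N) / z powr d"
proof (rule coins_slice[OF fin_EV D1_EV[OF y]])
  show "0 \<le> (1 - p + p * z) ^ (M1 * N) / z powr d" using tail_nonneg z by simp
  fix h :: "nat set \<Rightarrow> bool"
  show "measure_pmf.prob (coins p (D1 y)) {f. y \<notin> A1 (\<lambda>e. if e \<in> D1 y then f e else h e) \<and>
      real (dg (\<lambda>e. if e \<in> D1 y then f e else h e) (A1 (\<lambda>e. if e \<in> D1 y then f e else h e)) y) \<le> d}
    \<le> (1 - p + p * z) ^ (M1 * N) / z powr d"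
  proof (cases "y \<in> A1 h")
    case True
    then show ?thesis unfolding A1_D1 using tail_nonneg z by simp
  next
    case False
    have eq: "dg (\<lambda>e. if e \<in> D1 y then f e else h e) (A1 h) y = card {z \<in> A1 h. f {y, z}}" for f
      unfolding dg_def using A1_edges_D1[OF False] by (metis (no_types, lifting))
    show ?thesis
      unfolding A1_D1 eq using False
        coins_tail_le[OF p01 finite_subset[OF D1_EV[OF y] fin_EV] z finA(1) inj_pair[OF False], where x = d]
        A1_edges_D1[OF False] card_A(1)[of h] by auto
  qed
qed

lemma prob_high:
  assumes y: "y \<in> {1..n}" and z: "1 \<le> z"
  shows "measure_pmf.prob \<mu> {\<omega>. y \<notin> A1 \<omega> \<and> d \<le> real (dg \<omega> (A1 \<omega>) y)}
    \<le> (1 - p + p * z) ^ (M1 * N) / z powr d"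
proof (rule coins_slice[OF fin_EV D1_EV[OF y]])
  show "0 \<le> (1 - p + p * z) ^ (M1 * N) / z powr d" using tail_nonneg z by simp
  fix h :: "nat set \<Rightarrow> bool"
  show "measure_pmf.prob (coins p (D1 y)) {f. y \<notin> A1 (\<lambda>e. if e \<in> D1 y then f e else h e) \<and>
      d \<le> real (dg (\<lambda>e. if e \<in> D1 y then f e else h e) (A1 (\<lambda>e. if e \<in> D1 y then f e else h e)) y)}
    \<le> (1 - p + p * z) ^ (M1 * N) / z powr d"
  proof (cases "y \<in> A1 h")
    case True
    then show ?thesis unfolding A1_D1 using tail_nonneg z by simp
  next
    case False
    have eq: "dg (\<lambda>e. if e \<in> D1 y then f e else h e) (A1 h) y = card {z \<in> A1 h. f {y, z}}" for f
      unfolding dg_def using A1_edges_D1[OF False] by (metis (no_types, lifting))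
    show ?thesis
      unfolding A1_D1 eq using False
        coins_tail_ge[OF p01 finite_subset[OF D1_EV[OF y] fin_EV] z finA(1) inj_pair[OF False], where x = d]
        A1_edges_D1[OF False] card_A(1)[of h] by auto
  qed
qed

lemma power_le_powr:
  assumes "0 < q" "q \<le> 1" "d \<le> real m"
  shows "q ^ m \<le> q powr d"
proof -
  have "q ^ m = q powr real m" using assms by (simp add: powr_realpow)
  also have "\<dots> \<le> q powr d" using assms by (intro powr_mono') auto
  finally show ?thesis .
qed

text \<open>Freezing everything but \<open>D1 y\<close> fixes \<open>A1\<close> together with the
  neighbourhood of \<open>x\<close> in it, because the edges at \<open>x\<close> that matter do not
  contain \<open>y\<close>. The common degree is then binomial over that neighbourhood, whose size
  exceeds \<open>d\<close>.\<close>

lemma prob_codeg1: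
  assumes xy: "x \<in> {1..n}" "y \<in> {1..n}" "x \<noteq> y" and z: "0 < z" "z \<le> 1"
  shows "measure_pmf.prob \<mu> {\<omega>. x \<notin> A1 \<omega> \<and> y \<notin> A1 \<omega> \<and> d < real (dg \<omega> (A1 \<omega>) x) \<and> real (cdg \<omega> (A1 \<omega>) x y)
      \<le> t}
    \<le> (1 - p + p * z) powr d / z powr t"
proof (rule coins_slice[OF fin_EV D1_EV[OF xy(2)]])
  show c: "0 \<le> (1 - p + p * z) powr d / z powr t" by simp
  fix h :: "nat set \<Rightarrow> bool"
  let ?w = "\<lambda>f e. if e \<in> D1 y then f e else h e"
  show "measure_pmf.prob (coins p (D1 y)) {f. x \<notin> A1 (?w f) \<and> y \<notin> A1 (?w f) \<and>
      d < real (dg (?w f) (A1 (?w f)) x) \<and> real (cdg (?w f) (A1 (?w f)) x y) \<le> t}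
    \<le> (1 - p + p * z) powr d / z powr t"
  proof (cases "x \<notin> A1 h \<and> y \<notin> A1 h \<and> d < real (dg h (A1 h) x)")
    case nt: False
    have xe: "(if {x, z} \<in> D1 y then f {x, z} else h {x, z}) = h {x, z}" if "z \<in> A1 h" "y \<notin> A1 h" for f z
    proof -
      have "y \<notin> {x, z}" using that xy(3) by auto
      then have "{x, z} \<notin> D1 y" unfolding D1_def by auto
      then show ?thesis by simp
    qed
    have dgeq: "dg (?w f) (A1 h) x = dg h (A1 h) x" if "y \<notin> A1 h" for f
      unfolding dg_def using xe that by (metis (no_types, lifting))
    have "\<not> (x \<notin> A1 (?w f) \<and> y \<notin> A1 (?w f) \<and>
      d < real (dg (?w f) (A1 (?w f)) x) \<and> real (cdg (?w f) (A1 (?w f)) x y) \<le> t)" for f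
    proof
      assume c: "x \<notin> A1 (?w f) \<and> y \<notin> A1 (?w f) \<and>
        d < real (dg (?w f) (A1 (?w f)) x) \<and> real (cdg (?w f) (A1 (?w f)) x y) \<le> t"
      have xyA: "x \<notin> A1 h" "y \<notin> A1 h" and c3: "d < real (dg (?w f) (A1 h) x)"
        using c unfolding A1_D1 by blast+
      have "d < real (dg h (A1 h) x)" using c3 unfolding dgeq[OF xyA(2)] .
      then show False using nt xyA by blast
    qed
    then have "{f. x \<notin> A1 (?w f) \<and> y \<notin> A1 (?w f) \<and>
      d < real (dg (?w f) (A1 (?w f)) x) \<and> real (cdg (?w f) (A1 (?w f)) x y) \<le> t} = {}"
      by blast
    then show ?thesis using c by (simp only: measure_empty)
  next
    case t: True
    define Z where "Z = {z \<in> A1 h. h {x, z}}"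
    have Z: "finite Z" "y \<notin> Z" unfolding Z_def using finA t by auto
    have xe: "{x, z} \<notin> D1 y" if "z \<in> A1 h" for z
    proof -
      have "y \<notin> {x, z}" using that xy(3) t by auto
      then show ?thesis unfolding D1_def by auto
    qed
    have ye: "{y, z} \<in> D1 y" if "z \<in> A1 h" for z using A1_edges_D1 t that by auto
    have eq: "cdg (?w f) (A1 h) x y = card {z \<in> Z. f {y, z}}" for f
    proof -
      have "{z \<in> A1 h. ?w f {x, z} \<and> ?w f {y, z}} = {z \<in> Z. f {y, z}}"
        unfolding Z_def using xe ye by auto
      then show ?thesis unfolding cdg_def by simp
    qed
    have "measure_pmf.prob (coins p (D1 y)) {f. x \<notin> A1 (?w f) \<and> y \<notin> A1 (?w f) \<and>
      d < real (dg (?w f) (A1 (?w f)) x) \<and> real (cdg (?w f) (A1 (?w f)) x y) \<le> t}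
      \<le> measure_pmf.prob (coins p (D1 y)) {f. real (card {z \<in> Z. f {y, z}}) \<le> t}"
      unfolding A1_D1 eq by (intro measure_pmf.finite_measure_mono) auto
    also have "\<dots> \<le> (1 - p + p * z) ^ card Z / z powr t"
      by (rule coins_tail_le[OF p01 finite_subset[OF D1_EV[OF xy(2)] fin_EV] z Z(1) inj_pair[OF Z(2)]])
        (use ye in \<open>auto simp: Z_def\<close>)
    also have "\<dots> \<le> (1 - p + p * z) powr d / z powr t"
    proof (rule divide_right_mono[OF power_le_powr])
      show "0 < 1 - p + p * z" using p z by (simp add: add_pos_pos)
      show "1 - p + p * z \<le> 1" using p z by (simp add: mult_le_cancel_left1)
      show "d \<le> real (card Z)" using t unfolding dg_def Z_def by simp
    qed simp
    finally show ?thesis .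
  qed
qed

text \<open>For \<open>y\<close> outside the reservoirs the selection never looks at
  \<open>y\<close>, so every edge from \<open>y\<close> to \<open>SS\<close> is a fresh coin.
  Reservoir vertices are excluded from the statements on \<open>A2\<close> and later counted
  separately.\<close>

definition D2 :: "nat \<Rightarrow> nat set set" where "D2 y = (\<lambda>z. {y, z}) ` SS"

lemma D2_EV: "y \<in> {1..n} \<Longrightarrow> y \<notin> SS \<Longrightarrow> D2 y \<subseteq> EV"
  unfolding D2_def using S_n(4) by (auto intro!: all_edges_pair)

lemma SS_D2:
  assumes "y \<notin> SS"
  shows "A2 (\<lambda>e. if e \<in> D2 y then f e else h e) = A2 h" "T (\<lambda>e. if e \<in> D2 y then f e else h e) = T h"
proof -
  have "(if e \<in> D2 y then f e else h e) = h e" if "e \<subseteq> SS" for e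
    using that assms unfolding D2_def by auto
  then show "A2 (\<lambda>e. if e \<in> D2 y then f e else h e) = A2 h" "T (\<lambda>e. if e \<in> D2 y then f e else h e) = T h"
    using SS_cong[of "\<lambda>e. if e \<in> D2 y then f e else h e" h] by auto
qed

lemma edges_D2: "z \<in> A2 h \<union> T h \<Longrightarrow> {y, z} \<in> D2 y"
  unfolding D2_def SS_def using A_S by blast

lemma prob_low2:
  assumes y: "y \<in> {1..n}" "y \<notin> SS" and z: "0 < z" "z \<le> 1"
  shows "measure_pmf.prob \<mu> {\<omega>. real (dg \<omega> (A2 \<omega>) y) \<le> d} \<le> (1 - p + p * z) ^ (M2 * N) / z powr d"
proof (rule coins_slice[OF fin_EV D2_EV[OF y]])
  show "0 \<le> (1 - p + p * z) ^ (M2 * N) / z powr d" using tail_nonneg z by simp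
  fix h :: "nat set \<Rightarrow> bool"
  have ny: "y \<notin> A2 h" using y A_S(2)[of h] unfolding SS_def by auto
  have eq: "dg (\<lambda>e. if e \<in> D2 y then f e else h e) (A2 h) y = card {z \<in> A2 h. f {y, z}}" for f
    unfolding dg_def using edges_D2[of _ h y] by (metis (no_types, lifting) UnI1)
  show "measure_pmf.prob (coins p (D2 y))
      {f. real (dg (\<lambda>e. if e \<in> D2 y then f e else h e) (A2 (\<lambda>e. if e \<in> D2 y then f e else h e)) y) \<le> d}
    \<le> (1 - p + p * z) ^ (M2 * N) / z powr d"
    unfolding SS_D2[OF y(2)] eq
    using coins_tail_le[OF p01 finite_subset[OF D2_EV[OF y] fin_EV] z finA(2) inj_pair[OF ny], where x = d]
      edges_D2[of _ h y] card_A(2)[of h] by auto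
qed

lemma prob_codeg2:
  assumes x: "x \<noteq> y" "x \<notin> SS" and y: "y \<in> {1..n}" "y \<notin> SS" and z: "0 < z" "z \<le> 1"
  shows "measure_pmf.prob \<mu> {\<omega>. d < real (dg \<omega> (A2 \<omega>) x) \<and> real (cdg \<omega> (A2 \<omega>) x y) \<le> t}
    \<le> (1 - p + p * z) powr d / z powr t"
proof (rule coins_slice[OF fin_EV D2_EV[OF y]])
  show c: "0 \<le> (1 - p + p * z) powr d / z powr t" by simp
  fix h :: "nat set \<Rightarrow> bool"
  let ?w = "\<lambda>f e. if e \<in> D2 y then f e else h e"
  define Z where "Z = {z \<in> A2 h. h {x, z}}"
  have ny: "y \<notin> A2 h" using y A_S(2)[of h] unfolding SS_def by auto
  have Z: "finite Z" "y \<notin> Z" unfolding Z_def using finA ny by auto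
  have xe: "{x, z} \<notin> D2 y" if "z \<in> A2 h" for z
  proof -
    have "y \<notin> {x, z}" using that x(1) ny by auto
    then show ?thesis unfolding D2_def by auto
  qed
  have ye: "{y, z} \<in> D2 y" if "z \<in> A2 h" for z using edges_D2 that by blast
  have eq: "cdg (?w f) (A2 h) x y = card {z \<in> Z. f {y, z}}" for f
  proof -
    have "{z \<in> A2 h. ?w f {x, z} \<and> ?w f {y, z}} = {z \<in> Z. f {y, z}}"
      unfolding Z_def using xe ye by auto
    then show ?thesis unfolding cdg_def by simp
  qed
  have eqd: "dg (?w f) (A2 h) x = card Z" for f
  proof -
    have "{z \<in> A2 h. ?w f {x, z}} = Z" unfolding Z_def using xe by auto
    then show ?thesis unfolding dg_def by simp
  qed
  show "measure_pmf.prob (coins p (D2 y)) {f. d < real (dg (?w f) (A2 (?w f)) x) \<and>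
      real (cdg (?w f) (A2 (?w f)) x y) \<le> t}
    \<le> (1 - p + p * z) powr d / z powr t"
  proof (cases "d < real (card Z)")
    case False
    then have "{f. d < real (dg (?w f) (A2 (?w f)) x) \<and> real (cdg (?w f) (A2 (?w f)) x y) \<le> t} = {}"
      unfolding SS_D2[OF y(2)] eqd by auto
    then show ?thesis using c by (simp only: measure_empty)
  next
    case True
    have "measure_pmf.prob (coins p (D2 y)) {f. d < real (dg (?w f) (A2 (?w f)) x) \<and>
        real (cdg (?w f) (A2 (?w f)) x y) \<le> t}
      \<le> measure_pmf.prob (coins p (D2 y)) {f. real (card {z \<in> Z. f {y, z}}) \<le> t}"
      unfolding SS_D2[OF y(2)] eq by (intro measure_pmf.finite_measure_mono) auto
    also have "\<dots> \<le> (1 - p + p * z) ^ card Z / z powr t"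
      by (rule coins_tail_le[OF p01 finite_subset[OF D2_EV[OF y] fin_EV] z Z(1) inj_pair[OF Z(2)]])
        (use ye in \<open>auto simp: Z_def\<close>)
    also have "\<dots> \<le> (1 - p + p * z) powr d / z powr t"
    proof (rule divide_right_mono[OF power_le_powr])
      show "0 < 1 - p + p * z" using p z by (simp add: add_pos_pos)
      show "1 - p + p * z \<le> 1" using p z by (simp add: mult_le_cancel_left1)
      show "d \<le> real (card Z)" using True by simp
    qed simp
    finally show ?thesis .
  qed
qed

definition gd :: "(nat set \<Rightarrow> bool) \<Rightarrow> nat \<Rightarrow> bool" where
  "gd \<omega> y \<longleftrightarrow> (\<forall>\<psi>\<in>EE. \<exists>j<K. \<forall>t\<in>Ts. \<omega> {y, p3 (s3 \<omega>) (\<psi>, j, t)})"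

text \<open>For a fixed \<open>\<psi>\<close> the \<open>K\<close> bodies are disjoint, so
  \<open>y\<close> fails to see them independently; a union bound over \<open>EE\<close>
  follows.\<close>

lemma prob_not_gd:
  assumes y: "y \<in> {1..n}" "y \<notin> SS"
  shows "measure_pmf.prob \<mu> {\<omega>. \<not> gd \<omega> y} \<le> real (card EE) * (1 - p ^ card Ts) ^ K"
proof (rule coins_slice[OF fin_EV D2_EV[OF y]])
  show "0 \<le> real (card EE) * (1 - p ^ card Ts) ^ K" using p by (simp add: power_le_one)
  fix h :: "nat set \<Rightarrow> bool"
  let ?w = "\<lambda>f e. if e \<in> D2 y then f e else h e"
  have s3: "s3 (?w f) = s3 h" for f
  proof -
    have "ok3 (?w f) b = ok3 h b" if "b < L" for b
    proof -
      have "e \<notin> D2 y" if "e \<in> all_edges (bl3 b)" for e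
      proof -
        have "e \<subseteq> SS" using that bl_S(3)[OF \<open>b < L\<close>] unfolding all_edges_def SS_def by auto
        then show ?thesis using y(2) unfolding D2_def by auto
      qed
      then show ?thesis unfolding ok3_def by auto
    qed
    then show ?thesis unfolding s3_def by (intro pick_cong)
  qed
  have inT: "p3 (s3 h) (\<psi>, j, t) \<in> T h" if "\<psi> \<in> EE" "j < K" "t \<in> Ts" for \<psi> j t
    unfolding T_def bl3_def using that by auto
  have inD: "{y, p3 (s3 h) (\<psi>, j, t)} \<in> D2 y" if "\<psi> \<in> EE" "j < K" "t \<in> Ts" for \<psi> j t
    using edges_D2[of _ h y] inT[OF that] by blast
  define Nb where "Nb \<psi> j = (\<lambda>t. {y, p3 (s3 h) (\<psi>, j, t)}) ` Ts" for \<psi> j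
  have "{f. \<not> gd (?w f) y} \<subseteq> {f. \<exists>\<psi>\<in>EE. \<forall>j\<in>{..<K}. \<exists>e\<in>Nb \<psi> j. \<not> f e}"
  proof (intro subsetI CollectI, elim CollectE)
    fix f assume "\<not> gd (?w f) y"
    then obtain \<psi> where \<psi>: "\<psi> \<in> EE" "\<forall>j<K. \<exists>t\<in>Ts. \<not> ?w f {y, p3 (s3 h) (\<psi>, j, t)}"
      unfolding gd_def s3 by blast
    have "\<exists>e\<in>Nb \<psi> j. \<not> f e" if "j < K" for j
    proof -
      obtain t where "t \<in> Ts" "\<not> ?w f {y, p3 (s3 h) (\<psi>, j, t)}" using \<psi>(2) \<open>j < K\<close> by blast
      then show ?thesis unfolding Nb_def using inD[OF \<psi>(1) that] by auto
    qed
    then show "\<exists>\<psi>\<in>EE. \<forall>j\<in>{..<K}. \<exists>e\<in>Nb \<psi> j. \<not> f e" using \<psi>(1) by auto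
  qed
  then have "measure_pmf.prob (coins p (D2 y)) {f. \<not> gd (?w f) y}
      \<le> measure_pmf.prob (coins p (D2 y)) {f. \<exists>\<psi>\<in>EE. \<forall>j\<in>{..<K}. \<exists>e\<in>Nb \<psi> j. \<not> f e}"
    by (intro measure_pmf.finite_measure_mono) auto
  also have "\<dots> \<le> real (card EE) * (1 - p ^ card Ts) ^ K"
  proof (rule prob_exists_le[OF fin_sets(3)])
    fix \<psi> assume \<psi>: "\<psi> \<in> EE"
    have "measure_pmf.prob (coins p (D2 y)) {f. \<forall>j\<in>{..<K}. \<exists>e\<in>Nb \<psi> j. \<not> f e}
        \<le> (1 - p ^ card Ts) ^ card {..<K}"
    proof (rule coins_blocks_fail[OF p01])
      show "finite (D2 y)" using finite_subset[OF D2_EV[OF y] fin_EV] .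
      show "Nb \<psi> j \<subseteq> D2 y" if "j \<in> {..<K}" for j unfolding Nb_def using inD \<psi> that by auto
      show "card (Nb \<psi> j) \<le> card Ts" for j unfolding Nb_def by (rule card_image_le[OF fin_sets(2)])
      show "Nb \<psi> j \<inter> Nb \<psi> j' = {}" if j: "j \<in> {..<K}" "j' \<in> {..<K}" "j \<noteq> j'" for j j'
      proof -
        have False if t: "t \<in> Ts" "t' \<in> Ts" "{y, p3 (s3 h) (\<psi>, j, t)} = {y, p3 (s3 h) (\<psi>, j', t')}" for t t'
        proof -
          have "p3 (s3 h) (\<psi>, j, t) = p3 (s3 h) (\<psi>, j', t')" using t(3) by (auto simp: doubleton_eq_iff)
          then show False
            using inj_onD[OF inj3, of "(s3 h, \<psi>, j, t)" "(s3 h, \<psi>, j', t')"] pick_lt[of "ok3 h"] j t \<psi>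
            unfolding s3_def by auto
        qed
        then show ?thesis unfolding Nb_def by auto
      qed
    qed simp
    then show "measure_pmf.prob (coins p (D2 y)) {f. \<forall>j\<in>{..<K}. \<exists>e\<in>Nb \<psi> j. \<not> f e}
        \<le> (1 - p ^ card Ts) ^ K" by simp
  qed
  finally show "measure_pmf.prob (coins p (D2 y)) {f. \<not> gd (?w f) y}
      \<le> real (card EE) * (1 - p ^ card Ts) ^ K" .
qed

end

section \<open>From typical outcomes to a probability bound for the saturation number\<close>

context random_host
begin

definition Gr :: "(nat set \<Rightarrow> bool) \<Rightarrow> nat ugraph" where
  "Gr \<omega> = ({1..n}, {e \<in> EV. \<omega> e})"

lemma Gr_edge: "x \<in> {1..n} \<Longrightarrow> y \<in> {1..n} \<Longrightarrow> x \<noteq> y \<Longrightarrow> {x, y} \<in> uedges (Gr \<omega>) \<longleftrightarrow> \<omega> {x, y}"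
  unfolding Gr_def using all_edges_pair[of x "{1..n}" y] by simp

lemma p3_T: "\<psi> \<in> EE \<Longrightarrow> j < K \<Longrightarrow> t \<in> Ts \<Longrightarrow> p3 (s3 \<omega>) (\<psi>, j, t) \<in> T \<omega>"
  unfolding T_def bl3_def by auto

lemma A_n: "A1 \<omega> \<subseteq> {1..n}" "A2 \<omega> \<subseteq> {1..n}" "T \<omega> \<subseteq> {1..n}"
  using A_S S_n by blast+

lemma A_disj: "A1 \<omega> \<inter> A2 \<omega> = {}" "A1 \<omega> \<inter> T \<omega> = {}" "A2 \<omega> \<inter> T \<omega> = {}"
  using A_S[of \<omega>] S_disj by blast+

lemma host_inst:
  assumes sel: "sel \<omega>" and X: "X \<subseteq> {1..n} - A1 \<omega> - A2 \<omega> - T \<omega>"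
  shows "host F u v Is Rs Ts ka kb N EG \<delta> (Gr \<omega>) M1 M2 K (\<lambda>s i. p1 s (s1 \<omega> s) i) (\<lambda>s i. p2 s (s2 \<omega> s) i)
    (\<lambda>\<psi> j t. p3 (s3 \<omega>) (\<psi>, j, t)) (A1 \<omega>) (A2 \<omega>) (T \<omega>) X"
proof unfold_locales
  have vG: "uverts (Gr \<omega>) = {1..n}" by (simp add: Gr_def)
  show "minimal_conf Is Rs Ts ka kb" "rich Rs N EG \<delta>" "0 < \<delta>" using min rich \<delta> .
  show "ugraph (Gr \<omega>)" unfolding ugraph_def Gr_def by auto
  show "A1 \<omega> = (\<lambda>(s, i). p1 s (s1 \<omega> s) i) ` ({..<M1} \<times> {..<N})" by (rule A1_image)
  show "A2 \<omega> = (\<lambda>(s, i). p2 s (s2 \<omega> s) i) ` ({..<M2} \<times> {..<N})" by (rule A2_image)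
  show "inj_on (\<lambda>(s, i). p1 s (s1 \<omega> s) i) ({..<M1} \<times> {..<N})" by (rule inj_c1)
  show "inj_on (\<lambda>(s, i). p2 s (s2 \<omega> s) i) ({..<M2} \<times> {..<N})" by (rule inj_c2)
  show "T \<omega> = (\<lambda>(\<psi>, j, t). p3 (s3 \<omega>) (\<psi>, j, t)) ` TI" unfolding T_def bl3_def by force
  show "inj_on (\<lambda>(\<psi>, j, t). p3 (s3 \<omega>) (\<psi>, j, t)) TI"
  proof (rule inj_onI)
    fix q q' assume q: "q \<in> TI" "q' \<in> TI"
      and eq: "(case q of (\<psi>, j, t) \<Rightarrow> p3 (s3 \<omega>) (\<psi>, j, t)) = (case q' of (\<psi>, j, t) \<Rightarrow> p3 (s3 \<omega>) (\<psi>, j, t))"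
    have "p3 (s3 \<omega>) q = p3 (s3 \<omega>) q'" using eq by (cases q; cases q') auto
    then show "q = q'"
      using inj_onD[OF inj3, of "(s3 \<omega>, q)" "(s3 \<omega>, q')"] pick_lt[of "ok3 \<omega>"] q unfolding s3_def by simp
  qed
  show "A1 \<omega> \<inter> A2 \<omega> = {}" "A1 \<omega> \<inter> T \<omega> = {}" "A2 \<omega> \<inter> T \<omega> = {}" by (rule A_disj)+
  show "A1 \<omega> \<subseteq> uverts (Gr \<omega>)" "A2 \<omega> \<subseteq> uverts (Gr \<omega>)" "T \<omega> \<subseteq> uverts (Gr \<omega>)" unfolding vG by (rule A_n)+
  show "X \<subseteq> uverts (Gr \<omega>) - A1 \<omega> - A2 \<omega> - T \<omega>" unfolding vG by (rule X)
  show "{p1 s (s1 \<omega> s) i, p1 s (s1 \<omega> s) i'} \<in> uedges (Gr \<omega>)"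
    if h: "s < M1" "i < N" "i' < N" "i \<noteq> i'" for s i i'
  proof -
    have lt: "s1 \<omega> s < L" unfolding s1_def by (rule pick_lt)
    have "ok1 \<omega> s (s1 \<omega> s)" unfolding s1_def by (rule pick_ok) (use sel h in \<open>auto simp: sel_def\<close>)
    moreover have ne: "p1 s (s1 \<omega> s) i \<noteq> p1 s (s1 \<omega> s) i'"
      using inj_onD[OF inj_c1[of \<omega>], of "(s, i)" "(s, i')"] h by auto
    moreover have "{p1 s (s1 \<omega> s) i, p1 s (s1 \<omega> s) i'} \<in> all_edges (bl1 s (s1 \<omega> s))"
      using ne h unfolding bl1_def by (intro all_edges_pair) auto
    ultimately show ?thesis
      using Gr_edge[OF ran1[OF h(1) lt h(2)] ran1[OF h(1) lt h(3)] ne] unfolding ok1_def by auto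
  qed
  show "{p2 s (s2 \<omega> s) i, p2 s (s2 \<omega> s) i'} \<in> uedges (Gr \<omega>)"
    if h: "s < M2" "i < N" "i' < N" "i \<noteq> i'" for s i i'
  proof -
    have lt: "s2 \<omega> s < L" unfolding s2_def by (rule pick_lt)
    have "ok2 \<omega> s (s2 \<omega> s)" unfolding s2_def by (rule pick_ok) (use sel h in \<open>auto simp: sel_def\<close>)
    moreover have ne: "p2 s (s2 \<omega> s) i \<noteq> p2 s (s2 \<omega> s) i'"
      using inj_onD[OF inj_c2[of \<omega>], of "(s, i)" "(s, i')"] h by auto
    moreover have "{p2 s (s2 \<omega> s) i, p2 s (s2 \<omega> s) i'} \<in> all_edges (bl2 s (s2 \<omega> s))"
      using ne h unfolding bl2_def by (intro all_edges_pair) auto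
    ultimately show ?thesis
      using Gr_edge[OF ran2[OF h(1) lt h(2)] ran2[OF h(1) lt h(3)] ne] unfolding ok2_def by auto
  qed
  show "{p3 (s3 \<omega>) (\<psi>, j, t), p3 (s3 \<omega>) (\<psi>, j, t')} \<in> uedges (Gr \<omega>)"
    if h: "\<psi> \<in> EE" "j < K" "t \<in> Ts" "t' \<in> Ts" "t \<noteq> t'" for \<psi> j t t'
  proof -
    have lt: "s3 \<omega> < L" unfolding s3_def by (rule pick_lt)
    have "ok3 \<omega> (s3 \<omega>)" unfolding s3_def by (rule pick_ok) (use sel in \<open>auto simp: sel_def\<close>)
    moreover have q: "(\<psi>, j, t) \<in> TI" "(\<psi>, j, t') \<in> TI" using h by auto
    moreover have ne: "p3 (s3 \<omega>) (\<psi>, j, t) \<noteq> p3 (s3 \<omega>) (\<psi>, j, t')"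
      using inj_onD[OF inj3, of "(s3 \<omega>, \<psi>, j, t)" "(s3 \<omega>, \<psi>, j, t')"] lt h by auto
    moreover have "{p3 (s3 \<omega>) (\<psi>, j, t), p3 (s3 \<omega>) (\<psi>, j, t')} \<in> all_edges (bl3 (s3 \<omega>))"
      using ne q unfolding bl3_def by (intro all_edges_pair imageI) auto
    ultimately show ?thesis
      using Gr_edge[OF ran3[OF lt q(1)] ran3[OF lt q(2)] ne] unfolding ok3_def by auto
  qed
  show "{x, y} \<in> uedges (Gr \<omega>)" if xy: "x \<in> A2 \<omega>" "y \<in> T \<omega>" for x y
  proof -
    obtain g where g: "g < M2" "x \<in> bl2 g (s2 \<omega> g)" using xy(1) unfolding A2_def by auto
    have "ok2 \<omega> g (s2 \<omega> g)" unfolding s2_def by (rule pick_ok) (use sel g in \<open>auto simp: sel_def\<close>)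
    then have "\<omega> {x, y}" using g xy(2) unfolding ok2_def by auto
    moreover have "x \<noteq> y" using A_disj(3)[of \<omega>] xy by auto
    moreover have "x \<in> {1..n}" "y \<in> {1..n}" using A_n[of \<omega>] xy by blast+
    ultimately show ?thesis using Gr_edge by blast
  qed
qed

text \<open>The weights in the hypotheses are the costs of exceptional vertices. A vertex of
  \<open>X\<close> costs up to \<open>m2\<close> edges to \<open>A2\<close> and up to
  \<open>2 * n0\<close> pairs with reservoir vertices; a vertex of high degree costs up to
  \<open>m1\<close> edges to \<open>A1\<close>. Each kind then totals at most
  \<open>n\<close>.\<close>

lemma sat_le_of_good:
  fixes d d' d2 \<eta> m1 m2 n0 :: real
  defines "m1 \<equiv> real (M1 * N)" and "m2 \<equiv> real (M2 * N)" and "n0 \<equiv> real (card SS)"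
  assumes sel: "sel \<omega>" and d': "0 \<le> d'"
    and low: "real (card {y \<in> {1..n}. y \<notin> A1 \<omega> \<and> real (dg \<omega> (A1 \<omega>) y) \<le> d}) * (2 * n0 + m2) \<le> n"
    and high: "real (card {y \<in> {1..n}. y \<notin> A1 \<omega> \<and> d' \<le> real (dg \<omega> (A1 \<omega>) y)}) * m1 \<le> n"
    and cod: "real (card {(x, y) \<in> {1..n} \<times> {1..n}. x \<noteq> y \<and> x \<notin> A1 \<omega> \<and> y \<notin> A1 \<omega> \<and>
      d < real (dg \<omega> (A1 \<omega>) x) \<and> real (cdg \<omega> (A1 \<omega>) x y) \<le> \<delta> * m1}) \<le> n"
    and low2: "\<forall>y\<in>{1..n} - SS. d2 < real (dg \<omega> (A2 \<omega>) y)"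
    and cod2: "\<forall>x\<in>{1..n} - SS. \<forall>y\<in>{1..n} - SS. x \<noteq> y \<longrightarrow>
      \<not> (d2 < real (dg \<omega> (A2 \<omega>) x) \<and> real (cdg \<omega> (A2 \<omega>) x y) \<le> \<delta> * m2)"
    and bad: "real (card {y \<in> {1..n} - SS. \<not> gd \<omega> y}) \<le> \<eta> * n"
  shows "real (sat (Gr \<omega>) F) \<le> m1 * m1 + n * d' + 4 * n + card TI * real n + m2 * m2 + m2 * (\<eta> * n + n0)
    + m2 * (M2 * card EE * K * card V) + n * (\<delta> * m2)"
proof -
  define Ou where "Ou = {1..n} - A1 \<omega> - A2 \<omega> - T \<omega>"
  define X where "X = {y \<in> Ou. real (dg \<omega> (A1 \<omega>) y) \<le> d}"
  interpret H: host F u v Is Rs Ts ka kb N EG \<delta> "Gr \<omega>" M1 M2 K "\<lambda>s i. p1 s (s1 \<omega> s) i"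
    "\<lambda>s i. p2 s (s2 \<omega> s) i" "\<lambda>\<psi> j t. p3 (s3 \<omega>) (\<psi>, j, t)" "A1 \<omega>" "A2 \<omega>" "T \<omega>" X
    by (rule host_inst[OF sel]) (auto simp: X_def Ou_def)
  have vG: "uverts (Gr \<omega>) = {1..n}" by (simp add: Gr_def)
  have Ou: "H.Ou = Ou" unfolding H.Ou_def Ou_def vG ..
  have B: "H.B = Ou - X" unfolding H.B_def Ou ..
  have Oun: "y \<in> {1..n} \<and> y \<notin> A1 \<omega> \<and> y \<notin> A2 \<omega> \<and> y \<notin> T \<omega>" if "y \<in> Ou" for y using that unfolding Ou_def
      by auto
  have finG: "finite ({1..n} :: nat set)" by simp
  have fin: "finite Ou" "finite X" "finite SS"
    unfolding Ou_def X_def using S_n(4) finite_subset by auto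
  have codeg: "H.codeg A x y = cdg \<omega> A x y" if "x \<in> {1..n} - A" "y \<in> {1..n} - A" "A \<subseteq> {1..n}" for A x y
  proof -
    have "{z \<in> A. {x, z} \<in> uedges (Gr \<omega>) \<and> {y, z} \<in> uedges (Gr \<omega>)} = {z \<in> A. \<omega> {x, z} \<and> \<omega> {y, z}}"
      using Gr_edge[of x _ \<omega>] Gr_edge[of y _ \<omega>] that by blast
    then show ?thesis unfolding H.codeg_def cdg_def by simp
  qed
  have good: "H.good y = gd \<omega> y" if "y \<in> Ou" for y
  proof -
    have "{y, p3 (s3 \<omega>) (\<psi>, j, t)} \<in> uedges (Gr \<omega>) \<longleftrightarrow> \<omega> {y, p3 (s3 \<omega>) (\<psi>, j, t)}"
      if "\<psi> \<in> EE" "j < K" "t \<in> Ts" for \<psi> j t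
      using Gr_edge[of y "p3 (s3 \<omega>) (\<psi>, j, t)" \<omega>] Oun[OF \<open>y \<in> Ou\<close>] p3_T[OF that, of \<omega>] A_n(3)[of \<omega>] by blast
    then show ?thesis unfolding H.good_def gd_def by blast
  qed
  have cA: "card (A1 \<omega>) = M1 * N" "card (A2 \<omega>) = M2 * N" by (rule card_A)+

  have t1: "real (card {e \<in> uedges (Gr \<omega>). e \<inter> A1 \<omega> \<noteq> {}}) \<le> m1 * m1 + (n * d' + n)"
  proof -
    define R where "R = {1..n} - A1 \<omega>"
    define nb where "nb y = {z \<in> A1 \<omega>. \<omega> {y, z}}" for y
    have finR: "finite R" "finite (nb y)" for y unfolding R_def nb_def using finA by auto
    have "{e \<in> uedges (Gr \<omega>). e \<inter> A1 \<omega> \<noteq> {}} \<subseteq> (\<lambda>(x, y). {x, y}) ` (A1 \<omega> \<times> A1 \<omega> \<union> Sigma R nb)"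
    proof
      fix e assume "e \<in> {e \<in> uedges (Gr \<omega>). e \<inter> A1 \<omega> \<noteq> {}}"
      then have e: "e \<in> EV" "\<omega> e" "e \<inter> A1 \<omega> \<noteq> {}" unfolding Gr_def by auto
      have "e \<subseteq> {1..n}" "card e = 2" using e(1) unfolding all_edges_def by auto
      then obtain x y where xy: "e = {x, y}" "x \<in> {1..n}" "y \<in> {1..n}"
        by (metis card_2_iff insert_subset)
      have *: "e \<in> (\<lambda>(x, y). {x, y}) ` (A1 \<omega> \<times> A1 \<omega> \<union> Sigma R nb)"
        if "e = {p, q}" "q \<in> A1 \<omega>" "p \<in> {1..n}" for p q
      proof (cases "p \<in> A1 \<omega>")
        case True
        then show ?thesis using that by force
      next
        case False
        then have "(p, q) \<in> Sigma R nb" unfolding R_def nb_def using that e by auto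
        then show ?thesis using that by force
      qed
      show "e \<in> (\<lambda>(x, y). {x, y}) ` (A1 \<omega> \<times> A1 \<omega> \<union> Sigma R nb)"
      proof (cases "y \<in> A1 \<omega>")
        case True
        then show ?thesis using *[of x y] xy by simp
      next
        case False
        then have "x \<in> A1 \<omega>" using e(3) xy(1) by auto
        then show ?thesis using *[of y x] xy by (simp add: insert_commute)
      qed
    qed
    then have "card {e \<in> uedges (Gr \<omega>). e \<inter> A1 \<omega> \<noteq> {}} \<le> card (A1 \<omega> \<times> A1 \<omega> \<union> Sigma R nb)"
      using finR finA by (intro surj_card_le) auto
    also have "\<dots> \<le> card (A1 \<omega> \<times> A1 \<omega>) + card (Sigma R nb)" by (rule card_Un_le)
    also have "card (Sigma R nb) = (\<Sum>y\<in>R. card (nb y))" using finR by (intro card_SigmaI) auto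
    finally have le: "real (card {e \<in> uedges (Gr \<omega>). e \<inter> A1 \<omega> \<noteq> {}}) \<le> m1 * m1 + (\<Sum>y\<in>R. real (card (nb y)))"
      using cA(1) unfolding m1_def by (simp add: card_cartesian_product flip: of_nat_mult of_nat_add
          of_nat_sum)
    \<comment> \<open>Degrees below \<open>d'\<close> are charged \<open>d'\<close>; the exceptional
      ones are charged the trivial bound \<open>m1\<close> in addition.\<close>
    have "(\<Sum>y\<in>R. real (card (nb y))) \<le> (\<Sum>y\<in>R. d' + (if d' \<le> real (dg \<omega> (A1 \<omega>) y) then m1 else 0))"
    proof (rule sum_mono)
      fix y
      have "card (nb y) \<le> M1 * N" using card_mono[OF finA(1), of "nb y" \<omega>] cA(1) unfolding nb_def by auto
      then have "real (card (nb y)) \<le> m1" unfolding m1_def by (simp only: of_nat_le_iff)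
      moreover have "real (card (nb y)) = real (dg \<omega> (A1 \<omega>) y)" unfolding nb_def dg_def ..
      ultimately show "real (card (nb y)) \<le> d' + (if d' \<le> real (dg \<omega> (A1 \<omega>) y) then m1 else 0)" using d'
          by auto
    qed
    also have "\<dots> = card R * d' + m1 * card {y \<in> R. d' \<le> real (dg \<omega> (A1 \<omega>) y)}"
      using finR by (simp add: sum.distrib sum.If_cases Int_def)
    also have "\<dots> \<le> n * d' + n"
    proof (rule add_mono)
      have "card R \<le> card ({1..n} :: nat set)" unfolding R_def by (intro card_mono) auto
      then show "real (card R) * d' \<le> real n * d'" using d' by (intro mult_right_mono) auto
      have "{y \<in> R. d' \<le> real (dg \<omega> (A1 \<omega>) y)} = {y \<in> {1..n}. y \<notin> A1 \<omega> \<and> d' \<le> real (dg \<omega> (A1 \<omega>) y)}"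
        unfolding R_def by auto
      then show "m1 * real (card {y \<in> R. d' \<le> real (dg \<omega> (A1 \<omega>) y)}) \<le> real n"
        using high by (simp add: mult.commute)
    qed
    finally show ?thesis using le by linarith
  qed
  have cX: "real (card X) * (2 * n0 + m2) \<le> n"
  proof -
    have "card X \<le> card {y \<in> {1..n}. y \<notin> A1 \<omega> \<and> real (dg \<omega> (A1 \<omega>) y) \<le> d}"
      unfolding X_def using Oun by (intro card_mono) auto
    then have "real (card X) * (2 * n0 + m2)
        \<le> real (card {y \<in> {1..n}. y \<notin> A1 \<omega> \<and> real (dg \<omega> (A1 \<omega>) y) \<le> d}) * (2 * n0 + m2)"
      unfolding n0_def m2_def by (intro mult_right_mono) auto
    then show ?thesis using low by linarith
  qed
  have t5: "real (card {y \<in> H.B. \<not> H.good y}) \<le> \<eta> * n + n0"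
  proof -
    \<comment> \<open>Reservoir vertices are counted as bad wholesale, since goodness is controlled
      only outside \<open>SS\<close>.\<close>
    have "{y \<in> H.B. \<not> H.good y} \<subseteq> {y \<in> {1..n} - SS. \<not> gd \<omega> y} \<union> SS"
      unfolding B using good Oun by blast
    then have "card {y \<in> H.B. \<not> H.good y} \<le> card ({y \<in> {1..n} - SS. \<not> gd \<omega> y} \<union> SS)"
      using fin by (intro card_mono) auto
    also have "\<dots> \<le> card {y \<in> {1..n} - SS. \<not> gd \<omega> y} + card SS" by (rule card_Un_le)
    finally show ?thesis using bad unfolding n0_def by linarith
  qed
  have t8: "real (card {(x, y). x \<in> H.B \<and> y \<in> H.Ou \<and> x \<noteq> y \<and>
      H.codeg (A1 \<omega>) x y < \<delta> * (real M1 * real N)}) \<le> n"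
  proof -
    let ?C = "{(x, y) \<in> {1..n} \<times> {1..n}. x \<noteq> y \<and> x \<notin> A1 \<omega> \<and> y \<notin> A1 \<omega> \<and>
      d < real (dg \<omega> (A1 \<omega>) x) \<and> real (cdg \<omega> (A1 \<omega>) x y) \<le> \<delta> * m1}"
    have "{(x, y). x \<in> H.B \<and> y \<in> H.Ou \<and> x \<noteq> y \<and> H.codeg (A1 \<omega>) x y < \<delta> * (real M1 * real N)} \<subseteq> ?C"
    proof
      fix q assume "q \<in> {(x, y). x \<in> H.B \<and> y \<in> H.Ou \<and> x \<noteq> y \<and> H.codeg (A1 \<omega>) x y < \<delta> * (real M1 * real N)}"
      then obtain x y where q: "q = (x, y)" and h: "x \<in> H.B" "y \<in> H.Ou" "x \<noteq> y"
          "H.codeg (A1 \<omega>) x y < \<delta> * (real M1 * real N)"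
        by auto
      have "x \<in> Ou - X" "y \<in> Ou" using h unfolding B Ou by auto
      then have xy: "x \<in> Ou" "y \<in> Ou" "d < real (dg \<omega> (A1 \<omega>) x)" unfolding X_def by auto
      have "H.codeg (A1 \<omega>) x y = cdg \<omega> (A1 \<omega>) x y" using codeg[of x "A1 \<omega>" y] Oun xy A_n(1)[of \<omega>] by blast
      then show "q \<in> ?C"
        unfolding q using h xy Oun[OF xy(1)] Oun[OF xy(2)] unfolding m1_def by simp
    qed
    then have "card {(x, y). x \<in> H.B \<and> y \<in> H.Ou \<and> x \<noteq> y \<and> H.codeg (A1 \<omega>) x y < \<delta> * (real M1 * real N)}
        \<le> card ?C"
      by (intro card_mono) (auto intro: finite_subset[of _ "{1..n} \<times> {1..n}"])
    then show ?thesis using cod by linarith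
  qed
  have t9: "real (card {(x, y). x \<in> X \<and> y \<in> X \<and> x \<noteq> y \<and> H.codeg (A2 \<omega>) x y < \<delta> * (real M2 * real N)})
      \<le> 2 * n0 * card X"
  proof -
    \<comment> \<open>Outside the reservoirs no pair has a small common degree in \<open>A2\<close>,
      by \<open>low2\<close> and \<open>cod2\<close>; the remaining pairs have an end in
      \<open>SS\<close>.\<close>
    have "{(x, y). x \<in> X \<and> y \<in> X \<and> x \<noteq> y \<and> H.codeg (A2 \<omega>) x y < \<delta> * (real M2 * real N)} \<subseteq> SS \<times> X \<union> X \<times> SS"
    proof
      fix q assume "q \<in> {(x, y). x \<in> X \<and> y \<in> X \<and> x \<noteq> y \<and> H.codeg (A2 \<omega>) x y < \<delta> * (real M2 * real N)}"
      then obtain x y where q: "q = (x, y)" and h: "x \<in> X" "y \<in> X" "x \<noteq> y"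
          "H.codeg (A2 \<omega>) x y < \<delta> * (real M2 * real N)"
        by auto
      show "q \<in> SS \<times> X \<union> X \<times> SS"
      proof (rule ccontr)
        assume "q \<notin> SS \<times> X \<union> X \<times> SS"
        then have s: "x \<notin> SS" "y \<notin> SS" using h q by auto
        have xy: "x \<in> Ou" "y \<in> Ou" using h unfolding X_def by auto
        have "H.codeg (A2 \<omega>) x y = cdg \<omega> (A2 \<omega>) x y" using codeg[of x "A2 \<omega>" y] Oun xy A_n(2)[of \<omega>] by blast
        then have "real (cdg \<omega> (A2 \<omega>) x y) \<le> \<delta> * m2" using h(4) unfolding m2_def by simp
        then show False using cod2 low2 s Oun[OF xy(1)] Oun[OF xy(2)] h(3) by auto
      qed
    qed
    then have "card {(x, y). x \<in> X \<and> y \<in> X \<and> x \<noteq> y \<and> H.codeg (A2 \<omega>) x y < \<delta> * (real M2 * real N)}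
        \<le> card (SS \<times> X \<union> X \<times> SS)"
      using fin by (intro card_mono) auto
    also have "\<dots> \<le> card (SS \<times> X) + card (X \<times> SS)" by (rule card_Un_le)
    also have "\<dots> = 2 * card SS * card X" by (simp add: card_cartesian_product)
    finally have "card {(x, y). x \<in> X \<and> y \<in> X \<and> x \<noteq> y \<and> H.codeg (A2 \<omega>) x y < \<delta> * (real M2 * real N)}
      \<le> 2 * card SS * card X" .
    then show ?thesis using of_nat_mono[of _ "2 * card SS * card X", where ?'a = real] unfolding n0_def
        by simp
  qed
  have "real (sat (Gr \<omega>) F) \<le> real (card {e \<in> uedges (Gr \<omega>). e \<inter> A1 \<omega> \<noteq> {}})
    + real (card (T \<omega>)) * n + m2 * m2 + m2 * card X
    + m2 * card {y \<in> H.B. \<not> H.good y} + m2 * (M2 * card EE * K * card V)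
    + n * (\<delta> * m2)
    + card {(x, y). x \<in> H.B \<and> y \<in> H.Ou \<and> x \<noteq> y \<and> H.codeg (A1 \<omega>) x y < \<delta> * (real M1 * real N)}
    + card {(x, y). x \<in> X \<and> y \<in> X \<and> x \<noteq> y \<and> H.codeg (A2 \<omega>) x y < \<delta> * (real M2 * real N)}"
    using H.sat_bound[OF pos(1,2)] unfolding vG cA(2) m2_def by simp
  moreover have "m2 * card {y \<in> H.B. \<not> H.good y} \<le> m2 * (\<eta> * n + n0)"
    using t5 unfolding m2_def by (intro mult_left_mono) auto
  moreover have "m2 * card X + 2 * n0 * card X \<le> n" using cX by (simp add: algebra_simps)
  moreover have "real (card (T \<omega>)) * real n = real (card TI) * real n" using card_T[of \<omega>] by simp
  \<comment> \<open>Up to \<open>n\<close> is contributed by each of three sources: the vertices of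
    high degree, the set \<open>X\<close>, and the pairs of small common degree in
    \<open>A1\<close>. So \<open>4 * n\<close> leaves room.\<close>
  moreover have "real (4 * n) = 4 * real n" by simp
  ultimately show ?thesis using t1 t8 t9 by linarith
qed

text \<open>The summands bound the probabilities of the events \<open>B1\<close> to
  \<open>B7\<close> below, in this order. All but the last will tend to \<open>0\<close>; the last
  is a constant governed by \<open>K\<close>.\<close>

definition pfail :: "real \<Rightarrow> real \<Rightarrow> real \<Rightarrow> real \<Rightarrow> real \<Rightarrow> real \<Rightarrow> real \<Rightarrow> real" where
  "pfail z1 z2 z3 d d' d2 \<eta> =
    (real M1 + real M2 + 1) * (1 - p ^ rq) ^ L
    + (2 * real ((M1 + M2) * L * N + L * card TI) + real (M2 * N)) * ((1 - p + p * z1) ^ (M1 * N) / z1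
        powr d)
    + real (M1 * N) * ((1 - p + p * z2) ^ (M1 * N) / z2 powr d')
    + real n * ((1 - p + p * z3) powr d / z3 powr (\<delta> * real (M1 * N)))
    + real n * ((1 - p / 2) ^ (M2 * N) * 2 powr d2)
    + real n * real n * ((1 - p / 2) powr d2 * 2 powr (\<delta> * real (M2 * N)))
    + real (card EE) * (1 - p ^ card Ts) ^ K / \<eta>"

theorem prob_sat_le:
  fixes z1 z2 z3 d d' d2 \<eta> n0 m1 m2 :: real
  assumes z: "0 < z1" "z1 \<le> 1" "1 \<le> z2" "0 < z3" "z3 \<le> 1" and d': "0 \<le> d'" and \<eta>: "0 < \<eta>" and n: "0 < n"
    and S: "real ((M1 + M2) * L * N + L * card TI) = n0" and m1: "real (M1 * N) = m1"
        and m2: "real (M2 * N) = m2"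
  shows "measure_pmf.prob (gnp n p) {G. real (sat G F)
      \<le> m1 * m1 + n * d' + 4 * n + card TI * real n + m2 * m2
      + m2 * (\<eta> * n + n0) + m2 * (M2 * card EE * K * card V) + n * (\<delta> * m2)}
    \<ge> 1 - pfail z1 z2 z3 d d' d2 \<eta>"
proof -
  have N: "0 < N" using rich unfolding rich_def by blast
  have m_pos: "0 < m1" "0 < m2" using m1 m2 pos N by auto
  have fs: "finite (set_pmf \<mu>)" using finite_set_coins[OF fin_EV] .
  have n0: "real (card SS) \<le> n0" using card_SS S by (metis of_nat_le_iff)
  have n00: "0 \<le> n0" using S by linarith
  define B1 where "B1 = {\<omega>. \<not> sel \<omega>}"
  define B2 where "B2 = {\<omega>. n / (2 * n0 + m2) \<le> real (card {y \<in> {1..n}. y \<notin> A1 \<omega> \<and> real (dg \<omega> (A1 \<omega>) y)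
      \<le> d})}"
  define B3 where "B3 = {\<omega>. n / m1 \<le> real (card {y \<in> {1..n}. y \<notin> A1 \<omega> \<and> d' \<le> real (dg \<omega> (A1 \<omega>) y)})}"
  define B4 where "B4 = {\<omega>. n \<le> real (card {q \<in> {q \<in> {1..n} \<times> {1..n}. fst q \<noteq> snd q}. fst q \<notin> A1 \<omega> \<and>
      snd q \<notin> A1 \<omega> \<and>
      d < real (dg \<omega> (A1 \<omega>) (fst q)) \<and> real (cdg \<omega> (A1 \<omega>) (fst q) (snd q)) \<le> \<delta> * m1})}"
  define B5 where "B5 = {\<omega>. \<exists>y\<in>{1..n} - SS. real (dg \<omega> (A2 \<omega>) y) \<le> d2}"
  define B6 where "B6 = {\<omega>. \<exists>q\<in>{q \<in> ({1..n} - SS) \<times> ({1..n} - SS). fst q \<noteq> snd q}.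
      d2 < real (dg \<omega> (A2 \<omega>) (fst q)) \<and> real (cdg \<omega> (A2 \<omega>) (fst q) (snd q)) \<le> \<delta> * m2}"
  define B7 where "B7 = {\<omega>. \<eta> * n \<le> real (card {y \<in> {1..n} - SS. \<not> gd \<omega> y})}"
  have P1: "measure_pmf.prob \<mu> B1 \<le> (real M1 + real M2 + 1) * (1 - p ^ rq) ^ L"
    unfolding B1_def by (rule prob_not_sel)
  \<comment> \<open>The Markov threshold is \<open>n\<close> divided by the cost of one vertex, so
    the number \<open>n\<close> of candidates cancels and only that cost remains as a
    factor.\<close>
  have P2: "measure_pmf.prob \<mu> B2 \<le> (2 * n0 + m2) * ((1 - p + p * z1) ^ (M1 * N) / z1 powr d)"
  proof -
    have "measure_pmf.prob \<mu> B2
        \<le> real (card {1..n}) * ((1 - p + p * z1) ^ (M1 * N) / z1 powr d) / (n / (2 * n0 + m2))"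
      unfolding B2_def
      by (rule prob_count_ge[OF fs]) (use prob_low z n n00 m_pos in auto)
    then show ?thesis using n by (simp add: mult.commute)
  qed
  have P3: "measure_pmf.prob \<mu> B3 \<le> m1 * ((1 - p + p * z2) ^ (M1 * N) / z2 powr d')"
  proof -
    have "measure_pmf.prob \<mu> B3
        \<le> real (card {1..n}) * ((1 - p + p * z2) ^ (M1 * N) / z2 powr d') / (n / m1)"
      unfolding B3_def
      by (rule prob_count_ge[OF fs]) (use prob_high z n m_pos in auto)
    then show ?thesis using n by (simp add: mult.commute)
  qed
  have P4: "measure_pmf.prob \<mu> B4 \<le> n * ((1 - p + p * z3) powr d / z3 powr (\<delta> * m1))"
  proof -
    let ?A = "{q \<in> {1..n} \<times> {1..n}. fst q \<noteq> snd q}"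
    let ?c = "(1 - p + p * z3) powr d / z3 powr (\<delta> * m1)"
    have "measure_pmf.prob \<mu> B4 \<le> real (card ?A) * ?c / n"
      unfolding B4_def
      by (rule prob_count_ge[OF fs]) (use prob_codeg1 z n in auto)
    also have "\<dots> \<le> real (n * n) * ?c / n"
    proof (intro divide_right_mono mult_right_mono)
      have "card ?A \<le> card ({1..n} \<times> {1..n})" by (intro card_mono) auto
      then have "card ?A \<le> n * n" by (simp add: card_cartesian_product)
      then show "real (card ?A) \<le> real (n * n)" by (rule of_nat_mono)
    qed auto
    also have "\<dots> = n * ?c" using n by simp
    finally show ?thesis .
  qed
  \<comment> \<open>For \<open>A2\<close> the base \<open>1 / 2\<close> suffices in both tails,
    because the size of \<open>A2\<close> may be increased by any constant factor.\<close>
  have half: "1 - p + p * (1 / 2) = 1 - p / 2" by simp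
  have half2: "x / (1 / 2) powr y = x * 2 powr y" for x y :: real
    by (simp add: powr_divide)
  have P5: "measure_pmf.prob \<mu> B5 \<le> n * ((1 - p / 2) ^ (M2 * N) * 2 powr d2)"
  proof -
    have "measure_pmf.prob \<mu> B5 \<le> real (card ({1..n} - SS)) * ((1 - p / 2) ^ (M2 * N) * 2 powr d2)"
      unfolding B5_def
    proof (rule prob_exists_le)
      fix y assume "y \<in> {1..n} - SS"
      then show "measure_pmf.prob \<mu> {\<omega>. real (dg \<omega> (A2 \<omega>) y) \<le> d2} \<le> (1 - p / 2) ^ (M2 * N) * 2 powr d2"
        using prob_low2[of y "1 / 2" d2] unfolding half half2 by simp
    qed simp
    also have "\<dots> \<le> n * ((1 - p / 2) ^ (M2 * N) * 2 powr d2)"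
    proof (rule mult_right_mono)
      have "card ({1..n} - SS) \<le> card ({1..n} :: nat set)" by (intro card_mono) auto
      then show "real (card ({1..n} - SS)) \<le> real n" by simp
      show "0 \<le> (1 - p / 2) ^ (M2 * N) * 2 powr d2" using p by simp
    qed
    finally show ?thesis .
  qed
  \<comment> \<open>A plain union bound over all pairs; the constant \<open>C\<close> will be taken
    large enough to beat \<open>n * n\<close>. For \<open>A1\<close> this is out of reach, hence the
    count in \<open>B4\<close>.\<close>
  have P6: "measure_pmf.prob \<mu> B6 \<le> real n * real n * ((1 - p / 2) powr d2 * 2 powr (\<delta> * m2))"
  proof -
    let ?A = "{q \<in> ({1..n} - SS) \<times> ({1..n} - SS). fst q \<noteq> snd q}"
    let ?c = "(1 - p / 2) powr d2 * 2 powr (\<delta> * m2)"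
    have "measure_pmf.prob \<mu> B6 \<le> real (card ?A) * ?c"
      unfolding B6_def
    proof (rule prob_exists_le)
      fix q assume q: "q \<in> ?A"
      show "measure_pmf.prob \<mu> {\<omega>. d2 < real (dg \<omega> (A2 \<omega>) (fst q)) \<and> real (cdg \<omega> (A2 \<omega>) (fst q) (snd q))
          \<le> \<delta> * m2} \<le> ?c"
        using prob_codeg2[of "fst q" "snd q" "1 / 2" d2 "\<delta> * m2"] q unfolding half half2 by auto
    qed simp
    also have "\<dots> \<le> real (n * n) * ?c"
    proof (rule mult_right_mono)
      have "card ?A \<le> card ({1..n} \<times> {1..n} :: (nat \<times> nat) set)" by (intro card_mono) auto
      then have "card ?A \<le> n * n" by (simp add: card_cartesian_product)
      then show "real (card ?A) \<le> real (n * n)" by (rule of_nat_mono)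
    qed simp
    finally show ?thesis by simp
  qed
  have P7: "measure_pmf.prob \<mu> B7 \<le> real (card EE) * (1 - p ^ card Ts) ^ K / \<eta>"
  proof -
    let ?c = "real (card EE) * (1 - p ^ card Ts) ^ K"
    have c: "0 \<le> ?c" using p by (simp add: power_le_one)
    have "measure_pmf.prob \<mu> B7 \<le> real (card ({1..n} - SS)) * ?c / (\<eta> * n)"
      unfolding B7_def
      by (rule prob_count_ge[OF fs]) (use prob_not_gd \<eta> n in auto)
    also have "\<dots> \<le> real n * ?c / (\<eta> * n)"
    proof (intro divide_right_mono mult_right_mono c)
      have "card ({1..n} - SS) \<le> card ({1..n} :: nat set)" by (intro card_mono) auto
      then show "real (card ({1..n} - SS)) \<le> real n" by simp
    qed (use \<eta> in auto)
    also have "\<dots> = ?c / \<eta>" using n by simp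
    finally show ?thesis .
  qed
  let ?bound = "m1 * m1 + n * d' + 4 * n + card TI * real n + m2 * m2
      + m2 * (\<eta> * n + n0) + m2 * (M2 * card EE * K * card V) + n * (\<delta> * m2)"
  let ?U = "B1 \<union> (B2 \<union> (B3 \<union> (B4 \<union> (B5 \<union> (B6 \<union> B7)))))"
  have ok: "real (sat (Gr \<omega>) F) \<le> ?bound" if "\<omega> \<notin> ?U" for \<omega>
  proof -
    have sel: "sel \<omega>" using that unfolding B1_def by auto
    have "real (card {y \<in> {1..n}. y \<notin> A1 \<omega> \<and> real (dg \<omega> (A1 \<omega>) y) \<le> d}) < n / (2 * n0 + m2)"
      using that unfolding B2_def by auto
    then have "real (card {y \<in> {1..n}. y \<notin> A1 \<omega> \<and> real (dg \<omega> (A1 \<omega>) y) \<le> d}) * (2 * n0 + m2) \<le> n"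
      using n00 m_pos by (simp add: pos_less_divide_eq)
    then have low: "real (card {y \<in> {1..n}. y \<notin> A1 \<omega> \<and> real (dg \<omega> (A1 \<omega>) y)
        \<le> d}) * (2 * real (card SS) + real (M2 * N)) \<le> n"
      using n0 m2 by (smt (verit) mult_left_mono of_nat_0_le_iff)
    have "real (card {y \<in> {1..n}. y \<notin> A1 \<omega> \<and> d' \<le> real (dg \<omega> (A1 \<omega>) y)}) < n / m1"
      using that unfolding B3_def by auto
    then have high: "real (card {y \<in> {1..n}. y \<notin> A1 \<omega> \<and> d' \<le> real (dg \<omega> (A1 \<omega>) y)}) * real (M1 * N) \<le> n"
      using m_pos unfolding m1 by (simp add: pos_less_divide_eq)
    have eq: "{(x, y) \<in> {1..n} \<times> {1..n}. x \<noteq> y \<and> x \<notin> A1 \<omega> \<and> y \<notin> A1 \<omega> \<and>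
      d < real (dg \<omega> (A1 \<omega>) x) \<and> real (cdg \<omega> (A1 \<omega>) x y) \<le> \<delta> * real (M1 * N)}
      = {q \<in> {q \<in> {1..n} \<times> {1..n}. fst q \<noteq> snd q}. fst q \<notin> A1 \<omega> \<and> snd q \<notin> A1 \<omega> \<and>
      d < real (dg \<omega> (A1 \<omega>) (fst q)) \<and> real (cdg \<omega> (A1 \<omega>) (fst q) (snd q)) \<le> \<delta> * m1}"
      unfolding m1 by auto
    have cod: "real (card {(x, y) \<in> {1..n} \<times> {1..n}. x \<noteq> y \<and> x \<notin> A1 \<omega> \<and> y \<notin> A1 \<omega> \<and>
      d < real (dg \<omega> (A1 \<omega>) x) \<and> real (cdg \<omega> (A1 \<omega>) x y) \<le> \<delta> * real (M1 * N)}) \<le> n"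
      unfolding eq using that unfolding B4_def by auto
    have low2: "\<forall>y\<in>{1..n} - SS. d2 < real (dg \<omega> (A2 \<omega>) y)" proof -
      have "\<omega> \<notin> B5" using that by blast
      then show ?thesis unfolding B5_def by (simp add: not_le)
    qed
    have cod2: "\<forall>x\<in>{1..n} - SS. \<forall>y\<in>{1..n} - SS. x \<noteq> y \<longrightarrow>
      \<not> (d2 < real (dg \<omega> (A2 \<omega>) x) \<and> real (cdg \<omega> (A2 \<omega>) x y) \<le> \<delta> * real (M2 * N))"
      using that unfolding B6_def m2 by force
    have bad: "real (card {y \<in> {1..n} - SS. \<not> gd \<omega> y}) \<le> \<eta> * n" using that unfolding B7_def by auto
    have "m2 * real (card SS) \<le> m2 * n0" using n0 m_pos by (intro mult_left_mono) auto
    then show ?thesis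
      using sat_le_of_good[OF sel d' low high cod low2 cod2 bad] unfolding m1 m2
          by (simp add: algebra_simps)
  qed
  have "measure_pmf.prob \<mu> ?U \<le> measure_pmf.prob \<mu> B1 + (measure_pmf.prob \<mu> B2 + (measure_pmf.prob \<mu> B3 +
      (measure_pmf.prob \<mu> B4 + (measure_pmf.prob \<mu> B5 + (measure_pmf.prob \<mu> B6 + measure_pmf.prob \<mu> B7)))))"
    by (intro order_trans[OF measure_Un_le] add_left_mono measure_Un_le) auto
  also have "\<dots> \<le> pfail z1 z2 z3 d d' d2 \<eta>"
    using P1 P2 P3 P4 P5 P6 P7 unfolding pfail_def S m1 m2 by linarith
  finally have U: "measure_pmf.prob \<mu> ?U \<le> pfail z1 z2 z3 d d' d2 \<eta>" .
  have "1 - measure_pmf.prob \<mu> ?U = measure_pmf.prob \<mu> (- ?U)"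
    using measure_pmf.prob_compl[of ?U \<mu>] by (simp add: Compl_eq_Diff_UNIV)
  also have "\<dots> \<le> measure_pmf.prob \<mu> {\<omega>. real (sat (Gr \<omega>) F) \<le> ?bound}"
    using ok by (intro measure_pmf.finite_measure_mono) auto
  also have "\<dots> = measure_pmf.prob (gnp n p) {G. real (sat G F) \<le> ?bound}"
    unfolding gnp_def Gr_def by (simp add: vimage_def)
  finally show ?thesis using U by linarith
qed

end

subsection \<open>Asymptotics\<close>

lemma power_le_exp_ln:
  fixes x y :: real
  assumes "0 < x" "x \<le> 1" "y \<le> real k"
  shows "x ^ k \<le> exp (y * ln x)"
proof -
  have "x ^ k = exp (real k * ln x)" using assms(1) by (simp add: exp_of_nat_mult)
  moreover have "real k * ln x \<le> y * ln x" using assms by (intro mult_right_mono_neg) auto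
  ultimately show ?thesis by simp
qed

lemma power_le_exp_ln':
  fixes x y :: real
  assumes "1 \<le> x" "real k \<le> y"
  shows "x ^ k \<le> exp (y * ln x)"
proof -
  have "x ^ k = exp (real k * ln x)" using assms(1) by (simp add: exp_of_nat_mult)
  moreover have "real k * ln x \<le> y * ln x" using assms by (intro mult_right_mono) auto
  ultimately show ?thesis by simp
qed

text \<open>Here \<open>\<kappa> * l\<close> is \<open>ln n\<close>, so the strict inequalities
  compare exponential rates per unit of \<open>l\<close>. The mean degree into \<open>A1\<close> is
  about \<open>(1 + \<epsilon>) * l\<close>, and the thresholds \<open>1 + \<epsilon> / 2\<close>
  and the square of \<open>1 + \<epsilon>\<close> lie on either side of it.\<close>

lemma tail_parameters:
  fixes p \<epsilon> \<kappa> a :: real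
  assumes p: "0 < p" "p < 1" and \<epsilon>: "0 < \<epsilon>" and \<kappa>: "\<kappa> = - ln (1 - p)" and a: "a = (1 + \<epsilon>) / p"
  obtains z1 z2 z3 C \<delta> :: real
  where "0 < z1" "z1 \<le> 1" "1 \<le> z2" "0 < z3" "z3 \<le> 1" "0 < C" "0 < \<delta>" "\<delta> * C \<le> \<epsilon>"
    and "a * ln (1 - p + p * z1) < (1 + \<epsilon> / 2) * ln z1"
    and "a * ln (1 - p + p * z2) < (1 + \<epsilon>)\<^sup>2 * ln z2"
    and "\<kappa> + (1 + \<epsilon> / 2) * ln (1 - p + p * z3) - \<delta> * a * ln z3 < 0"
    and "\<kappa> + C * (ln (1 - p / 2) + p / 2 * ln 2) < 0"
    and "2 * \<kappa> + C * (p / 2 * ln (1 - p / 2) + \<delta> * ln 2) < 0"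
proof -
  have \<kappa>0: "0 < \<kappa>" using \<kappa> p by simp
  have a0: "0 < a" using a p \<epsilon> by simp
  have ap: "a * p = 1 + \<epsilon>" using a p by simp
  \<comment> \<open>The function vanishes at \<open>1\<close> with derivative
    \<open>1 + \<epsilon> - s\<close>. So a threshold below the mean is handled by a base slightly
    less than \<open>1\<close>, a threshold above it by a base slightly greater.\<close>
  define f where "f s z = a * ln (1 - p + p * z) - s * ln z" for s z :: real
  have f1: "f s 1 = 0" for s by (simp add: f_def)
  have D: "DERIV (f s) 1 :> a * p - s" for s
    unfolding f_def using p by (auto intro!: derivative_eq_intros)
  obtain d1 where d1: "0 < d1" "\<And>h. 0 < h \<Longrightarrow> h < d1 \<Longrightarrow> f (1 + \<epsilon> / 2) (1 - h) < 0"
    using DERIV_pos_inc_left[OF D[of "1 + \<epsilon> / 2"]] \<epsilon> unfolding ap f1 by auto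
  define h1 where "h1 = min (d1 / 2) (1 / 2)"
  have h1: "0 < h1" "h1 < d1" "h1 \<le> 1 / 2" using d1(1) unfolding h1_def by auto
  have "(1 + \<epsilon>) - (1 + \<epsilon>)\<^sup>2 = - (\<epsilon> + \<epsilon> * \<epsilon>)" by (simp add: power2_eq_square algebra_simps)
  also have "\<dots> < 0" using \<epsilon> by (simp only: neg_less_0_iff_less) (intro add_pos_pos mult_pos_pos)
  finally have "(1 + \<epsilon>) - (1 + \<epsilon>)\<^sup>2 < 0" .
  then obtain d2 where d2: "0 < d2" "\<And>h. 0 < h \<Longrightarrow> h < d2 \<Longrightarrow> f ((1 + \<epsilon>)\<^sup>2) (1 + h) < 0"
    using DERIV_neg_dec_right[OF D[of "(1 + \<epsilon>)\<^sup>2"]] unfolding ap f1 by auto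
  \<comment> \<open>As the base tends to \<open>0\<close> the rate becomes that of having no common
    neighbour at all, and the limit equals \<open>- \<kappa> * \<epsilon> / 2\<close>. This is where
    logarithms to base \<open>1 / (1 - p)\<close> come from.\<close>
  have "((\<lambda>z. \<kappa> + (1 + \<epsilon> / 2) * ln (1 - p + p * z)) \<longlongrightarrow> \<kappa> + (1 + \<epsilon> / 2) * ln (1 - p + p * 0)) (at_right 0)"
    using p by (intro tendsto_intros) auto
  moreover have "\<kappa> + (1 + \<epsilon> / 2) * ln (1 - p + p * 0) < 0" using mult_pos_pos[OF \<epsilon> \<kappa>0] unfolding \<kappa>
      by (simp add: algebra_simps)
  ultimately have "\<forall>\<^sub>F z in at_right 0. \<kappa> + (1 + \<epsilon> / 2) * ln (1 - p + p * z) < 0"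
    by (rule order_tendstoD)
  moreover have "\<forall>\<^sub>F z in at_right 0. z \<in> {0<..<(1::real)}"
    by (rule eventually_at_right_real) simp
  ultimately obtain z3 where z3: "\<kappa> + (1 + \<epsilon> / 2) * ln (1 - p + p * z3) < 0" "z3 \<in> {0<..<1}"
    using eventually_happens[OF eventually_conj] by fastforce
  \<comment> \<open>Decay rates per vertex of \<open>A2\<close>: \<open>c5\<close> is positive
    because \<open>ln (1 - p / 2)\<close> is at most \<open>- p / 2\<close> and
    \<open>ln 2 < 1\<close>; \<open>c6\<close> is half of the rate for common degrees, the other
    half being reserved for the loss \<open>\<delta> * ln 2\<close>.\<close>
  define c5 where "c5 = - (ln (1 - p / 2) + p / 2 * ln 2)"
  define c6 where "c6 = - (p / 4 * ln (1 - p / 2))"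
  have lp: "ln (1 - p / 2) \<le> - (p / 2)" using ln_add_one_self_le_self2[of "- (p / 2)"] p by simp
  have "ln (2::real) < 1" using ln_2_less_1 .
  then have "p / 2 * ln 2 < p / 2" using p by simp
  then have c5: "0 < c5" using lp unfolding c5_def by linarith
  have c6: "0 < c6" unfolding c6_def using lp p by (simp add: mult_less_0_iff)
  define C where "C = 1 + \<kappa> / c5 + 2 * \<kappa> / c6"
  have C: "0 < C" "\<kappa> < C * c5" "2 * \<kappa> < C * c6"
  proof -
    show "0 < C" unfolding C_def using \<kappa>0 c5 c6 by (simp add: add_pos_pos)
    show "\<kappa> < C * c5" unfolding C_def using \<kappa>0 c5 c6 by (simp add: field_simps add_pos_pos)
    show "2 * \<kappa> < C * c6" unfolding C_def using \<kappa>0 c5 c6 by (simp add: field_simps add_pos_pos)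
  qed
  \<comment> \<open>The density \<open>\<delta>\<close> comes last: it must be small relative to
    \<open>z3\<close> and \<open>C\<close>, and nothing chosen before depends on it.\<close>
  have "((\<lambda>\<delta>. \<kappa> + (1 + \<epsilon> / 2) * ln (1 - p + p * z3) - \<delta> * a * ln z3) \<longlongrightarrow>
      \<kappa> + (1 + \<epsilon> / 2) * ln (1 - p + p * z3) - 0 * a * ln z3) (at_right 0)"
    by (intro tendsto_intros)
  then have "\<forall>\<^sub>F \<delta> in at_right 0. \<kappa> + (1 + \<epsilon> / 2) * ln (1 - p + p * z3) - \<delta> * a * ln z3 < 0"
    using z3(1) by (intro order_tendstoD) auto
  moreover have "\<forall>\<^sub>F \<delta> in at_right 0. \<delta> \<in> {0<..<min (\<epsilon> / C) c6}"
    using \<epsilon> C(1) c6 by (intro eventually_at_right_real) auto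
  ultimately obtain \<delta> where \<delta>: "\<kappa> + (1 + \<epsilon> / 2) * ln (1 - p + p * z3) - \<delta> * a * ln z3 < 0"
      "\<delta> \<in> {0<..<min (\<epsilon> / C) c6}"
    using eventually_happens[OF eventually_conj] by fastforce
  have "\<delta> * ln 2 \<le> c6" using \<delta>(2) \<open>ln 2 < 1\<close>
      by (smt (verit) greaterThanLessThan_iff min_less_iff_conj mult_left_le)
  then have "p / 2 * ln (1 - p / 2) + \<delta> * ln 2 \<le> - c6" unfolding c6_def by (simp add: algebra_simps)
  then have "C * (p / 2 * ln (1 - p / 2) + \<delta> * ln 2) \<le> C * - c6" using C(1) by (intro mult_left_mono) auto
  then have last: "2 * \<kappa> + C * (p / 2 * ln (1 - p / 2) + \<delta> * ln 2) < 0" using C(3) by simp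
  have "\<delta> * C \<le> \<epsilon>" using \<delta>(2) C(1) by (simp add: field_simps)
  show ?thesis
  proof (rule that[of "1 - h1" "1 + d2 / 2" z3 C \<delta>])
    show "a * ln (1 - p + p * (1 - h1)) < (1 + \<epsilon> / 2) * ln (1 - h1)" using d1(2)[OF h1(1,2)]
        unfolding f_def by simp
    show "a * ln (1 - p + p * (1 + d2 / 2)) < (1 + \<epsilon>)\<^sup>2 * ln (1 + d2 / 2)"
      using d2(2)[of "d2 / 2"] d2(1) unfolding f_def by simp
    show "\<kappa> + C * (ln (1 - p / 2) + p / 2 * ln 2) < 0" using C(2) unfolding c5_def
        by (simp add: algebra_simps)
  qed (use h1 d2 z3 C \<delta> last \<open>\<delta> * C \<le> \<epsilon>\<close> in auto)
qed

text \<open>Stated for a real \<open>l\<close> with \<open>exp (\<kappa> * l)\<close> in place of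
  \<open>n\<close>, and uniformly over all integers in the rounding ranges, so that the rounded
  sizes can be inserted afterwards. Each of the six terms is a polynomial in \<open>l\<close> times
  a decaying exponential.\<close>

lemma tail_terms_small:
  fixes p \<epsilon> \<kappa> a C \<delta> z1 z2 z3 q \<gamma> t :: real and N :: nat
  assumes p: "0 < p" "p < 1" and \<epsilon>: "0 < \<epsilon>" and \<gamma>: "0 < \<gamma>" and \<kappa>: "0 < \<kappa>" and a: "0 < a" and C: "0 < C"
    and N: "0 < N" and q: "0 < q" "q < 1" and t: "0 \<le> t" and \<delta>: "0 < \<delta>"
    and z: "0 < z1" "z1 \<le> 1" "1 \<le> z2" "0 < z3" "z3 \<le> 1"
    and G1: "a * ln (1 - p + p * z1) < (1 + \<epsilon> / 2) * ln z1"
    and G2: "a * ln (1 - p + p * z2) < (1 + \<epsilon>)\<^sup>2 * ln z2"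
    and G3: "\<kappa> + (1 + \<epsilon> / 2) * ln (1 - p + p * z3) - \<delta> * a * ln z3 < 0"
    and G4: "\<kappa> + C * (ln (1 - p / 2) + p / 2 * ln 2) < 0"
    and G5: "2 * \<kappa> + C * (p / 2 * ln (1 - p / 2) + \<delta> * ln 2) < 0"
  shows "\<forall>\<^sub>F l in at_top. \<forall>M1 M2 L m1 m2 :: nat. a * l \<le> m1 \<and> m1 \<le> a * l + N \<and> C * l \<le> m2 \<and> m2 \<le> C * l + N \<and>
      M1 \<le> a * l + 1 \<and> M2 \<le> C * l + 1 \<and> l \<le> real L \<and> real L \<le> l + 1 \<longrightarrow>
    (real M1 + real M2 + 1) * (1 - q) ^ L
    + (2 * ((real M1 + real M2) * L * N + L * t) + real m2) * ((1 - p + p * z1) ^ m1 / z1 powr ((1 + \<epsilon> /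
        2) * l))
    + real m1 * ((1 - p + p * z2) ^ m1 / z2 powr ((1 + \<epsilon>)\<^sup>2 * l))
    + exp (\<kappa> * l) * ((1 - p + p * z3) powr ((1 + \<epsilon> / 2) * l) / z3 powr (\<delta> * real m1))
    + exp (\<kappa> * l) * ((1 - p / 2) ^ m2 * 2 powr (p / 2 * real m2))
    + exp (\<kappa> * l) * exp (\<kappa> * l) * ((1 - p / 2) powr (p / 2 * real m2) * 2 powr (\<delta> * real m2)) \<le> \<gamma>"
proof -
  define x1 x2 x3 where "x1 = 1 - p + p * z1" and "x2 = 1 - p + p * z2" and "x3 = 1 - p + p * z3"
  have x1: "0 < x1" "x1 \<le> 1" unfolding x1_def using p z by (auto simp: add_pos_pos mult_left_le)
  have x2: "1 \<le> x2" unfolding x2_def using p z by simp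
  have x3: "0 < x3" unfolding x3_def using p z by (auto simp: add_pos_pos)
  define g1 g2 g3 g4 g5 where "g1 = a * ln x1 - (1 + \<epsilon> / 2) * ln z1"
      and "g2 = a * ln x2 - (1 + \<epsilon>)\<^sup>2 * ln z2"
    and "g3 = \<kappa> + (1 + \<epsilon> / 2) * ln x3 - \<delta> * a * ln z3"
    and "g4 = \<kappa> + C * (ln (1 - p / 2) + p / 2 * ln 2)"
    and "g5 = 2 * \<kappa> + C * (p / 2 * ln (1 - p / 2) + \<delta> * ln 2)"
  have g: "g1 < 0" "g2 < 0" "g3 < 0" "g4 < 0" "g5 < 0"
    using G1 G2 G3 G4 G5 unfolding g1_def g2_def g3_def g4_def g5_def x1_def x2_def x3_def by auto
  define q' where "q' = ln (1 - q)"
  have q': "q' < 0" unfolding q'_def using q by simp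
  \<comment> \<open>The sizes are rounded up to multiples of \<open>N\<close>; \<open>c2\<close> and
    \<open>c3\<close> are the resulting bounded errors in the exponents.\<close>
  define c3 where "c3 = - (\<delta> * real N * ln z3)"
  define c2 where "c2 = real N * ln x2"
  define s where "s = \<gamma> / 6"
  have s: "0 < s" using \<gamma> s_def by simp
  define k where "k = real N"
  have k: "0 < k" using N k_def by simp
  have "\<forall>\<^sub>F l in at_top. (a * l + C * l + 3) * exp (l * q') \<le> s" using s q' by real_asymp
  moreover have "\<forall>\<^sub>F l in at_top. (2 * ((a * l + C * l + 2) * (l + 1) * k + (l + 1) * t) + (C * l + k)) *
      exp (g1 * l) \<le> s"
    using s g by real_asymp
  moreover have "\<forall>\<^sub>F l in at_top. (a * l + k) * exp (g2 * l + c2) \<le> s" using s g by real_asymp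
  moreover have "\<forall>\<^sub>F l in at_top. exp (g3 * l + c3) \<le> s" using s g by real_asymp
  moreover have "\<forall>\<^sub>F l in at_top. exp (g4 * l) \<le> s" using s g by real_asymp
  moreover have "\<forall>\<^sub>F l in at_top. exp (g5 * l) \<le> s" using s g by real_asymp
  moreover have "\<forall>\<^sub>F l in at_top. (0::real) \<le> l" by (rule eventually_ge_at_top)
  ultimately show ?thesis
  proof eventually_elim
    case (elim l)
    show ?case
    proof (intro allI impI, elim conjE)
      fix M1 M2 L m1 m2 :: nat
      assume H: "a * l \<le> m1" "m1 \<le> a * l + N" "C * l \<le> m2" "m2 \<le> C * l + N"
        "M1 \<le> a * l + 1" "M2 \<le> C * l + 1" "l \<le> L" "L \<le> l + 1"
      have l: "0 \<le> l" by fact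
      have sum: "real M1 + real M2 \<le> a * l + C * l + 2" using H by linarith
      have "(1 - q) ^ L \<le> exp (l * q')" unfolding q'_def using q H by (intro power_le_exp_ln) auto
      then have "(real M1 + real M2 + 1) * (1 - q) ^ L \<le> (a * l + C * l + 3) * exp (l * q')"
        using H q a C l by (intro mult_mono) auto
      then have T1: "(real M1 + real M2 + 1) * (1 - q) ^ L \<le> s" using elim(1) by linarith
      have "x1 ^ m1 \<le> exp (a * l * ln x1)" using x1 H by (intro power_le_exp_ln) auto
      then have "x1 ^ m1 / z1 powr ((1 + \<epsilon> / 2) * l) \<le> exp (a * l * ln x1) / z1 powr ((1 + \<epsilon> / 2) * l)"
        by (intro divide_right_mono) auto
      also have "\<dots> = exp (g1 * l)"
        using z unfolding g1_def powr_def by (simp add: exp_diff[symmetric] algebra_simps)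
      finally have b: "x1 ^ m1 / z1 powr ((1 + \<epsilon> / 2) * l) \<le> exp (g1 * l)" .
      have "(real M1 + real M2) * L * N + L * t \<le> (a * l + C * l + 2) * (l + 1) * k + (l + 1) * t"
        unfolding k_def using sum a C l t H(8) by (intro add_mono[OF mult_right_mono[OF mult_mono]
            mult_right_mono]) auto
      then have "2 * ((real M1 + real M2) * L * N + L * t) + real m2
          \<le> 2 * ((a * l + C * l + 2) * (l + 1) * k + (l + 1) * t) + (C * l + k)"
        unfolding k_def using H(4) by (intro add_mono[OF mult_left_mono]) auto
      then have "(2 * ((real M1 + real M2) * L * N + L * t) + real m2) * (x1 ^ m1 / z1 powr ((1 + \<epsilon> / 2)
          * l))
        \<le> (2 * ((a * l + C * l + 2) * (l + 1) * k + (l + 1) * t) + (C * l + k)) * exp (g1 * l)"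
        using b l a C k t x1 by (intro mult_mono) auto
      then have T2: "(2 * ((real M1 + real M2) * L * N + L * t) + real m2) * (x1 ^ m1 / z1 powr ((1 + \<epsilon> /
          2) * l)) \<le> s"
        using elim(2) by linarith
      have "x2 ^ m1 \<le> exp ((a * l + N) * ln x2)" using x2 H by (intro power_le_exp_ln') auto
      then have "x2 ^ m1 / z2 powr ((1 + \<epsilon>)\<^sup>2 * l) \<le> exp ((a * l + N) * ln x2) / z2 powr ((1 + \<epsilon>)\<^sup>2 * l)"
        by (intro divide_right_mono) auto
      also have "\<dots> = exp (g2 * l + c2)"
        using z unfolding g2_def c2_def powr_def by (simp add: exp_diff[symmetric] algebra_simps)
      finally have "real m1 * (x2 ^ m1 / z2 powr ((1 + \<epsilon>)\<^sup>2 * l)) \<le> (a * l + k) * exp (g2 * l + c2)"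
        using H x2 a l k unfolding k_def by (intro mult_mono) auto
      then have T3: "real m1 * (x2 ^ m1 / z2 powr ((1 + \<epsilon>)\<^sup>2 * l)) \<le> s" using elim(3) by linarith
      have "\<delta> * real m1 * (- ln z3) \<le> \<delta> * (a * l + N) * (- ln z3)"
        using H \<delta> z by (intro mult_right_mono mult_left_mono) auto
      then have "\<kappa> * l + (1 + \<epsilon> / 2) * l * ln x3 - \<delta> * real m1 * ln z3 \<le> g3 * l + c3"
        unfolding g3_def c3_def by (simp add: algebra_simps)
      moreover have "exp (\<kappa> * l) * (x3 powr ((1 + \<epsilon> / 2) * l) / z3 powr (\<delta> * real m1))
          = exp (\<kappa> * l + (1 + \<epsilon> / 2) * l * ln x3 - \<delta> * real m1 * ln z3)"
        using x3 z unfolding powr_def by (simp add: exp_diff exp_add)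
      ultimately have T4: "exp (\<kappa> * l) * (x3 powr ((1 + \<epsilon> / 2) * l) / z3 powr (\<delta> * real m1)) \<le> s"
        using elim(4) by (smt (verit) exp_le_cancel_iff)
      have "C * (ln (1 - p / 2) + p / 2 * ln 2) < 0" using g(4) \<kappa> unfolding g4_def by linarith
      then have "ln (1 - p / 2) + p / 2 * ln 2 \<le> 0" using C by (simp add: mult_less_0_iff)
      then have "real m2 * (ln (1 - p / 2) + p / 2 * ln 2) \<le> C * l * (ln (1 - p / 2) + p / 2 * ln 2)"
        using H by (intro mult_right_mono_neg) auto
      then have "\<kappa> * l + real m2 * (ln (1 - p / 2) + p / 2 * ln 2) \<le> g4 * l"
        unfolding g4_def by (simp add: algebra_simps)
      moreover have "(1 - p / 2) ^ m2 = exp (real m2 * ln (1 - p / 2))" using p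
          by (simp add: exp_of_nat_mult)
      then have "exp (\<kappa> * l) * ((1 - p / 2) ^ m2 * 2 powr (p / 2 * real m2))
          = exp (\<kappa> * l + real m2 * (ln (1 - p / 2) + p / 2 * ln 2))"
        unfolding powr_def by (simp add: exp_add[symmetric] algebra_simps)
      ultimately have T5: "exp (\<kappa> * l) * ((1 - p / 2) ^ m2 * 2 powr (p / 2 * real m2)) \<le> s"
        using elim(5) by (smt (verit) exp_le_cancel_iff)
      have "C * (p / 2 * ln (1 - p / 2) + \<delta> * ln 2) < 0" using g(5) \<kappa> unfolding g5_def by linarith
      then have "p / 2 * ln (1 - p / 2) + \<delta> * ln 2 \<le> 0" using C by (simp add: mult_less_0_iff)
      then have "real m2 * (p / 2 * ln (1 - p / 2) + \<delta> * ln 2)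
          \<le> C * l * (p / 2 * ln (1 - p / 2) + \<delta> * ln 2)"
        using H by (intro mult_right_mono_neg) auto
      then have "2 * \<kappa> * l + real m2 * (p / 2 * ln (1 - p / 2) + \<delta> * ln 2) \<le> g5 * l"
        unfolding g5_def by (simp add: algebra_simps)
      moreover have "exp (\<kappa> * l) * exp (\<kappa> * l) * ((1 - p / 2) powr (p / 2 * real m2) * 2 powr (\<delta> * real m2))
          = exp (2 * \<kappa> * l + real m2 * (p / 2 * ln (1 - p / 2) + \<delta> * ln 2))"
        using p unfolding powr_def by (simp add: exp_add[symmetric] algebra_simps)
      ultimately have T6: "exp (\<kappa> * l) * exp (\<kappa> * l) * ((1 - p / 2) powr (p / 2 * real m2) * 2 powr (\<delta> *
          real m2)) \<le> s"
        using elim(6) by (smt (verit) exp_le_cancel_iff)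
      show "(real M1 + real M2 + 1) * (1 - q) ^ L
        + (2 * ((real M1 + real M2) * L * N + L * t) + real m2) * ((1 - p + p * z1) ^ m1 / z1 powr ((1 +
            \<epsilon> / 2) * l))
        + real m1 * ((1 - p + p * z2) ^ m1 / z2 powr ((1 + \<epsilon>)\<^sup>2 * l))
        + exp (\<kappa> * l) * ((1 - p + p * z3) powr ((1 + \<epsilon> / 2) * l) / z3 powr (\<delta> * real m1))
        + exp (\<kappa> * l) * ((1 - p / 2) ^ m2 * 2 powr (p / 2 * real m2))
        + exp (\<kappa> * l) * exp (\<kappa> * l) * ((1 - p / 2) powr (p / 2 * real m2) * 2 powr (\<delta> * real m2)) \<le> \<gamma>"
        using T1 T2 T3 T4 T5 T6 unfolding x1_def x2_def x3_def s_def by linarith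
    qed
  qed
qed

text \<open>The six multiples of \<open>\<epsilon>\<close> arise as follows:
  \<open>(1 + \<epsilon>)\<^sup>2\<close> is at most \<open>1 + 3 * \<epsilon>\<close>, the terms
  with \<open>\<delta>\<close> and \<open>\<eta>\<close> give one each, and the polylogarithmic
  terms and the terms linear in \<open>n\<close> give one half each.\<close>

lemma edge_bound_asymptotic:
  fixes \<epsilon> \<kappa> a C \<delta> \<eta> t c :: real and N :: nat
  assumes \<epsilon>: "0 < \<epsilon>" "\<epsilon> \<le> 1" and \<kappa>: "0 < \<kappa>" and a: "0 < a" and C: "0 < C" and t: "0 \<le> t" and c: "0 \<le> c"
    and \<delta>: "0 < \<delta>" "\<delta> * C \<le> \<epsilon>" and \<eta>: "0 < \<eta>" "\<eta> * C \<le> \<epsilon>"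
  shows "\<forall>\<^sub>F l in at_top. \<forall>M1 M2 L m1 m2 :: nat. a * l \<le> m1 \<and> m1 \<le> a * l + N \<and> C * l \<le> m2 \<and> m2 \<le> C * l + N \<and>
      M1 \<le> a * l + 1 \<and> M2 \<le> C * l + 1 \<and> l \<le> real L \<and> real L \<le> l + 1 \<longrightarrow>
    (real M1 + real M2) * L * N + L * t \<le> exp (\<kappa> * l) \<and>
    real m1 * m1 + exp (\<kappa> * l) * ((1 + \<epsilon>)\<^sup>2 * l) + 4 * exp (\<kappa> * l) + t * exp (\<kappa> * l) + real m2 * m2
      + m2 * (\<eta> * exp (\<kappa> * l) + ((real M1 + real M2) * L * N + L * t)) + m2 * (M2 * c) + exp (\<kappa> * l) * (\<delta>
          * m2)
    \<le> (1 + 6 * \<epsilon>) * exp (\<kappa> * l) * l"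
proof -
  define k where "k = real N"
  define b where "b = (\<delta> + \<eta>) * k"
  define w where "w l = (a * l + C * l + 2) * (l + 1) * k + (l + 1) * t" for l
  have "\<forall>\<^sub>F l in at_top. (a * l + C * l + 2) * (l + 1) * k + (l + 1) * t \<le> exp (\<kappa> * l)"
    using \<kappa> by real_asymp
  then have "\<forall>\<^sub>F l in at_top. w l \<le> exp (\<kappa> * l)" unfolding w_def .
  moreover have "\<forall>\<^sub>F l in at_top. (a * l + k) * (a * l + k) + (C * l + k) * (C * l + k)
      + (C * l + k) * ((a * l + C * l + 2) * (l + 1) * k + (l + 1) * t) + (C * l + k) * ((C * l + 1) * c)
      \<le> \<epsilon> / 2 * exp (\<kappa> * l) * l"
    using \<kappa> \<epsilon> by real_asymp
  then have "\<forall>\<^sub>F l in at_top. (a * l + k) * (a * l + k) + (C * l + k) * (C * l + k)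
      + (C * l + k) * w l + (C * l + k) * ((C * l + 1) * c) \<le> \<epsilon> / 2 * exp (\<kappa> * l) * l" unfolding w_def .
  moreover have "\<forall>\<^sub>F l in at_top. 4 + t + b \<le> \<epsilon> / 2 * l" using \<epsilon> by real_asymp
  moreover have "\<forall>\<^sub>F l in at_top. (0::real) \<le> l" by (rule eventually_ge_at_top)
  ultimately show ?thesis
  proof eventually_elim
    case (elim l)
    show ?case
    proof (intro allI impI, elim conjE)
      fix M1 M2 L m1 m2 :: nat
      assume H: "a * l \<le> m1" "m1 \<le> a * l + N" "C * l \<le> m2" "m2 \<le> C * l + N"
        "M1 \<le> a * l + 1" "M2 \<le> C * l + 1" "l \<le> L" "L \<le> l + 1"
      have l: "0 \<le> l" by fact
      have sum: "real M1 + real M2 \<le> a * l + C * l + 2" using H by linarith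
      define e where "e = exp (\<kappa> * l)"
      have e: "0 < e" unfolding e_def by simp
      have k: "0 \<le> k" unfolding k_def by simp
      define n0 where "n0 = (real M1 + real M2) * L * N + L * t"
      have w: "n0 \<le> w l"
        unfolding k_def n0_def w_def using sum a C l t H(8)
        by (intro add_mono[OF mult_right_mono[OF mult_mono] mult_right_mono]) auto
      have n00: "0 \<le> n0" unfolding n0_def using t by simp
      have m1: "m1 \<le> a * l + k" and m2: "m2 \<le> C * l + k" using H unfolding k_def by auto
      have "real m1 * m1 \<le> (a * l + k) * (a * l + k)" using m1 by (intro mult_mono) auto
      moreover have "real m2 * m2 \<le> (C * l + k) * (C * l + k)" using m2 by (intro mult_mono) auto
      moreover have "m2 * n0 \<le> (C * l + k) * w l" using m2 w n00 C l k by (intro mult_mono) auto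
      moreover have "m2 * (M2 * c) \<le> (C * l + k) * ((C * l + 1) * c)" using m2 H c C l k
          by (intro mult_mono) auto
      moreover have "m2 * (\<eta> * e) + e * (\<delta> * m2) \<le> (C * l + k) * (\<eta> * e) + e * (\<delta> * (C * l + k))"
        using m2 \<delta> \<eta> e by (intro add_mono mult_mono) auto
      moreover have "\<dots> = e * ((\<eta> * C + \<delta> * C) * l + b)" unfolding b_def by (simp add: algebra_simps)
      moreover have "\<dots> \<le> e * (2 * \<epsilon> * l + b)"
        using \<delta> \<eta> e l by (intro mult_left_mono add_mono mult_right_mono) auto
      moreover have "e * (4 + t + b) \<le> e * (\<epsilon> / 2 * l)" using elim(3) e by (intro mult_left_mono) auto
      moreover have "\<epsilon>\<^sup>2 * (e * l) \<le> \<epsilon> * (e * l)"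
        using \<epsilon> e l by (intro mult_right_mono) (auto simp: power2_eq_square mult_left_le)
      moreover have "e * ((1 + \<epsilon>)\<^sup>2 * l) = e * l + 2 * \<epsilon> * (e * l) + \<epsilon>\<^sup>2 * (e * l)"
        by (simp add: power2_eq_square algebra_simps)
      moreover have "(1 + 6 * \<epsilon>) * e * l = e * l + 6 * (\<epsilon> * (e * l))" by (simp add: algebra_simps)
      moreover have "e * (2 * \<epsilon> * l + b) = 2 * (\<epsilon> * (e * l)) + e * b" by (simp add: algebra_simps)
      moreover have "e * (4 + t + b) = 4 * e + t * e + e * b" by (simp add: algebra_simps)
      moreover have "e * (\<epsilon> / 2 * l) = \<epsilon> * (e * l) / 2" "\<epsilon> / 2 * e * l = \<epsilon> * (e * l) / 2" by simp_all
      moreover note elim(2)[folded e_def]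
      ultimately have "real m1 * m1 + e * ((1 + \<epsilon>)\<^sup>2 * l) + 4 * e + t * e + real m2 * m2
        + m2 * (\<eta> * e + n0) + m2 * (M2 * c) + e * (\<delta> * m2) \<le> (1 + 6 * \<epsilon>) * e * l"
        unfolding distrib_left[of "real m2" "\<eta> * e" n0] by linarith
      then show "(real M1 + real M2) * L * N + L * t \<le> exp (\<kappa> * l) \<and>
        real m1 * m1 + exp (\<kappa> * l) * ((1 + \<epsilon>)\<^sup>2 * l) + 4 * exp (\<kappa> * l) + t * exp (\<kappa> * l) + real m2 * m2
          + m2 * (\<eta> * exp (\<kappa> * l) + ((real M1 + real M2) * L * N + L * t)) + m2 * (M2 * c) + exp (\<kappa> * l)
              * (\<delta> * m2)
        \<le> (1 + 6 * \<epsilon>) * exp (\<kappa> * l) * l"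


        using w elim(1) unfolding e_def n0_def by linarith
    qed
  qed
qed


lemma nat_ceiling_div_mult:
  fixes x :: real and N :: nat
  assumes "0 \<le> x" "0 < N"
  shows "x \<le> real (nat \<lceil>x / N\<rceil> * N)" "real (nat \<lceil>x / N\<rceil> * N) \<le> x + N" "real (nat \<lceil>x / N\<rceil>) \<le> x + 1"
proof -
  define M where "M = nat \<lceil>x / N\<rceil>"
  have M: "x / N \<le> real M" "real M \<le> x / N + 1" unfolding M_def using assms by (auto intro: of_nat_ceiling)
  show "x \<le> real (nat \<lceil>x / N\<rceil> * N)" using M(1) assms unfolding M_def[symmetric] by (simp add: field_simps)
  show "real (nat \<lceil>x / N\<rceil> * N) \<le> x + N" using M(2) assms unfolding M_def[symmetric]
      by (simp add: field_simps)
  have "x / N \<le> x" using assms mult_left_mono[of 1 "real N" x] by (simp add: field_simps)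
  then show "real (nat \<lceil>x / N\<rceil>) \<le> x + 1" using M(2) unfolding M_def by linarith
qed

section \<open>Choice of all parameters for a fixed \<epsilon>\<close>

context star_graph
begin

text \<open>A single injection of a disjoint sum of index sets into the vertex set gives all
  reservoirs together with their disjointness.\<close>

lemma random_host_exists:
  fixes p :: real
  assumes min: "minimal_conf Is Rs Ts ka kb" and rich: "rich Rs N EG \<delta>" and \<delta>: "0 < \<delta>" and p: "0 < p"
      "p < 1"
    and pos: "0 < M1" "0 < M2" "0 < L"
    and n: "(M1 + M2) * L * N + L * card (Emb Rs N EG \<times> {..<K} \<times> Ts) \<le> n"
  shows "\<exists>p1 p2 p3. random_host F u v Is Rs Ts ka kb N EG \<delta> p n M1 M2 L K p1 p2 p3"
proof -
  let ?TI = "Emb Rs N EG \<times> {..<K} \<times> Ts"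
  have "Rs \<subseteq> V" "Ts \<subseteq> V" using min unfolding minimal_conf_def conf_def by auto
  then have fTI: "finite ?TI" using finite_V finite_Emb
      by (meson finite_SigmaI finite_lessThan finite_subset)
  let ?A = "({..<M1} \<times> {..<L} \<times> {..<N}) <+> ({..<M2} \<times> {..<L} \<times> {..<N})"
  let ?D = "?A <+> ({..<L} \<times> ?TI)"
  have fA: "finite ?A" by simp
  have "finite ?D" using fA fTI by simp
  moreover have "card ?D = (M1 + M2) * L * N + L * card ?TI"
    using fTI by (simp add: card_Plus card_cartesian_product algebra_simps)
  ultimately obtain f where f: "inj_on f ?D" "f ` ?D \<subseteq> {1..n}"
    using n by (metis card_le_inj card_atLeastAtMost diff_Suc_1 finite_atLeastAtMost)
  have fin: "x \<in> ?D \<Longrightarrow> f x \<in> {1..n}" for x using f(2) by blast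
  have feq: "x \<in> ?D \<Longrightarrow> y \<in> ?D \<Longrightarrow> f x = f y \<longleftrightarrow> x = y" for x y using f(1) by (auto dest: inj_onD)
  have D1: "Inl (Inl (g, b, i)) \<in> ?D" if "g < M1" "b < L" "i < N" for g b i using that
      by (auto simp: Plus_def)
  have D2: "Inl (Inr (g, b, i)) \<in> ?D" if "g < M2" "b < L" "i < N" for g b i using that
      by (auto simp: Plus_def)
  have D3: "Inr (b, q) \<in> ?D" if "b < L" "q \<in> ?TI" for b q using that by (auto simp: Plus_def)
  have "random_host F u v Is Rs Ts ka kb N EG \<delta> p n M1 M2 L K
    (\<lambda>g b i. f (Inl (Inl (g, b, i)))) (\<lambda>g b i. f (Inl (Inr (g, b, i)))) (\<lambda>b q. f (Inr (b, q)))"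
  proof (intro random_host.intro random_host_axioms.intro star_graph_axioms min rich \<delta> p pos)
    show "inj_on (\<lambda>(g, b, i). f (Inl (Inl (g, b, i)))) ({..<M1} \<times> {..<L} \<times> {..<N})"
      by (rule inj_onI) (clarsimp simp: feq D1)
    show "inj_on (\<lambda>(g, b, i). f (Inl (Inr (g, b, i)))) ({..<M2} \<times> {..<L} \<times> {..<N})"
      by (rule inj_onI) (clarsimp simp: feq D2)
    show "inj_on (\<lambda>(b, q). f (Inr (b, q))) ({..<L} \<times> ?TI)"
      by (rule inj_onI) (clarsimp simp: feq D3)
    show "f (Inl (Inl (g, b, i))) \<in> {1..n}" if "g < M1" "b < L" "i < N" for g b i using fin[OF D1] that
        by blast
    show "f (Inl (Inr (g, b, i))) \<in> {1..n}" if "g < M2" "b < L" "i < N" for g b i using fin[OF D2] that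
        by blast
    show "f (Inr (b, q)) \<in> {1..n}" if "b < L" "q \<in> ?TI" for b q using fin[OF D3] that by blast
    show "f (Inl (Inl (g, b, i))) \<noteq> f (Inl (Inr (g', b', i')))"
      if "g < M1" "b < L" "i < N" "g' < M2" "b' < L" "i' < N" for g b i g' b' i'
      using feq[OF D1[OF that(1-3)] D2[OF that(4-6)]] by simp
    show "f (Inl (Inl (g, b, i))) \<noteq> f (Inr (b', q))"
      if "g < M1" "b < L" "i < N" "b' < L" "q \<in> ?TI" for g b i b' q
      using feq[OF D1[OF that(1-3)] D3[OF that(4-5)]] by simp
    show "f (Inl (Inr (g, b, i))) \<noteq> f (Inr (b', q))"
      if "g < M2" "b < L" "i < N" "b' < L" "q \<in> ?TI" for g b i b' q
      using feq[OF D2[OF that(1-3)] D3[OF that(4-5)]] by simp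
  qed
  then show ?thesis by blast
qed

text \<open>The order of choice matters: first \<open>C\<close> and \<open>\<delta>\<close> from
  \<open>\<epsilon>\<close>, then \<open>\<Gamma>\<close> and thereby \<open>N\<close>, then
  \<open>K\<close>, and only then \<open>n\<close>. The bodies may cost only a constant number of
  edges per vertex, so \<open>K\<close> is constant, and the probability of too many bad vertices is
  made at most \<open>\<epsilon> / 2\<close> instead of tending to \<open>0\<close>.\<close>

lemma eventually_prob_sat_le:
  fixes p \<epsilon> :: real
  assumes p: "0 < p" "p < 1" and \<epsilon>: "0 < \<epsilon>" "\<epsilon> \<le> 1"
  shows "\<forall>\<^sub>F n in sequentially. 1 - \<epsilon> \<le> measure_pmf.prob (gnp n p)
    {G. real (sat G F) \<le> (1 + 6 * \<epsilon>) * real n * log (1 / (1 - p)) (real n)}"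
proof -
  define \<kappa> where "\<kappa> = - ln (1 - p)"
  define a where "a = (1 + \<epsilon>) / p"
  have \<kappa>: "0 < \<kappa>" unfolding \<kappa>_def using p by simp
  have a: "0 < a" unfolding a_def using p \<epsilon> by simp
  obtain z1 z2 z3 C \<delta> :: real
    where z: "0 < z1" "z1 \<le> 1" "1 \<le> z2" "0 < z3" "z3 \<le> 1" and C: "0 < C" and \<delta>: "0 < \<delta>" "\<delta> * C \<le> \<epsilon>"
    and G: "a * ln (1 - p + p * z1) < (1 + \<epsilon> / 2) * ln z1"
      "a * ln (1 - p + p * z2) < (1 + \<epsilon>)\<^sup>2 * ln z2"
      "\<kappa> + (1 + \<epsilon> / 2) * ln (1 - p + p * z3) - \<delta> * a * ln z3 < 0"
      "\<kappa> + C * (ln (1 - p / 2) + p / 2 * ln 2) < 0"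
      "2 * \<kappa> + C * (p / 2 * ln (1 - p / 2) + \<delta> * ln 2) < 0"
    using tail_parameters[OF p \<epsilon>(1) \<kappa>_def a_def] by blast
  obtain Is Rs Ts ka kb where min: "minimal_conf Is Rs Ts ka kb" using minimal_conf_exists by blast
  then have conf: "conf Is Rs Ts" unfolding minimal_conf_def by blast
  have "Rs \<subseteq> V" "deg Rs" using conf unfolding conf_def by auto
  moreover have "Rs \<noteq> {}" using conf_crossing(2)[OF conf] by blast
  ultimately obtain N EG where rich: "rich Rs N EG \<delta>" using rich_exists \<delta>(1) by blast
  have N: "0 < N" using rich unfolding rich_def by blast
  \<comment> \<open>A bad vertex may be adjacent to all of \<open>A2\<close>, which has about
    \<open>C * l\<close> vertices; this fraction keeps their total near
    \<open>\<epsilon> * n * l\<close>.\<close>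
  define \<eta> where "\<eta> = \<epsilon> / C"
  have \<eta>: "0 < \<eta>" "\<eta> * C \<le> \<epsilon>" unfolding \<eta>_def using \<epsilon> C by auto
  let ?e = "real (card (Emb Rs N EG))"
  have "(\<lambda>K. ?e * (1 - p ^ card Ts) ^ K / \<eta>) \<longlonglongrightarrow> ?e * 0 / \<eta>"
    using p by (intro tendsto_intros LIMSEQ_realpow_zero) (use \<eta>(1) in \<open>auto simp: power_le_one\<close>)
  then have "\<forall>\<^sub>F K in sequentially. ?e * (1 - p ^ card Ts) ^ K / \<eta> < \<epsilon> / 2"
    using \<epsilon> by (intro order_tendstoD) auto
  then obtain K where K: "?e * (1 - p ^ card Ts) ^ K / \<eta> < \<epsilon> / 2"
    using eventually_happens'[OF sequentially_bot] by blast
  define TI where "TI = Emb Rs N EG \<times> {..<K} \<times> Ts"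
  define rr where "rr = N * N + N * card TI + card TI * card TI"
  define q where "q = p ^ rr"
  define c where "c = ?e * K * card V"
  have rr: "0 < rr" unfolding rr_def using N by simp
  have q: "0 < q" "q < 1" unfolding q_def using p rr by (auto simp: power_less_one_iff)
  have c: "0 \<le> c" unfolding c_def by simp
  have t: "0 \<le> real (card TI)" by simp
  have \<gamma>: "0 < \<epsilon> / 2" using \<epsilon> by simp
  define l where "l n = log (1 / (1 - p)) (real n)" for n :: nat
  have l_ln: "l n = ln (real n) / \<kappa>" for n unfolding l_def \<kappa>_def log_def using p by (simp add: ln_div)
  have "filterlim (\<lambda>n. ln (real n) / \<kappa>) at_top sequentially" using \<kappa> by real_asymp
  then have lim: "filterlim l at_top sequentially" unfolding l_ln[symmetric] .
  have ev_l: "\<forall>\<^sub>F n in sequentially. Q (l n)" if "\<forall>\<^sub>F x in at_top. Q x" for Q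
    using lim that by (simp add: filterlim_iff)
  note E1 = ev_l[OF tail_terms_small[OF p \<epsilon>(1) \<gamma> \<kappa> a C N q t \<delta>(1) z G]]
  note E2 = ev_l[OF edge_bound_asymptotic[OF \<epsilon> \<kappa> a C t c \<delta> \<eta>, of N]]
  have E3: "\<forall>\<^sub>F n in sequentially. 0 < l n" using ev_l[OF eventually_gt_at_top] .
  have E4: "\<forall>\<^sub>F n::nat in sequentially. 0 < n" by (rule eventually_gt_at_top)
  show ?thesis using E1 E2 E3 E4
  proof eventually_elim
    case (elim n)
    define x where "x = l n"
    have x: "0 < x" using elim(3) unfolding x_def .
    \<comment> \<open>This identity returns the estimates in terms of \<open>l\<close> to statements
      about \<open>n\<close>.\<close>
    have ex: "exp (\<kappa> * x) = real n" unfolding x_def l_ln using \<kappa> elim(4) by simp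
    define M1 M2 L where "M1 = nat \<lceil>a * x / N\<rceil>" and "M2 = nat \<lceil>C * x / N\<rceil>" and "L = nat \<lceil>x\<rceil>"
    have pos: "0 < M1" "0 < M2" "0 < L" unfolding M1_def M2_def L_def using x a C N by auto
    have A: "a * x \<le> real (M1 * N)" "real (M1 * N) \<le> a * x + N" "real M1 \<le> a * x + 1"
      unfolding M1_def using nat_ceiling_div_mult[of "a * x" N] a x N by auto
    have B: "C * x \<le> real (M2 * N)" "real (M2 * N) \<le> C * x + N" "real M2 \<le> C * x + 1"
      unfolding M2_def using nat_ceiling_div_mult[of "C * x" N] C x N by auto
    have D: "x \<le> L" "L \<le> x + 1" unfolding L_def using x by (auto intro: of_nat_ceiling)
    define n0 where "n0 = (real M1 + real M2) * L * N + real L * real (card TI)"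
    have n0: "real ((M1 + M2) * L * N + L * card TI) = n0" unfolding n0_def by simp
    note T = elim(1)[folded x_def, rule_format, OF conjI[OF A(1) conjI[OF A(2) conjI[OF B(1) conjI[OF B(2)
      conjI[OF A(3) conjI[OF B(3) conjI[OF D]]]]]]], unfolded ex]
    note U = elim(2)[folded x_def, rule_format, OF conjI[OF A(1) conjI[OF A(2) conjI[OF B(1) conjI[OF B(2)
      conjI[OF A(3) conjI[OF B(3) conjI[OF D]]]]]]], unfolded ex, folded n0_def]
    have "(M1 + M2) * L * N + L * card TI \<le> n" using U n0 by (metis of_nat_le_iff)
    then obtain p1 p2 p3 where "random_host F u v Is Rs Ts ka kb N EG \<delta> p n M1 M2 L K p1 p2 p3"
      using random_host_exists[OF min rich \<delta>(1) p pos] unfolding TI_def by blast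
    then interpret random_host F u v Is Rs Ts ka kb N EG \<delta> p n M1 M2 L K p1 p2 p3 .
    have d': "0 \<le> (1 + \<epsilon>)\<^sup>2 * x" using x by simp
    let ?f = "pfail z1 z2 z3 ((1 + \<epsilon> / 2) * x) ((1 + \<epsilon>)\<^sup>2 * x) (p / 2 * real (M2 * N)) \<eta>"
    have "?f \<le> \<epsilon> / 2 + \<epsilon> / 2"
      using add_mono[OF T less_imp_le[OF K]]
      unfolding pfail_def rq_def q_def rr_def TI_def of_nat_add of_nat_mult .
    then have f: "?f \<le> \<epsilon>" by simp
    let ?b = "real (M1 * N) * real (M1 * N) + n * ((1 + \<epsilon>)\<^sup>2 * x) + 4 * n + card TI * real n + real (M2 *
        N) * real (M2 * N)
      + real (M2 * N) * (\<eta> * n + n0) + real (M2 * N) * (M2 * card (Emb Rs N EG) * K * card V) + n * (\<delta> *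
          real (M2 * N))"
    have "1 - ?f \<le> measure_pmf.prob (gnp n p) {G. real (sat G F) \<le> ?b}"
      using prob_sat_le[OF z d' \<eta>(1) elim(4) n0[unfolded TI_def] refl refl,
        of "(1 + \<epsilon> / 2) * x" "p / 2 * real (M2 * N)"] unfolding TI_def .
    also have "\<dots> \<le> measure_pmf.prob (gnp n p) {G. real (sat G F) \<le> (1 + 6 * \<epsilon>) * real n * x}"
    proof -
      have "?b \<le> (1 + 6 * \<epsilon>) * real n * x" using U unfolding c_def by (simp add: mult.assoc)
      then show ?thesis by (intro measure_pmf.finite_measure_mono) auto
    qed
    finally show ?case using f unfolding x_def l_def by linarith
  qed
qed

end

text \<open>A diagonal argument: at \<open>n\<close> the smallest tolerance \<open>r k\<close> with
  \<open>k \<le> n\<close> is used whose guarantee is already in force from \<open>n\<close> on. The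
  same number serves as error in the edge bound and in the probability, so both vanish
  together.\<close>

lemma diagonal_prob_tendsto:
  fixes P :: "real \<Rightarrow> nat \<Rightarrow> real"
  assumes P: "\<And>\<epsilon>. 0 < \<epsilon> \<Longrightarrow> \<epsilon> \<le> 1 \<Longrightarrow> \<forall>\<^sub>F n in sequentially. 1 - \<epsilon> \<le> P \<epsilon> n"
    and le: "\<And>\<epsilon> n. 0 \<le> P \<epsilon> n" "\<And>\<epsilon> n. P \<epsilon> n \<le> 1"
  shows "\<exists>\<delta>. \<delta> \<longlonglongrightarrow> 0 \<and> (\<lambda>n. P (\<delta> n) n) \<longlonglongrightarrow> 1"
proof -
  define r where "r k = 1 / (real k + 1)" for k :: nat
  define S where "S n = {k. k \<le> n \<and> (\<forall>m\<ge>n. 1 - r k \<le> P (r k) m)}" for n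
  define \<delta> where "\<delta> n = r (Max (S n))" for n
  have fS: "finite (S n)" for n unfolding S_def by simp
  \<comment> \<open>Since \<open>r 0 = 1\<close>, the guarantee for \<open>k = 0\<close> only says
    that a probability is nonnegative; so the maximum is over a nonempty set from the start.\<close>
  have "0 \<in> S n" for n unfolding S_def r_def using le(1) by simp
  then have mem: "Max (S n) \<in> S n" for n using Max_in[OF fS] by blast
  have ge: "\<forall>\<^sub>F n in sequentially. k \<le> Max (S n)" for k
  proof -
    have "\<forall>\<^sub>F n in sequentially. 1 - r k \<le> P (r k) n" by (rule P) (auto simp: r_def)
    then obtain n0 where "\<And>n. n0 \<le> n \<Longrightarrow> 1 - r k \<le> P (r k) n" unfolding eventually_sequentially by blast
    then have "k \<in> S n" if "max n0 k \<le> n" for n using that unfolding S_def by auto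
    then show ?thesis unfolding eventually_sequentially using Max_ge[OF fS] by blast
  qed
  have "filterlim (\<lambda>n. Max (S n)) at_top sequentially" using ge by (simp add: filterlim_at_top)
  moreover have "r \<longlonglongrightarrow> 0" unfolding r_def by real_asymp
  ultimately have lim: "\<delta> \<longlonglongrightarrow> 0" unfolding \<delta>_def by (rule filterlim_compose[rotated])
  have "(\<lambda>n. 1 - \<delta> n) \<longlonglongrightarrow> 1 - 0" using lim by (intro tendsto_intros)
  then have lo: "(\<lambda>n. 1 - \<delta> n) \<longlonglongrightarrow> 1" by simp
  have "\<forall>\<^sub>F n in sequentially. 1 - \<delta> n \<le> P (\<delta> n) n" using mem unfolding S_def \<delta>_def by auto
  moreover have "\<forall>\<^sub>F n in sequentially. P (\<delta> n) n \<le> 1" using le by auto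
  ultimately have "(\<lambda>n. P (\<delta> n) n) \<longlonglongrightarrow> 1" by (rule tendsto_sandwich[OF _ _ lo tendsto_const])
  then show ?thesis using lim by blast
qed

theorem theorem1p8:
  fixes p :: real and F :: "'a ugraph"
  assumes "0 < p" and "p < 1"
    and "ugraph F" and "no_isolated_vertices F" and "property_star F"
  shows "\<exists>\<delta> :: nat \<Rightarrow> real. \<delta> \<longlonglongrightarrow> 0 \<and>
    (\<lambda>n. measure_pmf.prob (gnp n p)
       {G. real (sat G F) \<le> (1 + \<delta> n) * real n * log (1 / (1 - p)) (real n)}) \<longlonglongrightarrow> 1"
proof -
  obtain u v where "star_graph F u v"
    using assms(3,5) unfolding property_star_def star_graph_def by blast
  then interpret star_graph F u v .
  obtain \<delta> where \<delta>: "\<delta> \<longlonglongrightarrow> 0" "(\<lambda>n. measure_pmf.prob (gnp n p)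
      {G. real (sat G F) \<le> (1 + 6 * \<delta> n) * real n * log (1 / (1 - p)) (real n)}) \<longlonglongrightarrow> 1"
    using diagonal_prob_tendsto[of "\<lambda>\<epsilon> n. measure_pmf.prob (gnp n p)
      {G. real (sat G F) \<le> (1 + 6 * \<epsilon>) * real n * log (1 / (1 - p)) (real n)}"]
      eventually_prob_sat_le[OF assms(1,2)] by auto
  have "(\<lambda>n. 6 * \<delta> n) \<longlonglongrightarrow> 6 * 0" using \<delta>(1) by (intro tendsto_intros)
  then show ?thesis using \<delta>(2) by (intro exI[of _ "\<lambda>n. 6 * \<delta> n"]) auto
qed

end
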